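(* Let $\lambda\in X$ be a dominant weight. The affine crystals $\mathrm{QLS}(\lambda)$ and $\mathbb B(\lambda)_{\mathrm{cl}}$ are isomorphic.
   Context: Notation. $\mathfrak g$ is a finite-dimensional simple Lie algebra with node set $I$, roots $\Phi\supset\Phi^+$, highest root $\theta$, weight lattice $X$, Weyl group $W$ (reflections $r_\alpha$, length $\ell$), $\rho$ half the sum of positive roots; $\mathfrak g_{\mathrm{af}}$ is the associated untwisted affine algebra, with nodes $I_{\mathrm{af}}=I\sqcup\{0\}$, null root $\delta$, affine Weyl group $W_{\mathrm{af}}$, and positive real roots $\Phi^{\mathrm{af}+}=\Phi^+\cup\{\alpha+n\delta:\alpha\in\Phi,n>0\}$. Level-zero affine weights are $X\oplus\mathbb Z\delta$, $\mathrm{cl}:X\oplus\mathbb Z\delta\to X$ kills $\delta$, $\langle(\alpha+n\delta)^\vee,\mu\rangle=\langle\alpha^\vee,\mathrm{cl}(\mu)\rangle$ and $r_{\alpha+n\delta}(\mu)=\mu-\langle\alpha^\vee,\mathrm{cl}(\mu)\rangle(\alpha+n\delta)$. For the dominant weight $\lambda$, $J=\{i\in I:\langle\alpha_i^\vee,\lambda\rangle=0\}$, $W_J$ is the stabilizer of $\lambda$, $\Phi_J^+$ its positive roots, $\rho_J$ half their sum, $W^J$ the minimal-length representatives of $W/W_J$, $\lfloor v\rfloor$ the minimal-length element of $vW_J$. Quantum LS paths. $\mathrm{QB}(W^J)$ is the directed graph on $W^J$ with edges $w\xrightarrow{\gamma}\lfloor wr_\gamma\rfloor$, $\gamma\in\Phi^+\setminus\Phi_J^+$,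 such that either $wr_\gamma$ covers $w$ in Bruhat order, or $\ell(\lfloor wr_\gamma\rfloor)=\ell(w)+1-\langle\gamma^\vee,2\rho-2\rho_J\rangle$. A directed $\sigma$-path ($0<\sigma<1$ rational) from $y$ to $x$ is a directed path $x=w_0\xleftarrow{\gamma_1}\cdots\xleftarrow{\gamma_n}w_n=y$ in $\mathrm{QB}(W^J)$ with $\sigma\langle\gamma_k^\vee,\lambda\rangle\in\mathbb Z$ for all $k$. $\mathrm{QLS}(\lambda)$ is the set of $\eta=(x_1,\dots,x_s;\sigma_0,\dots,\sigma_s)$ with $x_u\in W^J$, $x_u\neq x_{u+1}$, rationals $0=\sigma_0<\cdots<\sigma_s=1$, and a directed $\sigma_u$-path from $x_{u+1}$ to $x_u$ for each $1\le u\le s-1$. Such $\eta$ is identified with the path $\eta(t)=\sum_{u'=1}^{u-1}(\sigma_{u'}-\sigma_{u'-1})x_{u'}\lambda+(t-\sigma_{u-1})x_u\lambda$ for $\sigma_{u-1}\le t\le\sigma_u$, in $\mathbb R\otimes X$. LS paths. $X^0_{\mathrm{af}}(\lambda)=W_{\mathrm{af}}\lambda$ is ordered by the transitive closure of $\mu<r_\beta(\mu)$ for $\beta\in\Phi^{\mathrm{af}+}$ with $\langle\beta^\vee,\mu\rangle>0$; a cover $\mu\lessdot r_\beta(\mu)$ has label $\beta$. For $\mu>\nu$ and rational $0<\sigma<1$, a $\sigma$-chain for $(\mu,\nu)$ is a sequence of covers $\mu=\xi_0\gtrdot\xi_1\gtrdot\cdots\gtrdot\xi_n=\nu$ with $\sigma\langle\gamma_k^\vee,\xi_{k-1}\rangle\in\mathbb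 Z$ for all $k$, $\gamma_k$ being the label of $\xi_{k-1}\gtrdot\xi_k$. $\mathbb B(\lambda)$ is the set of LS paths of shape $\lambda$: pairs $\pi=(\nu_1>\cdots>\nu_s;\,0=\sigma_0<\cdots<\sigma_s=1)$ with $\nu_u\in X^0_{\mathrm{af}}(\lambda)$, $\sigma_u\in\mathbb Q$ and a $\sigma_u$-chain for $(\nu_u,\nu_{u+1})$ for $1\le u\le s-1$; $\pi$ is identified with the path $\pi(t)=\sum_{u'=1}^{u-1}(\sigma_{u'}-\sigma_{u'-1})\nu_{u'}+(t-\sigma_{u-1})\nu_u$ for $\sigma_{u-1}\le t\le\sigma_u$. $\mathbb B(\lambda)_{\mathrm{cl}}=\{\mathrm{cl}(\pi):\pi\in\mathbb B(\lambda)\}$, with $\mathrm{cl}(\pi)(t)=\mathrm{cl}(\pi(t))\in\mathbb R\otimes X$. Crystal structure, on both sets of paths $\eta:[0,1]\to\mathbb R\otimes X$: $\mathrm{wt}(\eta)=\eta(1)$; on $X$ the coroot $\alpha_0^\vee$ acts as $-\theta^\vee$; $\tilde\alpha_i=\alpha_i$, $s_i=r_i$ for $i\in I$, and $\tilde\alpha_0=-\theta$, $s_0=r_\theta$. For $i\in I_{\mathrm{af}}$ let $H(t)=\langle\alpha_i^\vee,\eta(t)\rangle$, $m=\min H$ (an integer $\le0$). If $m=0$, $e_i\eta=\mathbf 0$; otherwise let $t_1=\min\{t:H(t)=m\}$, $t_0=\max\{t\le t_1:H(t)=m+1\}$, and $(e_i\eta)(t)=\eta(t)$ for $t\le t_0$,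 $\eta(t_0)+s_i(\eta(t)-\eta(t_0))$ for $t_0\le t\le t_1$, $\eta(t)+\tilde\alpha_i$ for $t\ge t_1$. If $H(1)=m$, $f_i\eta=\mathbf 0$; otherwise let $t_0=\max\{t:H(t)=m\}$, $t_1=\min\{t\ge t_0:H(t)=m+1\}$, and $(f_i\eta)(t)=\eta(t)$ for $t\le t_0$, $\eta(t_0)+s_i(\eta(t)-\eta(t_0))$ for $t_0\le t\le t_1$, $\eta(t)-\tilde\alpha_i$ for $t\ge t_1$. An isomorphism of affine crystals is a bijection commuting with $\mathrm{wt}$ and all $e_i,f_i$, $i\in I_{\mathrm{af}}$. *)

theory Defs
  imports "HOL-Analysis.Analysis"
begin

section \<open>Simple Lie algebras, through their root data\<close>

(* cpair a v is the pairing of the coroot of a with v; it is 0 for a = 0. *)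
definition cpair :: "'a::real_inner \<Rightarrow> 'a \<Rightarrow> real" where
  "cpair a v = 2 * (a \<bullet> v) / (a \<bullet> a)"

definition refl_root :: "'a::real_inner \<Rightarrow> 'a \<Rightarrow> 'a" where
  "refl_root a v = v - cpair a v *\<^sub>R a"

(* A finite-dimensional simple Lie algebra enters only through its root system, an irreducible
   reduced crystallographic root system Phi, with the simple roots alpha_i indexed by the node
   set I = UNIV :: 'i set. The ambient Euclidean space is R (x) X, with a Weyl group invariant
   inner product; coroots are represented by the functionals cpair. *)
locale simple_root_system =
  fixes \<Phi> :: "'a::euclidean_space set" and \<alpha> :: "'i::finite \<Rightarrow> 'a"
  assumes finite_roots: "finite \<Phi>"
    and span_roots: "span \<Phi> = UNIV"
    and zero_not_root: "0 \<notin> \<Phi>"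
    and refl_closed: "\<And>a b. a \<in> \<Phi> \<Longrightarrow> b \<in> \<Phi> \<Longrightarrow> refl_root a b \<in> \<Phi>"
    and crystallographic: "\<And>a b. a \<in> \<Phi> \<Longrightarrow> b \<in> \<Phi> \<Longrightarrow> cpair a b \<in> \<int>"
    and reduced: "\<And>a c. a \<in> \<Phi> \<Longrightarrow> c *\<^sub>R a \<in> \<Phi> \<Longrightarrow> c = 1 \<or> c = -1"
    and irreducible: "\<And>A B. A \<union> B = \<Phi> \<Longrightarrow> A \<inter> B = {} \<Longrightarrow> \<forall>a\<in>A. \<forall>b\<in>B. a \<bullet> b = 0
        \<Longrightarrow> A = {} \<or> B = {}"
    and simple_roots: "\<And>i. \<alpha> i \<in> \<Phi>"
    and simple_inj: "inj \<alpha>"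
    and simple_indep: "independent (range \<alpha>)"
    and simple_base: "\<And>b. b \<in> \<Phi> \<Longrightarrow>
        \<exists>c :: 'i \<Rightarrow> nat. b = (\<Sum>i\<in>UNIV. real (c i) *\<^sub>R \<alpha> i) \<or> b = - (\<Sum>i\<in>UNIV. real (c i) *\<^sub>R \<alpha> i)"

section \<open>Piecewise linear paths\<close>

(* The path attached to (v_1,...,v_s; sigma_0,...,sigma_s). Paths on [0,1] are extensional
   functions (undefined outside [0,1]), so that equality of paths is equality of functions. *)
definition pl_path :: "nat \<Rightarrow> (nat \<Rightarrow> 'v::real_vector) \<Rightarrow> (nat \<Rightarrow> real) \<Rightarrow> real \<Rightarrow> 'v" where
  "pl_path s v \<sigma> = (\<lambda>t\<in>{0..1}.
     let u = (LEAST u. 1 \<le> u \<and> u \<le> s \<and> \<sigma> (u - 1) \<le> t \<and> t \<le> \<sigma> u)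
     in (\<Sum>u'\<in>{1..<u}. (\<sigma> u' - \<sigma> (u' - 1)) *\<^sub>R v u') + (t - \<sigma> (u - 1)) *\<^sub>R v u)"

definition rational_partition :: "nat \<Rightarrow> (nat \<Rightarrow> real) \<Rightarrow> bool" where
  "rational_partition s \<sigma> \<longleftrightarrow> \<sigma> 0 = 0 \<and> \<sigma> s = 1 \<and>
     (\<forall>u\<le>s. \<sigma> u \<in> \<rat>) \<and> (\<forall>u<s. \<sigma> u < \<sigma> (Suc u))"

context simple_root_system
begin

section \<open>The finite root system and its Weyl group\<close>

definition root_cone :: "'a set" where
  "root_cone = {(\<Sum>i\<in>UNIV. real (c i) *\<^sub>R \<alpha> i) | c :: 'i \<Rightarrow> nat. True}"

definition pos_roots :: "'a set" where
  "pos_roots = \<Phi> \<inter> root_cone"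

definition highest_root :: 'a where
  "highest_root = (THE b. b \<in> \<Phi> \<and> (\<forall>a\<in>\<Phi>. b - a \<in> root_cone))"

definition weight_lattice :: "'a set" where
  "weight_lattice = {v. \<forall>a\<in>\<Phi>. cpair a v \<in> \<int>}"

definition dominant_weight :: "'a \<Rightarrow> bool" where
  "dominant_weight \<Lambda> \<longleftrightarrow> \<Lambda> \<in> weight_lattice \<and> (\<forall>i. 0 \<le> cpair (\<alpha> i) \<Lambda>)"

definition word :: "'i list \<Rightarrow> 'a \<Rightarrow> 'a" where
  "word is = foldr (\<lambda>i w. refl_root (\<alpha> i) \<circ> w) is id"

definition weyl_group :: "('a \<Rightarrow> 'a) set" where
  "weyl_group = range word"

definition len :: "('a \<Rightarrow> 'a) \<Rightarrow> nat" where
  "len w = (LEAST n. \<exists>is. length is = n \<and> word is = w)"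

definition bruhat_less :: "('a \<Rightarrow> 'a) \<Rightarrow> ('a \<Rightarrow> 'a) \<Rightarrow> bool" where
  "bruhat_less = tranclp (\<lambda>w w'. w \<in> weyl_group \<and>
     (\<exists>\<gamma>\<in>pos_roots. w' = w \<circ> refl_root \<gamma> \<and> len w < len w'))"

definition bruhat_cover :: "('a \<Rightarrow> 'a) \<Rightarrow> ('a \<Rightarrow> 'a) \<Rightarrow> bool" where
  "bruhat_cover w w' \<longleftrightarrow> bruhat_less w w' \<and> \<not> (\<exists>z. bruhat_less w z \<and> bruhat_less z w')"

definition rho :: 'a where
  "rho = (1/2) *\<^sub>R (\<Sum>b\<in>pos_roots. b)"

(* The subscript J is the set of nodes i with cpair (alpha i) Lambda = 0, so
   the objects depend on J only through the weight Lambda (the lambda of QLS(lambda)). *)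
definition stab :: "'a \<Rightarrow> ('a \<Rightarrow> 'a) set" where
  "stab \<Lambda> = {w \<in> weyl_group. w \<Lambda> = \<Lambda>}"

definition pos_roots_J :: "'a \<Rightarrow> 'a set" where
  "pos_roots_J \<Lambda> = {b \<in> pos_roots. refl_root b \<in> stab \<Lambda>}"

definition rho_J :: "'a \<Rightarrow> 'a" where
  "rho_J \<Lambda> = (1/2) *\<^sub>R (\<Sum>b\<in>pos_roots_J \<Lambda>. b)"

definition min_reps :: "'a \<Rightarrow> ('a \<Rightarrow> 'a) set" where
  "min_reps \<Lambda> = {w \<in> weyl_group. \<forall>u\<in>stab \<Lambda>. len w \<le> len (w \<circ> u)}"

definition min_rep :: "'a \<Rightarrow> ('a \<Rightarrow> 'a) \<Rightarrow> 'a \<Rightarrow> 'a" where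
  "min_rep \<Lambda> v = (THE w. w \<in> min_reps \<Lambda> \<and> (\<exists>u\<in>stab \<Lambda>. w = v \<circ> u))"

section \<open>Quantum LS paths\<close>

definition qb_edge :: "'a \<Rightarrow> ('a \<Rightarrow> 'a) \<Rightarrow> 'a \<Rightarrow> ('a \<Rightarrow> 'a) \<Rightarrow> bool" where
  "qb_edge \<Lambda> w \<gamma> w' \<longleftrightarrow> w \<in> min_reps \<Lambda> \<and> \<gamma> \<in> pos_roots - pos_roots_J \<Lambda> \<and>
     w' = min_rep \<Lambda> (w \<circ> refl_root \<gamma>) \<and>
     (bruhat_cover w (w \<circ> refl_root \<gamma>) \<or>
      real (len w') = real (len w) + 1 - cpair \<gamma> (2 *\<^sub>R rho - 2 *\<^sub>R rho_J \<Lambda>))"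

(* a directed \<sigma>-path from y to x *)
definition qb_sigma_path :: "'a \<Rightarrow> real \<Rightarrow> ('a \<Rightarrow> 'a) \<Rightarrow> ('a \<Rightarrow> 'a) \<Rightarrow> bool" where
  "qb_sigma_path \<Lambda> \<sigma> y x \<longleftrightarrow>
     (\<lambda>w w'. \<exists>\<gamma>. qb_edge \<Lambda> w \<gamma> w' \<and> \<sigma> * cpair \<gamma> \<Lambda> \<in> \<int>)\<^sup>*\<^sup>* y x"

definition is_qls :: "'a \<Rightarrow> nat \<Rightarrow> (nat \<Rightarrow> 'a \<Rightarrow> 'a) \<Rightarrow> (nat \<Rightarrow> real) \<Rightarrow> bool" where
  "is_qls \<Lambda> s x \<sigma> \<longleftrightarrow> rational_partition s \<sigma> \<and>
     (\<forall>u\<in>{1..s}. x u \<in> min_reps \<Lambda>) \<and>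
     (\<forall>u\<in>{1..<s}. x u \<noteq> x (u + 1) \<and> qb_sigma_path \<Lambda> (\<sigma> u) (x (u + 1)) (x u))"

definition QLS :: "'a \<Rightarrow> (real \<Rightarrow> 'a) set" where
  "QLS \<Lambda> = {pl_path s (\<lambda>u. x u \<Lambda>) \<sigma> | s x \<sigma>. is_qls \<Lambda> s x \<sigma>}"

section \<open>LS paths\<close>

(* A level-zero affine weight mu + n delta is the pair (mu, n), and cl is fst. *)
definition aff_pos_real_roots :: "('a \<times> real) set" where
  "aff_pos_real_roots = {(a, 0) | a. a \<in> pos_roots} \<union> {(a, of_int n) | a n. a \<in> \<Phi> \<and> n > 0}"

definition aff_refl :: "'a \<times> real \<Rightarrow> 'a \<times> real \<Rightarrow> 'a \<times> real" where
  "aff_refl \<beta> \<mu> = \<mu> - cpair (fst \<beta>) (fst \<mu>) *\<^sub>R \<beta>"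

(* The node set of the affine algebra is 'i option, None being the node 0;
   alpha_0 = delta - theta. *)
fun aff_simple :: "'i option \<Rightarrow> 'a \<times> real" where
  "aff_simple None = (- highest_root, 1)"
| "aff_simple (Some i) = (\<alpha> i, 0)"

definition aff_weyl_group :: "('a \<times> real \<Rightarrow> 'a \<times> real) set" where
  "aff_weyl_group = {foldr (\<lambda>i w. aff_refl (aff_simple i) \<circ> w) is id | is. True}"

definition aff_orbit :: "'a \<Rightarrow> ('a \<times> real) set" where
  "aff_orbit \<Lambda> = {w (\<Lambda>, 0) | w. w \<in> aff_weyl_group}"

definition aff_less :: "'a \<Rightarrow> 'a \<times> real \<Rightarrow> 'a \<times> real \<Rightarrow> bool" where
  "aff_less \<Lambda> = tranclp (\<lambda>\<mu> \<nu>. \<mu> \<in> aff_orbit \<Lambda> \<and>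
     (\<exists>\<beta>\<in>aff_pos_real_roots. 0 < cpair (fst \<beta>) (fst \<mu>) \<and> \<nu> = aff_refl \<beta> \<mu>))"

(* \<nu> covers \<mu>, with label \<beta> *)
definition aff_cover :: "'a \<Rightarrow> 'a \<times> real \<Rightarrow> 'a \<times> real \<Rightarrow> 'a \<times> real \<Rightarrow> bool" where
  "aff_cover \<Lambda> \<mu> \<beta> \<nu> \<longleftrightarrow> \<mu> \<in> aff_orbit \<Lambda> \<and> \<beta> \<in> aff_pos_real_roots \<and>
     0 < cpair (fst \<beta>) (fst \<mu>) \<and> \<nu> = aff_refl \<beta> \<mu> \<and>
     \<not> (\<exists>\<xi>. aff_less \<Lambda> \<mu> \<xi> \<and> aff_less \<Lambda> \<xi> \<nu>)"

definition sigma_chain :: "'a \<Rightarrow> real \<Rightarrow> 'a \<times> real \<Rightarrow> 'a \<times> real \<Rightarrow> bool" where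
  "sigma_chain \<Lambda> \<sigma> \<mu> \<nu> \<longleftrightarrow>
     (\<lambda>\<xi> \<xi>'. \<exists>\<gamma>. aff_cover \<Lambda> \<xi>' \<gamma> \<xi> \<and> \<sigma> * cpair (fst \<gamma>) (fst \<xi>) \<in> \<int>)\<^sup>*\<^sup>* \<mu> \<nu>"

definition is_ls :: "'a \<Rightarrow> nat \<Rightarrow> (nat \<Rightarrow> 'a \<times> real) \<Rightarrow> (nat \<Rightarrow> real) \<Rightarrow> bool" where
  "is_ls \<Lambda> s \<nu> \<sigma> \<longleftrightarrow> rational_partition s \<sigma> \<and>
     (\<forall>u\<in>{1..s}. \<nu> u \<in> aff_orbit \<Lambda>) \<and>
     (\<forall>u\<in>{1..<s}. aff_less \<Lambda> (\<nu> (u + 1)) (\<nu> u) \<and> sigma_chain \<Lambda> (\<sigma> u) (\<nu> u) (\<nu> (u + 1)))"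

definition LS :: "'a \<Rightarrow> (real \<Rightarrow> 'a \<times> real) set" where
  "LS \<Lambda> = {pl_path s \<nu> \<sigma> | s \<nu> \<sigma>. is_ls \<Lambda> s \<nu> \<sigma>}"

definition cl_path :: "(real \<Rightarrow> 'a \<times> real) \<Rightarrow> real \<Rightarrow> 'a" where
  "cl_path \<pi> = (\<lambda>t\<in>{0..1}. fst (\<pi> t))"

definition LS_cl :: "'a \<Rightarrow> (real \<Rightarrow> 'a) set" where
  "LS_cl \<Lambda> = cl_path ` LS \<Lambda>"

section \<open>The crystal structure on paths\<close>

definition wt :: "(real \<Rightarrow> 'a) \<Rightarrow> 'a" where
  "wt \<eta> = \<eta> 1"

fun cl_simple :: "'i option \<Rightarrow> 'a" where
  "cl_simple None = - highest_root"
| "cl_simple (Some i) = \<alpha> i"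

fun cl_refl :: "'i option \<Rightarrow> 'a \<Rightarrow> 'a" where
  "cl_refl None = refl_root highest_root"
| "cl_refl (Some i) = refl_root (\<alpha> i)"

fun cl_coroot :: "'i option \<Rightarrow> 'a \<Rightarrow> real" where
  "cl_coroot None v = - cpair highest_root v"
| "cl_coroot (Some i) v = cpair (\<alpha> i) v"

definition min_height :: "'i option \<Rightarrow> (real \<Rightarrow> 'a) \<Rightarrow> real" where
  "min_height i \<eta> = (LEAST h. h \<in> (\<lambda>t. cl_coroot i (\<eta> t)) ` {0..1})"

(* None is the extra element 0 of the crystal. *)
definition crystal_e :: "'i option \<Rightarrow> (real \<Rightarrow> 'a) \<Rightarrow> (real \<Rightarrow> 'a) option" where
  "crystal_e i \<eta> =
    (let H = (\<lambda>t. cl_coroot i (\<eta> t)); m = min_height i \<eta>;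
         t1 = (LEAST t. t \<in> {0..1} \<and> H t = m);
         t0 = (GREATEST t. t \<in> {0..t1} \<and> H t = m + 1)
     in if m = 0 then None
        else Some (\<lambda>t\<in>{0..1}.
          if t \<le> t0 then \<eta> t
          else if t \<le> t1 then \<eta> t0 + cl_refl i (\<eta> t - \<eta> t0)
          else \<eta> t + cl_simple i))"

definition crystal_f :: "'i option \<Rightarrow> (real \<Rightarrow> 'a) \<Rightarrow> (real \<Rightarrow> 'a) option" where
  "crystal_f i \<eta> =
    (let H = (\<lambda>t. cl_coroot i (\<eta> t)); m = min_height i \<eta>;
         t0 = (GREATEST t. t \<in> {0..1} \<and> H t = m);
         t1 = (LEAST t. t \<in> {t0..1} \<and> H t = m + 1)
     in if H 1 = m then None
        else Some (\<lambda>t\<in>{0..1}.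
          if t \<le> t0 then \<eta> t
          else if t \<le> t1 then \<eta> t0 + cl_refl i (\<eta> t - \<eta> t0)
          else \<eta> t - cl_simple i))"

(* A set of paths is a crystal for these operators when they map it to itself together with 0. *)
definition affine_crystal :: "(real \<Rightarrow> 'a) set \<Rightarrow> bool" where
  "affine_crystal B \<longleftrightarrow>
     (\<forall>\<eta>\<in>B. \<forall>i. set_option (crystal_e i \<eta>) \<subseteq> B \<and> set_option (crystal_f i \<eta>) \<subseteq> B)"

definition affine_crystal_iso ::
  "(real \<Rightarrow> 'a) set \<Rightarrow> (real \<Rightarrow> 'a) set \<Rightarrow> ((real \<Rightarrow> 'a) \<Rightarrow> real \<Rightarrow> 'a) \<Rightarrow> bool" where
  "affine_crystal_iso B B' \<Psi> \<longleftrightarrow> bij_betw \<Psi> B B' \<and>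
     (\<forall>\<eta>\<in>B. wt (\<Psi> \<eta>) = wt \<eta> \<and>
       (\<forall>i. crystal_e i (\<Psi> \<eta>) = map_option \<Psi> (crystal_e i \<eta>) \<and>
            crystal_f i (\<Psi> \<eta>) = map_option \<Psi> (crystal_f i \<eta>)))"

end

end

theory Submission
  imports Defs
begin

text \<open>Both sets of paths coincide with the set of piecewise linear paths whose directions
  \<open>v_1, \<dots>, v_s\<close> lie in the orbit \<open>W\<Lambda>\<close> and are linked by \<open>\<sigma>\<close>-chains of edges \<open>\<mu> \<rightarrow> r_\<alpha> \<mu>\<close>
  satisfying a numerical condition \<open>step_len \<mu> (\<alpha> + k\<delta>) = 1\<close> for some positive affine root
  \<open>\<alpha> + k\<delta>\<close> with \<open>\<langle>\<alpha>^\<or>, \<mu>\<rangle> > 0\<close>. The function \<open>step_len\<close> is at least 1 and changes by the difference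
  of the signs of \<open>\<langle>\<alpha>_i^\<or>, r_\<alpha> \<mu>\<rangle>\<close> and \<open>\<langle>\<alpha>_i^\<or>, \<mu>\<rangle>\<close> when everything is reflected by an affine simple
  reflection. Induction on the height of the affine root then identifies the edges with the covers
  of the affine orbit. They are also the edges of the quantum Bruhat graph, as \<open>step_len\<close> is
  the corresponding difference of lengths. The same transformation rule shows that the sign of
  \<open>\<langle>\<alpha>_i^\<or>, \<mu>\<rangle>\<close> drops along an edge only if the edge is \<open>\<mu> \<rightarrow> r_i \<mu>\<close>; this makes the local minima
  of the height functions integral and lets \<open>\<sigma>\<close>-chains be reflected, so the root operators
  preserve the set of paths. The identity is then an isomorphism.\<close>

text \<open>The obstacle is that the objects live in different places: quantum Bruhat edges join
  minimal coset representatives while Bruhat covers are taken in the whole group, affine covers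
  carry a \<delta>-component, and \<Lambda> may be singular, so that lengths in the group and signs
  on the orbit differ. The numerical condition sees only the classical weight and the label. On the
  orbit of \<open>rho\<close>, where stabilizers are trivial, it recognizes Bruhat covers, and
  \<open>step_len_regular\<close> carries it there from the orbit of \<Lambda>. Only k = 0 and k = 1
  can occur, because \<open>step_len\<close> grows by the positive amount \<open>qweight\<close> per
  unit of \<delta> and is already at least 1 at k = 1. Taking cl loses nothing, since a chain in the
  finite orbit lifts from any affine weight above its start. In the common set of paths adjacent
  directions may coincide: nodes can then be inserted freely before a segment is reflected, and the
  strictness that both kinds of paths demand is recovered by using as few pieces as
  possible.\<close>

lemma refl_root_linear: "linear (refl_root a)"
  by (rule linearI) (simp_all add: refl_root_def cpair_def algebra_simps inner_add_right add_divide_distrib)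

lemma cpair_add: "cpair a (x + y) = cpair a x + cpair a y"
  by (simp add: cpair_def inner_add_right add_divide_distrib distrib_left)

lemma cpair_diff: "cpair a (x - y) = cpair a x - cpair a y"
  by (simp add: cpair_def inner_diff_right diff_divide_distrib right_diff_distrib)

lemma cpair_scaleR: "cpair a (c *\<^sub>R x) = c * cpair a x"
  by (simp add: cpair_def)

lemma cpair_minus: "cpair a (- x) = - cpair a x"
  by (simp add: cpair_def)

lemma cpair_zero: "cpair a 0 = 0"
  by (simp add: cpair_def)

lemma cpair_sum: "cpair a (sum f A) = (\<Sum>x\<in>A. cpair a (f x))"
  by (simp add: cpair_def inner_sum_right sum_distrib_left sum_divide_distrib)

lemma cpair_neg_root: "cpair (- a) x = - cpair a x"
  by (simp add: cpair_def)

lemma cpair_self: "a \<noteq> 0 \<Longrightarrow> cpair a a = 2"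
  by (simp add: cpair_def)

lemma sgn_cpair: "a \<noteq> 0 \<Longrightarrow> sgn (cpair a x) = sgn (a \<bullet> x)"
  by (simp add: cpair_def sgn_mult sgn_divide)

lemma cpair_pos_iff: "a \<noteq> 0 \<Longrightarrow> 0 < cpair a x \<longleftrightarrow> 0 < a \<bullet> x"
  by (metis sgn_cpair sgn_greater)

lemma refl_root_neg_root: "refl_root (- a) = refl_root a"
  by (simp add: refl_root_def cpair_def fun_eq_iff)

lemma cpair_refl_same: "cpair a (refl_root a v) = - cpair a v"
  by (cases "a = 0") (simp_all add: refl_root_def cpair_diff cpair_scaleR cpair_self, simp add: cpair_def)

lemma refl_root_self: "a \<noteq> 0 \<Longrightarrow> refl_root a a = - a"
  by (simp add: refl_root_def cpair_self scaleR_2)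

lemma refl_root_invol [simp]: "refl_root a (refl_root a v) = v"
  unfolding refl_root_def[of a "refl_root a v"] cpair_refl_same by (simp add: refl_root_def)

lemma refl_root_invol_comp [simp]: "refl_root a \<circ> refl_root a = id"
  by (simp add: fun_eq_iff)

lemma inner_refl_root: "refl_root a x \<bullet> y = x \<bullet> refl_root a y"
  by (simp add: refl_root_def cpair_def inner_diff_left inner_diff_right inner_commute)

lemma inner_refl_refl: "refl_root a x \<bullet> refl_root a y = x \<bullet> y"
  by (simp add: inner_refl_root)

lemma cpair_refl_refl: "cpair (refl_root a b) (refl_root a v) = cpair b v"
  by (simp add: cpair_def inner_refl_refl)

lemma cpair_refl_left: "cpair (refl_root a b) v = cpair b (refl_root a v)"
  by (metis cpair_refl_refl refl_root_invol)

lemma inj_refl_root: "inj (refl_root a)"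
  by (metis injI refl_root_invol)

lemma refl_root_eq_iff [simp]: "refl_root a x = refl_root a y \<longleftrightarrow> x = y"
  by (metis refl_root_invol)

lemma cpair_isometry:
  assumes "\<And>x y. w x \<bullet> w y = x \<bullet> y"
  shows "cpair (w a) (w v) = cpair a v"
  by (simp add: cpair_def assms)

lemma refl_root_isometry:
  assumes "linear w" "\<And>x y. w x \<bullet> w y = x \<bullet> y"
  shows "refl_root (w a) (w v) = w (refl_root a v)"
  by (simp add: refl_root_def cpair_isometry[of w] assms linear_diff linear_scale)

context simple_root_system
begin

lemma root_nonzero: "a \<in> \<Phi> \<Longrightarrow> a \<noteq> 0"
  using zero_not_root by blast

lemma uminus_root: "a \<in> \<Phi> \<Longrightarrow> - a \<in> \<Phi>"
  using refl_closed[of a a] refl_root_self[of a] root_nonzero[of a] by simp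

lemma refl_root_image: "a \<in> \<Phi> \<Longrightarrow> refl_root a ` \<Phi> = \<Phi>"
  by (rule endo_inj_surj[OF finite_roots]) (auto intro: refl_closed inj_on_subset[OF inj_refl_root])

text \<open>The dual basis of the simple roots. The choice is justified by their independence;
  coordinates make membership in \<open>root_cone\<close> a condition on each coefficient.\<close>

definition coord :: "'i \<Rightarrow> 'a \<Rightarrow> real" where
  "coord j = (SOME g. linear g \<and> (\<forall>i. g (\<alpha> i) = (if i = j then 1 else 0)))"

lemma coord: "linear (coord j)" "coord j (\<alpha> i) = (if i = j then 1 else 0)"
proof -
  obtain g :: "'a \<Rightarrow> real" where g: "linear g" "\<forall>x\<in>range \<alpha>. g x = (if inv \<alpha> x = j then 1 else 0)"
    using linear_independent_extend[OF simple_indep, of "\<lambda>x. if inv \<alpha> x = j then 1 else 0"] by blast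
  have "\<exists>g. linear g \<and> (\<forall>i. g (\<alpha> i) = (if i = j then (1::real) else 0))"
    using g simple_inj by (intro exI[of _ g]) auto
  from someI_ex[OF this] show "linear (coord j)" "coord j (\<alpha> i) = (if i = j then 1 else 0)"
    unfolding coord_def by auto
qed

lemmas coord_simps = linear_add[OF coord(1)] linear_diff[OF coord(1)] linear_scale[OF coord(1)]
  linear_neg[OF coord(1)] linear_0[OF coord(1)] linear_sum[OF coord(1)]

lemma coord_combination: "coord j (\<Sum>i\<in>UNIV. c i *\<^sub>R \<alpha> i) = c j"
  by (simp add: coord_simps coord(2) if_distrib[of "\<lambda>x. _ * x"] cong: if_cong)

lemma span_simple: "span (range \<alpha>) = UNIV"
proof -
  have "b \<in> span (range \<alpha>)" if "b \<in> \<Phi>" for b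
  proof -
    have c: "(\<Sum>i\<in>UNIV. real (c i) *\<^sub>R \<alpha> i) \<in> span (range \<alpha>)" for c
      by (intro span_sum span_scale span_base) auto
    from simple_base[OF that] show ?thesis using c span_neg by metis
  qed
  then have "span \<Phi> \<subseteq> span (range \<alpha>)" by (intro span_minimal) auto
  then show ?thesis using span_roots by auto
qed

lemma coord_expansion: "(\<Sum>i\<in>UNIV. coord i x *\<^sub>R \<alpha> i) = x"
proof -
  have "linear (\<lambda>x. x - (\<Sum>i\<in>UNIV. coord i x *\<^sub>R \<alpha> i))"
    by (intro linearI)
      (simp_all add: coord_simps scaleR_left_distrib sum.distrib scaleR_sum_right scaleR_right_diff_distrib)
  moreover have "\<alpha> j - (\<Sum>i\<in>UNIV. coord i (\<alpha> j) *\<^sub>R \<alpha> i) = 0" for j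
    by (simp add: coord(2) if_distrib[of "\<lambda>c. c *\<^sub>R _"] cong: if_cong)
  ultimately have "x - (\<Sum>i\<in>UNIV. coord i x *\<^sub>R \<alpha> i) = 0"
    using linear_eq_0_on_span[of "\<lambda>x. x - (\<Sum>i\<in>UNIV. coord i x *\<^sub>R \<alpha> i)" "range \<alpha>" x]
    by (auto simp: span_simple)
  then show ?thesis by simp
qed

lemma coord_eq_0: "(\<And>j. coord j x = 0) \<Longrightarrow> x = 0"
  using coord_expansion[of x] by simp

lemma root_cone_iff: "x \<in> root_cone \<longleftrightarrow> (\<forall>j. coord j x \<in> \<nat>)"
proof
  assume "x \<in> root_cone"
  then show "\<forall>j. coord j x \<in> \<nat>"
    unfolding root_cone_def by (auto simp: coord_combination)
next
  assume "\<forall>j. coord j x \<in> \<nat>"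
  then have "\<forall>j. \<exists>n. coord j x = real n"
    by (auto simp: Nats_def)
  then obtain c where c: "\<And>j. coord j x = real (c j)"
    by metis
  have "x = (\<Sum>i\<in>UNIV. real (c i) *\<^sub>R \<alpha> i)"
    using coord_expansion[of x] by (simp only: c)
  then show "x \<in> root_cone"
    unfolding root_cone_def by blast
qed

lemma root_cone_add: "x \<in> root_cone \<Longrightarrow> y \<in> root_cone \<Longrightarrow> x + y \<in> root_cone"
  by (auto simp: root_cone_iff coord_simps)

lemma coord_root_cone: "x \<in> root_cone \<Longrightarrow> 0 \<le> coord j x"
  by (auto simp: root_cone_iff Nats_def dest!: spec[of _ j])

lemma root_cone_antisym: "x \<in> root_cone \<Longrightarrow> - x \<in> root_cone \<Longrightarrow> x = 0"
  using coord_root_cone[of x] coord_root_cone[of "- x"]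
  by (intro coord_eq_0) (auto simp: coord_simps intro: antisym)

lemma root_cases: "b \<in> \<Phi> \<Longrightarrow> b \<in> pos_roots \<or> - b \<in> pos_roots"
  using simple_base[of b] uminus_root[of b] unfolding pos_roots_def root_cone_def by force

lemma pos_roots_subset: "pos_roots \<subseteq> \<Phi>"
  by (simp add: pos_roots_def)

lemma pos_root_nonzero: "b \<in> pos_roots \<Longrightarrow> b \<noteq> 0"
  using pos_roots_subset root_nonzero by blast

lemma finite_pos_roots: "finite pos_roots"
  using finite_subset[OF pos_roots_subset finite_roots] .

lemma pos_not_neg: "b \<in> pos_roots \<Longrightarrow> - b \<notin> pos_roots"
  using root_cone_antisym[of b] root_nonzero[of b] by (auto simp: pos_roots_def)

lemma roots_decomp: "\<Phi> = pos_roots \<union> uminus ` pos_roots" "pos_roots \<inter> uminus ` pos_roots = {}"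
proof -
  show "\<Phi> = pos_roots \<union> uminus ` pos_roots"
  proof (intro equalityI subsetI)
    fix b assume "b \<in> \<Phi>"
    then show "b \<in> pos_roots \<union> uminus ` pos_roots"
      using root_cases[of b] by (metis UnI1 UnI2 imageI minus_minus)
  qed (use pos_roots_subset uminus_root in auto)
qed (use pos_not_neg in auto)

lemma sum_roots_decomp:
  fixes g :: "'a \<Rightarrow> real"
  assumes "\<And>b. g (- b) = g b"
  shows "(\<Sum>b\<in>\<Phi>. g b) = 2 * (\<Sum>b\<in>pos_roots. g b)"
proof -
  have "(\<Sum>b\<in>\<Phi>. g b) = (\<Sum>b\<in>pos_roots. g b) + (\<Sum>b\<in>uminus ` pos_roots. g b)"
    by (subst roots_decomp(1), rule sum.union_disjoint) (use finite_pos_roots roots_decomp(2) in auto)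
  also have "(\<Sum>b\<in>uminus ` pos_roots. g b) = (\<Sum>b\<in>pos_roots. g b)"
    by (subst sum.reindex) (auto simp: assms inj_on_def)
  finally show ?thesis by simp
qed

lemma simple_pos: "\<alpha> i \<in> pos_roots"
  using simple_roots by (simp add: pos_roots_def root_cone_iff coord(2))

text \<open>The reflection changes only the i-th coordinate. A negative image would force all other
  coordinates of b to vanish, so b would be a multiple of \<alpha> i, and \<open>reduced\<close>
  leaves only \<alpha> i itself.\<close>

lemma refl_simple_pos:
  assumes b: "b \<in> pos_roots" and ne: "b \<noteq> \<alpha> i"
  shows "refl_root (\<alpha> i) b \<in> pos_roots"
proof (rule ccontr)
  assume neg: "refl_root (\<alpha> i) b \<notin> pos_roots"
  have bR: "b \<in> \<Phi>" using b pos_roots_subset by auto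
  have "refl_root (\<alpha> i) b \<in> \<Phi>" using refl_closed simple_roots bR by auto
  then have nc: "- refl_root (\<alpha> i) b \<in> root_cone" using root_cases neg by (auto simp: pos_roots_def)
  have bc: "0 \<le> coord j b" for j using coord_root_cone b by (auto simp: pos_roots_def)
  have "coord j b = 0" if "j \<noteq> i" for j
    using coord_root_cone[OF nc, of j] bc[of j] that by (auto simp: refl_root_def coord_simps coord(2))
  then have "b - coord i b *\<^sub>R \<alpha> i = 0"
    by (intro coord_eq_0) (auto simp: coord_simps coord(2))
  then have e: "b = coord i b *\<^sub>R \<alpha> i" by simp
  then have "coord i b = 1 \<or> coord i b = -1" using reduced[OF simple_roots, of "coord i b" i] bR by simp
  with bc[of i] e ne show False by auto
qed

lemma refl_simple_pos_image: "refl_root (\<alpha> i) ` (pos_roots - {\<alpha> i}) = pos_roots - {\<alpha> i}"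
proof (rule endo_inj_surj)
  show "refl_root (\<alpha> i) ` (pos_roots - {\<alpha> i}) \<subseteq> pos_roots - {\<alpha> i}"
  proof safe
    fix b assume b: "b \<in> pos_roots" "b \<noteq> \<alpha> i"
    then show "refl_root (\<alpha> i) b \<in> pos_roots" by (rule refl_simple_pos)
    assume "refl_root (\<alpha> i) b = \<alpha> i"
    then have "b = - \<alpha> i" using refl_root_self[of "\<alpha> i"] root_nonzero[OF simple_roots]
      by (metis refl_root_invol)
    then show False using b simple_pos[of i] pos_not_neg by auto
  qed
qed (auto simp: finite_pos_roots intro: inj_on_subset[OF inj_refl_root])

subsection \<open>The highest root\<close>

text \<open>Strict Cauchy-Schwarz makes the product of the two Cartan integers less than 4. Both are
  positive, so one of them is 1, and the corresponding reflection produces a - b up to sign.\<close>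

lemma root_diff:
  assumes a: "a \<in> \<Phi>" and b: "b \<in> \<Phi>" and pos: "0 < a \<bullet> b" and ne: "a \<noteq> b"
  shows "a - b \<in> \<Phi>"
proof -
  have nz: "a \<noteq> 0" "b \<noteq> 0" using a b root_nonzero by auto
  have aa: "0 < a \<bullet> a" "0 < b \<bullet> b" using nz by auto
  have strict: "(a \<bullet> b)\<^sup>2 < (a \<bullet> a) * (b \<bullet> b)"
  proof (rule ccontr)
    assume "\<not> ?thesis"
    then have "(a \<bullet> b)\<^sup>2 = (a \<bullet> a) * (b \<bullet> b)" using Cauchy_Schwarz_ineq[of a b] by simp
    \<comment> \<open>This is the component of b orthogonal to a. Equality in Cauchy-Schwarz makes
      its norm vanish, so b would be a multiple of a.\<close>
    moreover have "(b - ((a \<bullet> b) / (a \<bullet> a)) *\<^sub>R a) \<bullet> (b - ((a \<bullet> b) / (a \<bullet> a)) *\<^sub>R a)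
        = b \<bullet> b - (a \<bullet> b)\<^sup>2 / (a \<bullet> a)"
      using aa by (simp add: inner_diff_left inner_diff_right inner_commute field_simps power2_eq_square)
    ultimately have "(b - ((a \<bullet> b) / (a \<bullet> a)) *\<^sub>R a) \<bullet> (b - ((a \<bullet> b) / (a \<bullet> a)) *\<^sub>R a) = 0"
      using aa by simp
    then have "b - ((a \<bullet> b) / (a \<bullet> a)) *\<^sub>R a = 0" by (simp only: inner_eq_zero_iff)
    then have e: "b = ((a \<bullet> b) / (a \<bullet> a)) *\<^sub>R a" by simp
    then have "(a \<bullet> b) / (a \<bullet> a) = 1 \<or> (a \<bullet> b) / (a \<bullet> a) = -1" using reduced[OF a] b by metis
    moreover have "(a \<bullet> b) / (a \<bullet> a) > 0" using pos aa by simp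
    ultimately have "(a \<bullet> b) / (a \<bullet> a) = 1" by linarith
    with e ne show False by (metis scaleR_one)
  qed
  obtain m n :: int where m: "cpair a b = m" and n: "cpair b a = n"
    using crystallographic[OF a b] crystallographic[OF b a] by (auto elim!: Ints_cases)
  have "0 < cpair a b" "0 < cpair b a" using pos nz by (auto simp: cpair_pos_iff inner_commute)
  then have pm: "0 < m" "0 < n" using m n by simp_all
  have "cpair a b * cpair b a < 4"
    using strict aa by (simp add: cpair_def inner_commute field_simps power2_eq_square)
  then have "real_of_int (m * n) < 4" using m n by simp
  then have "m * n < 4" by linarith
  have "m = 1 \<or> n = 1"
  proof (rule ccontr)
    assume "\<not> ?thesis"
    then have "2 * 2 \<le> m * n" using pm by (intro mult_mono) auto
    with \<open>m * n < 4\<close> show False by simp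
  qed
  then show ?thesis
  proof
    assume "m = 1"
    then have "refl_root a b = - (a - b)" using m by (simp add: refl_root_def)
    then show ?thesis using refl_closed[OF a b] uminus_root by (metis minus_minus)
  next
    assume "n = 1"
    then have "refl_root b a = a - b" using n by (simp add: refl_root_def)
    then show ?thesis using refl_closed[OF b a] by metis
  qed
qed

lemma sum_in_Nats: "(\<And>x. x \<in> A \<Longrightarrow> f x \<in> \<nat>) \<Longrightarrow> sum f A \<in> \<nat>"
  by (induction A rule: infinite_finite_induct) auto

section \<open>Heights and descent of positive roots\<close>

definition height :: "'a \<Rightarrow> real" where
  "height x = (\<Sum>j\<in>UNIV. coord j x)"

lemma height_linear: "linear height"
  unfolding height_def by (intro linearI) (simp_all add: coord_simps sum.distrib sum_distrib_left)

lemmas height_simps = linear_add[OF height_linear] linear_diff[OF height_linear]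
  linear_scale[OF height_linear] linear_neg[OF height_linear] linear_0[OF height_linear]

lemma height_simple [simp]: "height (\<alpha> i) = 1"
  by (simp add: height_def coord(2))

lemma height_root_cone: "x \<in> root_cone \<Longrightarrow> height x \<in> \<nat>"
  unfolding height_def root_cone_iff by (rule sum_in_Nats) auto

lemma height_nonneg: "x \<in> root_cone \<Longrightarrow> 0 \<le> height x"
  by (auto simp: height_def intro!: sum_nonneg coord_root_cone)

lemma height_eq_0: "x \<in> root_cone \<Longrightarrow> height x = 0 \<Longrightarrow> x = 0"
  unfolding height_def
  by (subst (asm) sum_nonneg_eq_0_iff) (auto intro: coord_root_cone coord_eq_0)

lemma height_pos: "b \<in> pos_roots \<Longrightarrow> 0 < height b"
  using height_nonneg[of b] height_eq_0[of b] pos_root_nonzero[of b] by (auto simp: pos_roots_def less_le)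

text \<open>If every node in the support of a paired nonpositively with a, expanding one factor of a
  \<bullet> a in simple roots would make it nonpositive.\<close>

lemma ex_nonzero_inner_simple:
  assumes "a \<in> \<Phi>" "a \<in> root_cone" shows "\<exists>i. 0 < coord i a \<and> 0 < \<alpha> i \<bullet> a"
proof (rule ccontr)
  assume no: "\<not> ?thesis"
  have "a \<bullet> a = (\<Sum>i\<in>UNIV. coord i a * (\<alpha> i \<bullet> a))"
    using arg_cong[OF coord_expansion[of a, symmetric], of "\<lambda>x. x \<bullet> a"] by (simp only: inner_sum_left inner_scaleR_left)
  also have "\<dots> \<le> 0"
  proof (intro sum_nonpos)
    fix i show "coord i a * (\<alpha> i \<bullet> a) \<le> 0"
      using no[unfolded not_ex, rule_format, of i] coord_root_cone[OF assms(2), of i]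
      by (cases "coord i a = 0") (auto simp: mult_le_0_iff)
  qed
  finally show False using root_nonzero[OF assms(1)] by (metis inner_gt_zero_iff not_le)
qed

lemma height_refl_less:
  assumes "0 < cpair (\<alpha> i) a" shows "height (refl_root (\<alpha> i) a) < height a"
  using assms by (simp add: refl_root_def height_simps)

text \<open>A simple root pairing positively with b lowers its height and keeps it positive, unless
  b is that simple root. Heights of positive roots are natural numbers, so the descent ends; the
  floor in the measure only converts the type.\<close>

lemma pos_root_induct [consumes 1, case_names simple step]:
  assumes "b \<in> pos_roots"
    and "\<And>i. P (\<alpha> i)"
    and "\<And>b i. b \<in> pos_roots \<Longrightarrow> 0 < cpair (\<alpha> i) b \<Longrightarrow> P (refl_root (\<alpha> i) b) \<Longrightarrow> P b"
  shows "P b"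
  using assms(1)
proof (induction "nat \<lfloor>height b\<rfloor>" arbitrary: b rule: less_induct)
  case less
  obtain i where i: "0 < \<alpha> i \<bullet> b"
    using ex_nonzero_inner_simple less.prems by (auto simp: pos_roots_def)
  show ?case
  proof (cases "b = \<alpha> i")
    case False
    have c: "refl_root (\<alpha> i) b \<in> pos_roots" using refl_simple_pos less.prems False by auto
    have p: "0 < cpair (\<alpha> i) b" using i cpair_pos_iff root_nonzero simple_roots by metis
    have "height (refl_root (\<alpha> i) b) < height b" using height_refl_less[OF p] .
    moreover have "height (refl_root (\<alpha> i) b) \<in> \<nat>" "height b \<in> \<nat>"
      using height_root_cone c less.prems by (auto simp: pos_roots_def)
    ultimately have "nat \<lfloor>height (refl_root (\<alpha> i) b)\<rfloor> < nat \<lfloor>height b\<rfloor>" by (auto simp: Nats_def)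
    from less.hyps[OF this c] show ?thesis using assms(3)[OF less.prems p] by blast
  qed (simp add: assms(2))
qed

text \<open>Otherwise the difference of the two simple roots would be a root with coordinates of
  both signs.\<close>

lemma inner_simple_nonpos:
  assumes "i \<noteq> j" shows "\<alpha> i \<bullet> \<alpha> j \<le> 0"
proof (rule ccontr)
  assume "\<not> ?thesis"
  then have "\<alpha> i - \<alpha> j \<in> \<Phi>"
    using root_diff[OF simple_roots simple_roots, of i j] simple_inj assms by (auto simp: inj_eq)
  then have "\<alpha> i - \<alpha> j \<in> root_cone \<or> - (\<alpha> i - \<alpha> j) \<in> root_cone"
    using root_cases[of "\<alpha> i - \<alpha> j"] unfolding pos_roots_def by blast
  then show False
  proof
    assume "\<alpha> i - \<alpha> j \<in> root_cone"
    from coord_root_cone[OF this, of j] assms show False by (simp add: coord_simps coord(2))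
  next
    assume "- (\<alpha> i - \<alpha> j) \<in> root_cone"
    from coord_root_cone[OF this, of i] assms show False by (simp add: coord_simps coord(2))
  qed
qed

lemma inner_expansion: "x \<bullet> y = (\<Sum>i\<in>UNIV. coord i x * (\<alpha> i \<bullet> y))"
  using arg_cong[OF coord_expansion[of x, symmetric], of "\<lambda>x. x \<bullet> y"]
  by (simp only: inner_sum_left inner_scaleR_left)

section \<open>Existence and uniqueness of the highest root\<close>

definition maximal_root :: "'a \<Rightarrow> bool" where
  "maximal_root b \<longleftrightarrow> b \<in> \<Phi> \<and> (\<forall>c\<in>\<Phi>. c - b \<in> root_cone \<longrightarrow> c = b)"

lemma ex_maximal_root:
  assumes "a \<in> \<Phi>" shows "\<exists>b. maximal_root b \<and> b - a \<in> root_cone"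
proof -
  let ?S = "{b \<in> \<Phi>. b - a \<in> root_cone}"
  have fin: "finite ?S" using finite_roots by auto
  have "a \<in> ?S" using assms by (simp add: root_cone_iff coord_simps)
  then have ne: "?S \<noteq> {}" by auto
  have "Max (height ` ?S) \<in> height ` ?S" using fin ne by (intro Max_in) auto
  then obtain b where b: "b \<in> ?S" "height b = Max (height ` ?S)" by force
  have mx: "height c \<le> height b" if "c \<in> ?S" for c
    unfolding b(2) using fin that by (intro Max_ge) auto
  have "c = b" if "c \<in> \<Phi>" "c - b \<in> root_cone" for c
  proof -
    have "c - a = (c - b) + (b - a)" by simp
    then have "c - a \<in> root_cone" using that(2) b(1) root_cone_add by (metis (no_types, lifting) mem_Collect_eq)
    then have "height c \<le> height b" using mx that by auto
    then have "height (c - b) \<le> 0" by (simp add: height_simps)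
    then have "height (c - b) = 0" using height_nonneg[OF that(2)] by simp
    from height_eq_0[OF that(2) this] show ?thesis by simp
  qed
  then show ?thesis using b unfolding maximal_root_def by auto
qed

text \<open>If the pairing with \<alpha> i were negative, reflecting b would add a positive multiple
  of \<alpha> i and give a root strictly above b.\<close>

lemma maximal_root_dominant:
  assumes "maximal_root b" shows "0 \<le> \<alpha> i \<bullet> b"
proof (rule ccontr)
  assume neg: "\<not> ?thesis"
  have nz: "\<alpha> i \<noteq> 0" using root_nonzero simple_roots by auto
  have bR: "b \<in> \<Phi>" using assms by (simp add: maximal_root_def)
  obtain m :: int where m: "cpair (\<alpha> i) b = m"
    using crystallographic[OF simple_roots bR] by (auto elim!: Ints_cases)
  have "sgn (cpair (\<alpha> i) b) = -1" using neg by (subst sgn_cpair[OF nz]) auto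
  then have m0: "m < 0" using m by (simp add: sgn_if split: if_splits)
  have "refl_root (\<alpha> i) b - b = real (nat (- m)) *\<^sub>R \<alpha> i"
    using m m0 by (simp add: refl_root_def)
  then have "refl_root (\<alpha> i) b - b \<in> root_cone"
    by (simp add: root_cone_iff coord_simps coord(2) del: of_nat_nat)
  then have "refl_root (\<alpha> i) b = b"
    using assms refl_closed[OF simple_roots bR] by (auto simp: maximal_root_def)
  then show False using m m0 nz by (simp add: refl_root_def)
qed

lemma maximal_root_pos: assumes "maximal_root b" shows "b \<in> pos_roots"
proof (rule ccontr)
  assume "b \<notin> pos_roots"
  then have p: "- b \<in> pos_roots" using root_cases assms by (auto simp: maximal_root_def)
  then have "- b - b \<in> root_cone" using root_cone_add[of "-b" "-b"] by (auto simp: pos_roots_def)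
  then have "- b = b" using assms p pos_roots_subset by (auto simp: maximal_root_def)
  then show False using p \<open>b \<notin> pos_roots\<close> by simp
qed

text \<open>If the support of a maximal root were a proper subset S of the nodes, then S and its
  complement would be orthogonal and every root would be supported on one of the two.\<close>
lemma maximal_root_full_support:
  assumes b: "maximal_root b" shows "0 < coord j b"
proof (rule ccontr)
  assume j: "\<not> ?thesis"
  define S where "S = {i. 0 < coord i b}"
  have bp: "b \<in> pos_roots" using maximal_root_pos b by auto
  have bc: "0 \<le> coord i b" for i using coord_root_cone bp by (auto simp: pos_roots_def)
  have jS: "j \<notin> S" using j by (simp add: S_def)
  \<comment> \<open>Dominance makes b \<bullet> \<alpha> k nonnegative, while every term of its
    expansion is nonpositive; hence all terms vanish, in particular that of i.\<close>
  have orth: "\<alpha> i \<bullet> \<alpha> k = 0" if "i \<in> S" "k \<notin> S" for i k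
  proof -
    have "b \<bullet> \<alpha> k = (\<Sum>i\<in>UNIV. coord i b * (\<alpha> i \<bullet> \<alpha> k))" by (rule inner_expansion)
    moreover have nonpos: "coord i b * (\<alpha> i \<bullet> \<alpha> k) \<le> 0" for i
    proof (cases "i = k")
      case True
      then have "coord i b = 0" using that bc[of i] by (auto simp: S_def)
      then show ?thesis by simp
    next
      case False
      then show ?thesis using bc[of i] inner_simple_nonpos[of i k] by (simp add: mult_nonneg_nonpos)
    qed
    moreover have "0 \<le> b \<bullet> \<alpha> k" using maximal_root_dominant[OF b, of k] by (simp add: inner_commute)
    moreover have "(\<Sum>i\<in>UNIV. coord i b * (\<alpha> i \<bullet> \<alpha> k)) \<le> 0" using nonpos by (intro sum_nonpos)
    ultimately have "(\<Sum>i\<in>UNIV. - (coord i b * (\<alpha> i \<bullet> \<alpha> k))) = 0" by (simp add: sum_negf)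
    then have "\<forall>i\<in>UNIV. - (coord i b * (\<alpha> i \<bullet> \<alpha> k)) = 0"
      using nonpos by (subst (asm) sum_nonneg_eq_0_iff) auto
    then have "coord i b * (\<alpha> i \<bullet> \<alpha> k) = 0" by simp
    then show ?thesis using that(1) unfolding S_def by (metis less_irrefl mem_Collect_eq mult_eq_0_iff)
  qed
  define onS where "onS a \<longleftrightarrow> (\<forall>k. k \<notin> S \<longrightarrow> coord k a = 0)" for a
  define offS where "offS a \<longleftrightarrow> (\<forall>k. k \<in> S \<longrightarrow> coord k a = 0)" for a
  have ortho: "x \<bullet> y = 0" if "onS x" "offS y" for x y
  proof -
    have "\<alpha> i \<bullet> y = 0" if "i \<in> S" for i
    proof -
      have "coord k y * (\<alpha> k \<bullet> \<alpha> i) = 0" for k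
        using \<open>offS y\<close> orth[OF that, of k]
        by (cases "k \<in> S") (auto simp: offS_def inner_commute)
      then have "(\<Sum>k\<in>UNIV. coord k y * (\<alpha> k \<bullet> \<alpha> i)) = 0" by (intro sum.neutral) blast
      then show ?thesis using inner_expansion[of y "\<alpha> i"] by (simp add: inner_commute)
    qed
    then have "coord k x * (\<alpha> k \<bullet> y) = 0" for k
      using \<open>onS x\<close> by (cases "k \<in> S") (auto simp: onS_def)
    then show ?thesis unfolding inner_expansion[of x y] by (intro sum.neutral) blast
  qed
  \<comment> \<open>Along the descent, a node outside the half supporting the lower root would be
    orthogonal to that root, against the strictly positive pairing. So the support never leaves its
    half.\<close>
  have split: "onS a \<or> offS a" if "a \<in> pos_roots" for a
    using that
  proof (induction rule: pos_root_induct)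
    case (simple i)
    then show ?case by (auto simp: onS_def offS_def coord(2))
  next
    case (step a i)
    let ?c = "refl_root (\<alpha> i) a"
    from step.IH show ?case
    proof
      assume on: "onS ?c"
      show ?thesis
      proof (cases "i \<in> S")
        case True
        then have "onS a" using on by (auto simp: onS_def refl_root_def coord_simps coord(2) split: if_splits)
        then show ?thesis ..
      next
        case False
        then have "offS (\<alpha> i)" by (auto simp: offS_def coord(2))
        then have "cpair (\<alpha> i) ?c = 0" using ortho[OF on, of "\<alpha> i"] by (simp add: cpair_def inner_commute)
        then show ?thesis using step.hyps(2) by (simp add: cpair_refl_same)
      qed
    next
      assume off: "offS ?c"
      show ?thesis
      proof (cases "i \<in> S")
        case False
        then have "offS a" using off by (auto simp: offS_def refl_root_def coord_simps coord(2) split: if_splits)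
        then show ?thesis ..
      next
        case True
        then have "onS (\<alpha> i)" by (auto simp: onS_def coord(2))
        then have "cpair (\<alpha> i) ?c = 0" using ortho[OF _ off, of "\<alpha> i"] by (simp add: cpair_def)
        then show ?thesis using step.hyps(2) by (simp add: cpair_refl_same)
      qed
    qed
  qed
  have neg: "onS (- a) = onS a" "offS (- a) = offS a" for a
    by (auto simp: onS_def offS_def coord_simps)
  have split': "onS a \<or> offS a" if "a \<in> \<Phi>" for a
    using root_cases[OF that] split neg by metis
  let ?A = "{a \<in> \<Phi>. onS a}" and ?B = "{a \<in> \<Phi>. offS a}"
  have "?A \<union> ?B = \<Phi>" using split' by auto
  moreover have "?A \<inter> ?B = {}"
  proof (rule ccontr)
    assume "?A \<inter> ?B \<noteq> {}"
    then obtain a where "a \<in> \<Phi>" "onS a" "offS a" by auto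
    with ortho[of a a] root_nonzero show False by auto
  qed
  moreover have "\<forall>a\<in>?A. \<forall>b\<in>?B. a \<bullet> b = 0" using ortho by auto
  ultimately have "?A = {} \<or> ?B = {}" by (rule irreducible)
  moreover have "\<alpha> j \<in> ?B" using jS simple_roots by (auto simp: offS_def coord(2))
  moreover have "b \<in> ?A"
    using bp pos_roots_subset bc by (auto simp: onS_def S_def not_less intro: antisym)
  ultimately show False by auto
qed

text \<open>Full support and dominance make two maximal roots pair positively. If they differed,
  their difference would be a root, so they would be comparable, which maximality excludes.\<close>

lemma maximal_root_unique:
  assumes b: "maximal_root b" and b': "maximal_root b'" shows "b = b'"
proof (rule ccontr)
  assume ne: "b \<noteq> b'"
  have R: "b \<in> \<Phi>" "b' \<in> \<Phi>" using b b' by (auto simp: maximal_root_def)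
  have "b \<in> root_cone" using maximal_root_pos[OF b] by (auto simp: pos_roots_def)
  from ex_nonzero_inner_simple[OF R(1) this] obtain i where i: "0 < \<alpha> i \<bullet> b" by auto
  have "b' \<bullet> b = (\<Sum>i\<in>UNIV. coord i b' * (\<alpha> i \<bullet> b))" by (rule inner_expansion)
  also have "\<dots> > 0"
    using maximal_root_full_support[OF b'] maximal_root_dominant[OF b] i
    by (intro sum_pos2[of _ i]) (auto simp: less_imp_le)
  finally have "b - b' \<in> \<Phi>" using root_diff[OF R] ne by (simp add: inner_commute)
  then have "b - b' \<in> root_cone \<or> b' - b \<in> root_cone"
    using root_cases[of "b - b'"] by (auto simp: pos_roots_def)
  then show False using b b' R ne by (auto simp: maximal_root_def)
qed

lemma ex_highest_root: "\<exists>!b. b \<in> \<Phi> \<and> (\<forall>a\<in>\<Phi>. b - a \<in> root_cone)"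
proof -
  \<comment> \<open>Types are nonempty, so there is a node, hence a root and a maximal root above
    it.\<close>
  obtain i0 :: 'i where True by simp
  obtain b where b: "maximal_root b" using ex_maximal_root[OF simple_roots[of i0]] by auto
  have "b - a \<in> root_cone" if "a \<in> \<Phi>" for a
    using ex_maximal_root[OF that] maximal_root_unique[OF b] by auto
  moreover have "b \<in> \<Phi>" using b by (simp add: maximal_root_def)
  ultimately show ?thesis using root_cone_antisym by (metis eq_iff_diff_eq_0 minus_diff_eq)
qed

lemma highest_root: "highest_root \<in> \<Phi>" "a \<in> \<Phi> \<Longrightarrow> highest_root - a \<in> root_cone"
  using theI'[OF ex_highest_root] unfolding highest_root_def by auto

lemma maximal_highest_root: "maximal_root highest_root"
proof -
  have "c = highest_root" if "c \<in> \<Phi>" "c - highest_root \<in> root_cone" for c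
    using root_cone_antisym[OF that(2)] highest_root(2)[OF that(1)] by simp
  then show ?thesis using highest_root by (auto simp: maximal_root_def)
qed

lemma highest_root_pos: "highest_root \<in> pos_roots"
  by (rule maximal_root_pos[OF maximal_highest_root])

lemma highest_root_nonzero: "highest_root \<noteq> 0"
  using highest_root(1) root_nonzero by blast

text \<open>With pairing m, the root m \<theta> - b lies below \<theta>, as does b. For m at least 2
  this puts both b - (m - 1) \<theta> and \<theta> - b in the cone, and comparing coordinates gives
  b = \<theta>.\<close>

lemma cpair_highest_root:
  assumes "b \<in> pos_roots" "b \<noteq> highest_root"
  shows "cpair highest_root b = 0 \<or> cpair highest_root b = 1"
proof -
  let ?\<theta> = highest_root
  have bR: "b \<in> \<Phi>" and bc: "b \<in> root_cone" using assms by (auto simp: pos_roots_def)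
  obtain m :: int where m: "cpair ?\<theta> b = m"
    using crystallographic[OF highest_root(1) bR] by (auto elim!: Ints_cases)
  have "0 \<le> b \<bullet> ?\<theta>"
    unfolding inner_expansion[of b] using coord_root_cone[OF bc] maximal_root_dominant[OF maximal_highest_root]
    by (intro sum_nonneg) auto
  then have "0 \<le> cpair ?\<theta> b" by (simp add: cpair_def inner_commute)
  then have "0 \<le> m" using m by simp
  moreover have "m < 2"
  proof (rule ccontr)
    assume "\<not> m < 2"
    then have m2: "2 \<le> real_of_int m" by simp
    have "- refl_root ?\<theta> b \<in> \<Phi>" using refl_closed[OF highest_root(1) bR] uminus_root by auto
    from highest_root(2)[OF this] have 1: "b - (m - 1) *\<^sub>R ?\<theta> \<in> root_cone"
      using m by (simp add: refl_root_def algebra_simps)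
    have 2: "?\<theta> - b \<in> root_cone" using highest_root(2)[OF bR] .
    have \<theta>c: "?\<theta> \<in> root_cone" using highest_root_pos by (simp add: pos_roots_def)
    have "coord j (?\<theta> - b) = 0" for j
    proof -
      have "0 \<le> coord j b - (m - 1) * coord j ?\<theta>" "0 \<le> coord j ?\<theta> - coord j b" "0 \<le> coord j ?\<theta>"
        using coord_root_cone[OF 1, of j] coord_root_cone[OF 2, of j] coord_root_cone[OF \<theta>c, of j]
        by (auto simp: coord_simps)
      moreover have "coord j ?\<theta> \<le> (m - 1) * coord j ?\<theta>"
        using m2 \<open>0 \<le> coord j ?\<theta>\<close> mult_right_mono[of 1 "real_of_int m - 1" "coord j ?\<theta>"] by simp
      ultimately show ?thesis by (simp add: coord_simps)
    qed
    then have "?\<theta> - b = 0" by (rule coord_eq_0)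
    then show False using assms by simp
  qed
  ultimately have "m = 0 \<or> m = 1" by auto
  then show ?thesis using m by auto
qed

subsection \<open>Affine roots\<close>

lemma cl_simple_fst: "cl_simple i = fst (aff_simple i)"
  by (cases i) auto

lemma cl_simple_root: "cl_simple i \<in> \<Phi>"
  by (cases i) (auto simp: simple_roots highest_root(1) uminus_root)

lemma cl_simple_nonzero [simp]: "cl_simple i \<noteq> 0"
  using cl_simple_root root_nonzero by blast

lemma cl_refl_eq: "cl_refl i = refl_root (cl_simple i)"
  by (cases i) (auto simp: refl_root_neg_root)

lemma cl_coroot_eq: "cl_coroot i = cpair (cl_simple i)"
  by (cases i) (auto simp: cpair_neg_root fun_eq_iff)

lemma aff_refl_fst: "fst (aff_refl b m) = refl_root (fst b) (fst m)"
  by (simp add: aff_refl_def refl_root_def)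

lemma aff_refl_snd: "snd (aff_refl b m) = snd m - cpair (fst b) (fst m) * snd b"
  by (simp add: aff_refl_def)

lemma aff_refl_invol [simp]: "aff_refl b (aff_refl b m) = m"
  by (rule prod_eqI) (simp_all add: aff_refl_fst aff_refl_snd cpair_refl_same)

lemma aff_refl_eq_iff [simp]: "aff_refl b x = aff_refl b y \<longleftrightarrow> x = y"
  by (metis aff_refl_invol)

lemma aff_refl_conj: "aff_refl (aff_refl a b) (aff_refl a m) = aff_refl a (aff_refl b m)"
proof (rule prod_eqI)
  show "fst (aff_refl (aff_refl a b) (aff_refl a m)) = fst (aff_refl a (aff_refl b m))"
    by (simp add: aff_refl_fst refl_root_isometry refl_root_linear inner_refl_refl)
  show "snd (aff_refl (aff_refl a b) (aff_refl a m)) = snd (aff_refl a (aff_refl b m))"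
    by (simp add: aff_refl_snd aff_refl_fst cpair_refl_refl)
      (simp add: refl_root_def cpair_diff cpair_scaleR algebra_simps)
qed

lemma aff_root_fst: "b \<in> aff_pos_real_roots \<Longrightarrow> fst b \<in> \<Phi>"
  by (auto simp: aff_pos_real_roots_def pos_roots_def)

lemma aff_root_iff:
  "(a, k) \<in> aff_pos_real_roots \<longleftrightarrow> (k = 0 \<and> a \<in> pos_roots) \<or> (a \<in> \<Phi> \<and> 0 < k \<and> k \<in> \<int>)"
  by (auto simp: aff_pos_real_roots_def Ints_def)

lemma aff_simple_root: "aff_simple i \<in> aff_pos_real_roots"
  by (cases i) (auto simp: aff_root_iff simple_pos highest_root(1) uminus_root)

lemma cpair_highest_root_ge:
  assumes "a \<in> \<Phi>" "a \<noteq> - highest_root" shows "- 1 \<le> cpair highest_root a"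
proof (cases "a \<in> pos_roots")
  case True
  then show ?thesis
    using cpair_highest_root[OF True] cpair_self[OF highest_root_nonzero] by (cases "a = highest_root") auto
next
  case False
  then have "- a \<in> pos_roots" "- a \<noteq> highest_root" using root_cases assms minus_minus by metis+
  from cpair_highest_root[OF this] show ?thesis by (auto simp: cpair_minus)
qed

text \<open>For node 0 the reflection adds the pairing of \<theta> with a to the \<delta>-component
  k. That pairing is at least -1, except at a = -\<theta>, where it is -2. So from k at least 1 the
  component turns negative only for the simple root of node 0, and when it reaches 0 the new finite
  part is \<theta> or \<theta> + a, both positive.\<close>

lemma aff_refl_simple_pos:
  assumes b: "b \<in> aff_pos_real_roots" and ne: "b \<noteq> aff_simple i"
  shows "aff_refl (aff_simple i) b \<in> aff_pos_real_roots"
proof -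
  obtain a k where ak: "b = (a, k)" by force
  have aR: "a \<in> \<Phi>" using aff_root_fst[OF b] ak by simp
  show ?thesis
  proof (cases i)
    case (Some j)
    have e: "aff_refl (aff_simple i) b = (refl_root (\<alpha> j) a, k)"
      using Some ak by (simp add: aff_refl_def refl_root_def)
    show ?thesis
      using b[unfolded ak aff_root_iff] ne[unfolded ak Some] refl_simple_pos[of a j] refl_closed[OF simple_roots aR]
      unfolding e aff_root_iff by auto
  next
    case None
    let ?\<theta> = highest_root
    have e: "aff_refl (aff_simple i) b = (refl_root ?\<theta> a, k + cpair ?\<theta> a)"
      using None ak by (simp add: aff_refl_def refl_root_def cpair_neg_root)
    have R: "refl_root ?\<theta> a \<in> \<Phi>" using refl_closed[OF highest_root(1) aR] .
    have I: "cpair ?\<theta> a \<in> \<int>" using crystallographic[OF highest_root(1) aR] .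
    have k: "k = 0 \<and> a \<in> pos_roots \<or> 1 \<le> k \<and> k \<in> \<int>"
      using b unfolding ak aff_root_iff by (auto simp: Ints_def)
    then have kI: "k + cpair ?\<theta> a \<in> \<int>" using I by auto
    consider "k = 0" "a \<in> pos_roots" "a \<noteq> ?\<theta>" | "k = 0" "a = ?\<theta>" | "1 \<le> k" "a = - ?\<theta>"
      | "1 \<le> k" "a \<noteq> - ?\<theta>" using k by auto
    then show ?thesis
    proof cases
      case 1
      then show ?thesis using cpair_highest_root[OF 1(2,3)] R unfolding e aff_root_iff
        by (auto simp: refl_root_def)
    next
      case 2
      then show ?thesis using cpair_self[OF highest_root_nonzero] R unfolding e aff_root_iff by auto
    next
      case 3
      have c: "cpair ?\<theta> a = -2" using 3 cpair_self[OF highest_root_nonzero] by (simp add: cpair_minus)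
      have r: "refl_root ?\<theta> a = ?\<theta>" unfolding refl_root_def c using 3 by (simp add: scaleR_2)
      have "k \<noteq> 1" using 3 ne None ak by auto
      then have "k \<ge> 2" using k 3 by (auto simp: Ints_def)
      then show ?thesis using r c kI highest_root_pos highest_root(1) unfolding e aff_root_iff by auto
    next
      case 4
      have c: "-1 \<le> cpair ?\<theta> a" using cpair_highest_root_ge[OF aR 4(2)] .
      show ?thesis
      proof (cases "k + cpair ?\<theta> a = 0")
        case True
        then have "cpair ?\<theta> a = -1" using c 4 by linarith
        then have r: "refl_root ?\<theta> a = ?\<theta> - (- a)" by (simp add: refl_root_def)
        then have "refl_root ?\<theta> a \<in> pos_roots"
          using R highest_root(2)[OF uminus_root[OF aR]] by (simp add: pos_roots_def)
        then show ?thesis using True unfolding e aff_root_iff by simp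
      next
        case False
        then show ?thesis using c 4 R kI unfolding e aff_root_iff by auto
      qed
    qed
  qed
qed

section \<open>Heights and descent of affine roots\<close>

definition aff_height :: "'a \<times> real \<Rightarrow> real" where
  "aff_height b = height (fst b) + snd b * (1 + height highest_root)"

text \<open>The factor \<open>1 + height highest_root\<close> in the definition is the height of
  \<delta>, the sum of \<theta> and the simple root of node 0; it is chosen to give this root height
  1.\<close>

lemma aff_height_simple [simp]: "aff_height (aff_simple i) = 1"
  by (cases i) (auto simp: aff_height_def height_simps)

lemma aff_height_refl: "aff_height (aff_refl a b) = aff_height b - cpair (fst a) (fst b) * aff_height a"
  by (simp add: aff_height_def aff_refl_fst aff_refl_snd) (simp add: refl_root_def height_simps algebra_simps)

lemma aff_height_nat:
  assumes "b \<in> aff_pos_real_roots" shows "aff_height b \<in> \<nat>"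
proof -
  have \<theta>: "height highest_root \<in> \<nat>"
    using highest_root_pos height_root_cone by (auto simp: pos_roots_def)
  obtain a k where ak: "b = (a, k)" by force
  from assms have "(k = 0 \<and> a \<in> pos_roots) \<or> (a \<in> \<Phi> \<and> 0 < k \<and> k \<in> \<int>)"
    unfolding ak aff_root_iff .
  then show ?thesis
  proof
    assume "k = 0 \<and> a \<in> pos_roots"
    then show ?thesis using height_root_cone by (auto simp: ak aff_height_def pos_roots_def)
  next
    assume a: "a \<in> \<Phi> \<and> 0 < k \<and> k \<in> \<int>"
    then have "highest_root - (- a) \<in> root_cone" using highest_root(2) uminus_root by blast
    then have n: "height highest_root + height a \<in> \<nat>" using height_root_cone by (fastforce simp: height_simps)
    \<comment> \<open>Moving one copy of \<theta> to a makes every summand natural, because \<theta>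
      + a lies in the cone even when a is negative.\<close>
    have e: "aff_height b = (height highest_root + height a) + k + (k - 1) * height highest_root"
      by (simp add: ak aff_height_def algebra_simps)
    have "k \<in> \<nat>" "k - 1 \<in> \<nat>" using a by (auto elim!: Ints_cases simp: Nats_altdef2)
    then show ?thesis unfolding e using n \<theta> by auto
  qed
qed

text \<open>Suppose all affine simple roots pair nonpositively with the finite part a. Node 0 then
  makes \<theta> \<bullet> a nonnegative, and the cone, containing a if k = 0 and \<theta> + a if k
  > 0, makes a \<bullet> a nonpositive.\<close>

lemma ex_simple_descent:
  assumes b: "b \<in> aff_pos_real_roots" shows "\<exists>i. 0 < cpair (cl_simple i) (fst b)"
proof -
  obtain a k where ak: "b = (a, k)" by force
  have aR: "a \<in> \<Phi>" using aff_root_fst[OF b] ak by simp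
  have aa: "0 < a \<bullet> a" using root_nonzero[OF aR] by simp
  show ?thesis
  proof (rule ccontr)
    assume no: "\<not> ?thesis"
    then have np: "cl_simple i \<bullet> a \<le> 0" for i
      using cpair_pos_iff[OF cl_simple_nonzero, of i a] ak by (metis fst_conv not_less)
    have cone: "x \<bullet> a \<le> 0" if "x \<in> root_cone" for x
      unfolding inner_expansion[of x] using coord_root_cone[OF that] np[of "Some _"]
      by (intro sum_nonpos) (simp add: mult_nonneg_nonpos)
    have \<theta>: "0 \<le> highest_root \<bullet> a" using np[of None] by simp
    from b have "(k = 0 \<and> a \<in> pos_roots) \<or> (a \<in> \<Phi> \<and> 0 < k \<and> k \<in> \<int>)"
      unfolding ak aff_root_iff .
    then show False
    proof
      assume "k = 0 \<and> a \<in> pos_roots"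
      then show False using cone[of a] aa by (auto simp: pos_roots_def)
    next
      assume a: "a \<in> \<Phi> \<and> 0 < k \<and> k \<in> \<int>"
      then have "highest_root - (- a) \<in> root_cone" using highest_root(2) uminus_root by blast
      from cone[OF this] show False using \<theta> aa by (simp add: inner_add_left)
    qed
  qed
qed

text \<open>The step keeps the sign condition on the chosen node: it makes the pairing with that
  node strictly decrease along a step labelled b, which drives the inductions on
  \<open>step_len\<close>.\<close>

lemma aff_root_induct [consumes 1, case_names simple step]:
  assumes "b \<in> aff_pos_real_roots"
    and "\<And>i. P (aff_simple i)"
    and "\<And>b i. b \<in> aff_pos_real_roots \<Longrightarrow> b \<noteq> aff_simple i \<Longrightarrow> 0 < cpair (cl_simple i) (fst b)
      \<Longrightarrow> aff_refl (aff_simple i) b \<in> aff_pos_real_roots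
      \<Longrightarrow> P (aff_refl (aff_simple i) b) \<Longrightarrow> P b"
  shows "P b"
  using assms(1)
proof (induction "nat \<lfloor>aff_height b\<rfloor>" arbitrary: b rule: less_induct)
  case less
  obtain i where i: "0 < cpair (cl_simple i) (fst b)" using ex_simple_descent[OF less.prems] by auto
  show ?case
  proof (cases "b = aff_simple i")
    case True then show ?thesis using assms(2) by simp
  next
    case False
    let ?c = "aff_refl (aff_simple i) b"
    have c: "?c \<in> aff_pos_real_roots" using aff_refl_simple_pos[OF less.prems False] .
    have "aff_height ?c < aff_height b" using i by (simp add: aff_height_refl cl_simple_fst)
    then have "nat \<lfloor>aff_height ?c\<rfloor> < nat \<lfloor>aff_height b\<rfloor>"
      using aff_height_nat[OF c] aff_height_nat[OF less.prems] by (auto simp: Nats_def)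
    from less.hyps[OF this c] show ?thesis using assms(3)[OF less.prems False i c] by blast
  qed
qed

text \<open>By reducedness the finite parts agree, and then so do the multipliers. This recovers the
  label of a step from its two ends.\<close>

lemma aff_roots_parallel:
  assumes "b \<in> aff_pos_real_roots" "c \<in> aff_pos_real_roots" "s *\<^sub>R b = t *\<^sub>R c" "0 < s" "0 < t"
  shows "b = c"
proof -
  obtain a k where ak: "b = (a, k)" by force
  obtain a' k' where ak': "c = (a', k')" by force
  have R: "a \<in> \<Phi>" "a' \<in> \<Phi>" using aff_root_fst assms(1,2) ak ak' by force+
  have "a' = (s / t) *\<^sub>R a" "s * k = t * k'" using assms(3-5) by (auto simp: ak ak' divide_inverse_commute)
      (metis (no_types) less_irrefl scaleR_scaleR scaleR_one left_inverse)
  then have "s / t = 1 \<or> s / t = -1" using reduced[OF R(1), of "s / t"] R(2) by simp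
  moreover have "0 < s / t" using assms by simp
  ultimately have "s / t = 1" by linarith
  then have "s = t" using assms by simp
  then show ?thesis using assms by simp
qed

subsection \<open>The semi-infinite length\<close>

text \<open>For \<open>\<mu> = w\<Lambda>\<close> with \<open>w\<close> of minimal length, \<open>sign_len \<mu>\<close> is the length of \<open>w\<close> up to
  a constant depending on \<open>\<Lambda>\<close> only, and \<open>qweight \<mu> (w\<gamma>)\<close> is the pairing of \<open>\<gamma>\<close> with
  \<open>2\<rho> - 2\<rho>_J\<close>. Hence \<open>step_len \<mu> (w\<gamma> + k\<delta>) = 1\<close> is the condition on the edges of the quantum
  Bruhat graph, Bruhat ones for \<open>k = 0\<close> and quantum ones for \<open>k = 1\<close>.\<close>

definition sign_len :: "'a \<Rightarrow> real" where
  "sign_len m = - (\<Sum>b\<in>pos_roots. sgn (b \<bullet> m)) / 2"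

definition qweight :: "'a \<Rightarrow> 'a \<Rightarrow> real" where
  "qweight m a = (\<Sum>b\<in>\<Phi>. cpair a b * sgn (b \<bullet> m)) / 2"

definition step_len :: "'a \<Rightarrow> 'a \<times> real \<Rightarrow> real" where
  "step_len m b = sign_len (refl_root (fst b) m) - sign_len m + snd b * qweight m (fst b)"

lemma qweight_pos_roots: "qweight m a = (\<Sum>b\<in>pos_roots. cpair a b * sgn (b \<bullet> m))"
  unfolding qweight_def by (subst sum_roots_decomp) (auto simp: cpair_minus sgn_minus)

text \<open>Summing over all of \<Phi> and halving makes the invariance immediate: an isometry
  permuting \<Phi> just reindexes the sum.\<close>

lemma qweight_isometry:
  assumes "linear w" "\<And>x y. w x \<bullet> w y = x \<bullet> y" "w ` \<Phi> = \<Phi>"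
  shows "qweight (w m) (w a) = qweight m a"
proof -
  have "inj_on w \<Phi>" by (rule eq_card_imp_inj_on[OF finite_roots]) (simp add: assms(3))
  then have "(\<Sum>b\<in>w ` \<Phi>. cpair (w a) b * sgn (b \<bullet> w m)) = (\<Sum>b\<in>\<Phi>. cpair a b * sgn (b \<bullet> m))"
    by (subst sum.reindex) (simp_all add: assms(2) cpair_isometry[of w])
  then show ?thesis by (simp add: qweight_def assms(3))
qed

lemma qweight_refl:
  assumes "c \<in> \<Phi>" shows "qweight (refl_root c m) (refl_root c a) = qweight m a"
  by (intro qweight_isometry refl_root_linear inner_refl_refl refl_root_image assms)

text \<open>\<open>cpair\<close> is not additive in its root argument, but reflections act linearly
  on coroots: the coroot of r_c a is that of a minus \<open>cpair a c\<close> times that of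
  c.\<close>

lemma qweight_refl_right: "qweight m (refl_root c a) = qweight m a - cpair a c * qweight m c" if "c \<noteq> 0"
proof -
  have "cpair (refl_root c a) b = cpair a b - cpair a c * cpair c b" for b
    by (simp add: cpair_refl_left) (simp add: refl_root_def cpair_diff cpair_scaleR mult.commute)
  then show ?thesis
    by (simp add: qweight_def left_diff_distrib sum_subtractf diff_divide_distrib mult.assoc sum_distrib_left)
qed

lemma qweight_refl_left:
  assumes "c \<in> \<Phi>" shows "qweight (refl_root c m) a = qweight m a - cpair a c * qweight m c"
  using qweight_refl[OF assms, of m "refl_root c a"] qweight_refl_right[of c m a] root_nonzero[OF assms] by simp

lemma qweight_neg: "qweight m (- a) = - qweight m a"
  by (simp add: qweight_def cpair_neg_root sum_negf)

text \<open>Adding the sum to its reindexing by r_a gives terms \<open>cpair a b\<close> times the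
  difference of the signs at b and at r_a b. The arguments of these signs differ by
  \<open>cpair a b\<close> times a \<bullet> m, so each term is nonnegative, and the one for b = a
  is positive.\<close>

lemma qweight_pos:
  assumes a: "a \<in> \<Phi>" and pos: "0 < a \<bullet> m" shows "0 < qweight m a"
proof -
  have a0: "a \<noteq> 0" using root_nonzero a by auto
  have "inj_on (refl_root a) \<Phi>" using inj_refl_root inj_on_subset by blast
  then have "(\<Sum>b\<in>refl_root a ` \<Phi>. cpair a b * sgn (b \<bullet> m))
      = (\<Sum>b\<in>\<Phi>. - (cpair a b * sgn (refl_root a b \<bullet> m)))"
    by (subst sum.reindex) (simp_all add: cpair_refl_same)
  then have "4 * qweight m a = (\<Sum>b\<in>\<Phi>. cpair a b * (sgn (b \<bullet> m) - sgn (refl_root a b \<bullet> m)))"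
    by (simp add: refl_root_image[OF a] qweight_def right_diff_distrib sum_subtractf sum_negf)
  also have "\<dots> > 0"
  proof (rule sum_pos2[OF finite_roots a])
    show "0 < cpair a a * (sgn (a \<bullet> m) - sgn (refl_root a a \<bullet> m))"
      using pos by (simp add: cpair_self[OF a0] refl_root_self[OF a0])
    fix b
    have mono: "x \<le> y \<Longrightarrow> sgn x \<le> sgn y" for x y :: real by (auto simp: sgn_if)
    have e: "refl_root a b \<bullet> m = b \<bullet> m - cpair a b * (a \<bullet> m)"
      by (simp add: refl_root_def inner_diff_left)
    show "0 \<le> cpair a b * (sgn (b \<bullet> m) - sgn (refl_root a b \<bullet> m))"
    proof (cases "0 \<le> cpair a b")
      case True
      then have "refl_root a b \<bullet> m \<le> b \<bullet> m" using pos by (simp add: e)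
      then show ?thesis using True mono by simp
    next
      case False
      then have "b \<bullet> m \<le> refl_root a b \<bullet> m" using pos by (simp add: e mult_nonpos_nonneg)
      then show ?thesis using False mono by (simp add: mult_nonpos_nonpos)
    qed
  qed
  finally show ?thesis by simp
qed

lemma sign_len_refl_sum: "sign_len (refl_root a m) = - (\<Sum>b\<in>pos_roots. sgn (refl_root a b \<bullet> m)) / 2"
  by (simp add: sign_len_def inner_refl_root)

text \<open>The reflection permutes the positive roots other than \<alpha> i, so only the sign at
  \<alpha> i flips.\<close>

lemma sign_len_simple: "sign_len (refl_root (\<alpha> i) m) = sign_len m + sgn (\<alpha> i \<bullet> m)"
proof -
  let ?P = "pos_roots - {\<alpha> i}"
  have split: "(\<Sum>b\<in>pos_roots. g b) = g (\<alpha> i) + (\<Sum>b\<in>?P. g b)" for g :: "'a \<Rightarrow> real"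
    by (rule sum.remove[OF finite_pos_roots simple_pos])
  have "inj_on (refl_root (\<alpha> i)) ?P" using inj_refl_root inj_on_subset by blast
  then have "(\<Sum>b\<in>refl_root (\<alpha> i) ` ?P. sgn (b \<bullet> m)) = (\<Sum>b\<in>?P. sgn (refl_root (\<alpha> i) b \<bullet> m))"
    by (subst sum.reindex) simp_all
  then have "(\<Sum>b\<in>?P. sgn (refl_root (\<alpha> i) b \<bullet> m)) = (\<Sum>b\<in>?P. sgn (b \<bullet> m))"
    by (simp add: refl_simple_pos_image)
  then show ?thesis
    unfolding sign_len_refl_sum unfolding sign_len_def split
    by (simp add: refl_root_self[OF root_nonzero[OF simple_roots]] sgn_minus field_simps)
qed

text \<open>The positive roots pairing to 1 with the coroot of the highest root \<open>\<theta>\<close> are permuted by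
  \<open>b \<mapsto> \<theta> - b\<close>; those pairing to 0 are fixed by the reflection.\<close>
lemma sign_len_highest:
  "sign_len (refl_root highest_root m) = sign_len m - sgn (highest_root \<bullet> m) + qweight m highest_root"
proof -
  let ?\<theta> = highest_root and ?P = "pos_roots - {highest_root}"
  let ?A = "{b \<in> ?P. cpair ?\<theta> b = 1}"
  have split: "(\<Sum>b\<in>pos_roots. g b) = g ?\<theta> + (\<Sum>b\<in>?P. g b)" for g :: "'a \<Rightarrow> real"
    by (rule sum.remove[OF finite_pos_roots highest_root_pos])
  have mem: "?\<theta> - b \<in> ?A" if "b \<in> ?A" for b
  proof -
    have bR: "b \<in> \<Phi>" using that pos_roots_subset by auto
    have "- refl_root ?\<theta> b \<in> \<Phi>" using refl_closed[OF highest_root(1) bR] uminus_root by auto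
    then have "?\<theta> - b \<in> \<Phi>" using that by (simp add: refl_root_def)
    then have "?\<theta> - b \<in> pos_roots" using highest_root(2)[OF bR] by (simp add: pos_roots_def)
    moreover have "cpair ?\<theta> (?\<theta> - b) = 1"
      using that by (simp add: cpair_diff cpair_self[OF highest_root_nonzero])
    moreover have "?\<theta> - b \<noteq> ?\<theta>" using root_nonzero[OF bR] by simp
    ultimately show ?thesis by auto
  qed
  have flip: "(\<Sum>b\<in>?A. sgn (b \<bullet> m)) = (\<Sum>b\<in>?A. sgn ((?\<theta> - b) \<bullet> m))"
    by (rule sum.reindex_bij_witness[of _ "\<lambda>b. ?\<theta> - b" "\<lambda>b. ?\<theta> - b"]) (use mem in auto)
  have A: "(\<Sum>b\<in>?P. g b * cpair ?\<theta> b) = (\<Sum>b\<in>?A. g b)" for g :: "'a \<Rightarrow> real"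
  proof -
    have "(\<Sum>b\<in>?P. g b * cpair ?\<theta> b) = (\<Sum>b\<in>?P. if cpair ?\<theta> b = 1 then g b else 0)"
      by (rule sum.cong) (use cpair_highest_root in auto)
    also have "\<dots> = (\<Sum>b\<in>?A. g b)"
      using finite_pos_roots by (subst sum.inter_filter[symmetric]) auto
    finally show ?thesis .
  qed
  \<comment> \<open>The factor \<open>cpair ?\<theta> b\<close> is the indicator of
    \<open>?A\<close> and merges the cases of pairing 0 and 1.\<close>
  have "(\<Sum>b\<in>?P. sgn (refl_root ?\<theta> b \<bullet> m))
      = (\<Sum>b\<in>?P. sgn (b \<bullet> m) + (- sgn ((?\<theta> - b) \<bullet> m) - sgn (b \<bullet> m)) * cpair ?\<theta> b)"
  proof (rule sum.cong)
    fix b assume b: "b \<in> ?P"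
    then have "cpair ?\<theta> b = 0 \<or> cpair ?\<theta> b = 1" using cpair_highest_root by auto
    then show "sgn (refl_root ?\<theta> b \<bullet> m)
        = sgn (b \<bullet> m) + (- sgn ((?\<theta> - b) \<bullet> m) - sgn (b \<bullet> m)) * cpair ?\<theta> b"
    proof
      assume "cpair ?\<theta> b = 1"
      moreover have "(b - ?\<theta>) \<bullet> m = - ((?\<theta> - b) \<bullet> m)" by (simp add: inner_diff_left)
      ultimately show ?thesis by (simp add: refl_root_def sgn_minus del: minus_diff_eq)
    qed (simp add: refl_root_def)
  qed simp
  also have "\<dots> = (\<Sum>b\<in>?P. sgn (b \<bullet> m)) + (\<Sum>b\<in>?A. - sgn ((?\<theta> - b) \<bullet> m) - sgn (b \<bullet> m))"
    by (simp only: sum.distrib A)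
  finally have 1: "(\<Sum>b\<in>?P. sgn (refl_root ?\<theta> b \<bullet> m)) = (\<Sum>b\<in>?P. sgn (b \<bullet> m)) - 2 * (\<Sum>b\<in>?A. sgn (b \<bullet> m))"
    using flip by (simp add: sum_subtractf sum_negf)
  have 2: "qweight m ?\<theta> = 2 * sgn (?\<theta> \<bullet> m) + (\<Sum>b\<in>?A. sgn (b \<bullet> m))"
    unfolding qweight_pos_roots split using A[of "\<lambda>b. sgn (b \<bullet> m)"]
    by (simp add: cpair_self[OF highest_root_nonzero] mult.commute)
  show ?thesis
    unfolding sign_len_refl_sum unfolding sign_len_def split 1 2
    by (simp add: refl_root_self[OF highest_root_nonzero] sgn_minus field_simps)
qed

text \<open>The \<open>qweight\<close> term is present only for node 0, whose simple root has
  \<delta>-component 1; it accounts for the translation contained in that affine reflection.\<close>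

lemma sign_len_aff_simple:
  "sign_len (refl_root (cl_simple i) m)
    = sign_len m + sgn (cpair (cl_simple i) m) - snd (aff_simple i) * qweight m (cl_simple i)"
  by (cases i)
    (simp_all add: sign_len_highest sign_len_simple sgn_cpair refl_root_neg_root qweight_neg sgn_minus cpair_neg_root
      highest_root_nonzero root_nonzero[OF simple_roots])

lemma step_len_simple:
  assumes "0 < cpair (cl_simple i) m" shows "step_len m (aff_simple i) = 1"
  using assms sign_len_aff_simple[of i m] by (simp add: step_len_def cl_simple_fst)

text \<open>Both ends of the step move by r_i, and each contributes the sign in
  \<open>sign_len_aff_simple\<close>; the \<open>qweight\<close> terms left over cancel against the
  change of the \<delta>-component of the label.\<close>

lemma step_len_refl:
  assumes "fst b \<in> \<Phi>"
  shows "step_len (refl_root (cl_simple i) m) (aff_refl (aff_simple i) b)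
    = step_len m b + sgn (cpair (cl_simple i) (refl_root (fst b) m)) - sgn (cpair (cl_simple i) m)"
proof -
  let ?s = "refl_root (cl_simple i)" and ?n = "refl_root (fst b) m"
  have 1: "refl_root (fst (aff_refl (aff_simple i) b)) (?s m) = ?s ?n"
    by (simp add: aff_refl_fst cl_simple_fst[symmetric] refl_root_isometry refl_root_linear inner_refl_refl)
  have 2: "qweight (?s m) (fst (aff_refl (aff_simple i) b)) = qweight m (fst b)"
    by (simp add: aff_refl_fst cl_simple_fst[symmetric] qweight_refl cl_simple_root)
  have 3: "snd (aff_refl (aff_simple i) b) = snd b - cpair (cl_simple i) (fst b) * snd (aff_simple i)"
    by (simp add: aff_refl_snd cl_simple_fst)
  show ?thesis
    unfolding step_len_def 1 2 3 sign_len_aff_simple qweight_refl_left[OF assms]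
    by (simp add: algebra_simps)
qed

lemma cpair_step_less:
  assumes "0 < cpair (fst b) m" "0 < cpair a (fst b)"
  shows "cpair a (refl_root (fst b) m) < cpair a m"
  using assms by (simp add: refl_root_def cpair_diff cpair_scaleR)

lemma sgn_mono: "x \<le> y \<Longrightarrow> sgn x \<le> sgn (y::real)"
  by (auto simp: sgn_if)

lemma aff_refl_pairing:
  "cpair (fst (aff_refl (aff_simple i) b)) (refl_root (cl_simple i) m) = cpair (fst b) m"
  by (simp add: aff_refl_fst cl_simple_fst[symmetric] cpair_refl_refl)

text \<open>Descending the label by a node that pairs positively with it can only lower
  \<open>step_len\<close>, because the pairing with that node decreases along the step; at a simple
  label the value is 1.\<close>

lemma step_len_ge_1:
  assumes "b \<in> aff_pos_real_roots" "0 < cpair (fst b) m"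
  shows "1 \<le> step_len m b"
  using assms
proof (induction arbitrary: m rule: aff_root_induct)
  case (simple i)
  then show ?case by (simp add: step_len_simple cl_simple_fst)
next
  case (step b i)
  have "1 \<le> step_len (refl_root (cl_simple i) m) (aff_refl (aff_simple i) b)"
    by (intro step.IH) (simp add: aff_refl_pairing step.prems)
  moreover have "sgn (cpair (cl_simple i) (refl_root (fst b) m)) \<le> sgn (cpair (cl_simple i) m)"
    using cpair_step_less[OF step.prems step.hyps(3)] by (intro sgn_mono) simp
  ultimately show ?case using step_len_refl[OF aff_root_fst[OF step.hyps(1)], of i m] by simp
qed

subsection \<open>Covers in the affine orbit\<close>

definition aff_step :: "'a \<Rightarrow> 'a \<times> real \<Rightarrow> 'a \<times> real \<Rightarrow> bool" where
  "aff_step \<Lambda> m n \<longleftrightarrow> m \<in> aff_orbit \<Lambda> \<and>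
     (\<exists>b\<in>aff_pos_real_roots. 0 < cpair (fst b) (fst m) \<and> n = aff_refl b m)"

abbreviation aff_le :: "'a \<Rightarrow> 'a \<times> real \<Rightarrow> 'a \<times> real \<Rightarrow> bool" where
  "aff_le \<Lambda> \<equiv> (aff_step \<Lambda>)\<^sup>*\<^sup>*"

lemma aff_less_eq: "aff_less \<Lambda> = (aff_step \<Lambda>)\<^sup>+\<^sup>+"
  unfolding aff_less_def aff_step_def ..

lemma aff_orbit_base: "(\<Lambda>, 0) \<in> aff_orbit \<Lambda>"
  unfolding aff_orbit_def aff_weyl_group_def by (force intro: exI[of _ "[]"])

lemma aff_orbit_simple:
  assumes "m \<in> aff_orbit \<Lambda>" shows "aff_refl (aff_simple i) m \<in> aff_orbit \<Lambda>"
proof -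
  obtain js where m: "m = foldr (\<lambda>i w. aff_refl (aff_simple i) \<circ> w) js id (\<Lambda>, 0)"
    using assms unfolding aff_orbit_def aff_weyl_group_def by auto
  have "aff_refl (aff_simple i) m = foldr (\<lambda>i w. aff_refl (aff_simple i) \<circ> w) (i # js) id (\<Lambda>, 0)"
    by (simp add: m)
  then show ?thesis unfolding aff_orbit_def aff_weyl_group_def by blast
qed

lemma aff_orbit_induct [consumes 1, case_names base step]:
  assumes "m \<in> aff_orbit \<Lambda>" "P (\<Lambda>, 0)"
    and "\<And>i m. m \<in> aff_orbit \<Lambda> \<Longrightarrow> P m \<Longrightarrow> P (aff_refl (aff_simple i) m)"
  shows "P m"
proof -
  have "foldr (\<lambda>i w. aff_refl (aff_simple i) \<circ> w) js id (\<Lambda>, 0) \<in> aff_orbit \<Lambda> \<and>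
      P (foldr (\<lambda>i w. aff_refl (aff_simple i) \<circ> w) js id (\<Lambda>, 0))" for js
    by (induction js) (auto simp: aff_orbit_base assms(2) intro: assms(3) aff_orbit_simple)
  then show ?thesis using assms(1) unfolding aff_orbit_def aff_weyl_group_def by auto
qed

lemma aff_orbit_refl:
  assumes "b \<in> aff_pos_real_roots" "m \<in> aff_orbit \<Lambda>" shows "aff_refl b m \<in> aff_orbit \<Lambda>"
  using assms
proof (induction arbitrary: m rule: aff_root_induct)
  case (simple i)
  then show ?case by (rule aff_orbit_simple)
next
  case (step b i)
  have "aff_refl b m = aff_refl (aff_simple i) (aff_refl (aff_refl (aff_simple i) b) (aff_refl (aff_simple i) m))"
    by (simp add: aff_refl_conj)
  then show ?case using step aff_orbit_simple by metis
qed

lemma aff_step_orbit: "aff_step \<Lambda> m n \<Longrightarrow> m \<in> aff_orbit \<Lambda> \<and> n \<in> aff_orbit \<Lambda>"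
  unfolding aff_step_def using aff_orbit_refl by blast

lemma aff_le_orbit: "aff_le \<Lambda> m n \<Longrightarrow> m \<in> aff_orbit \<Lambda> \<longleftrightarrow> n \<in> aff_orbit \<Lambda>"
  by (induction rule: rtranclp_induct) (auto dest: aff_step_orbit)

lemma aff_less_orbit: "aff_less \<Lambda> m n \<Longrightarrow> m \<in> aff_orbit \<Lambda> \<and> n \<in> aff_orbit \<Lambda>"
  unfolding aff_less_eq by (induction rule: tranclp_induct) (auto dest: aff_step_orbit)

lemma aff_root_snd: "b \<in> aff_pos_real_roots \<Longrightarrow> (snd b = 0 \<and> fst b \<in> pos_roots) \<or> 0 < snd b"
  by (cases b) (auto simp: aff_root_iff)

text \<open>A label with positive \<delta>-component lowers the \<delta>-component of the weight;
  any other is a positive finite root and lowers the height. This lexicographic measure makes the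
  order irreflexive.\<close>

lemma aff_step_measure:
  assumes "aff_step \<Lambda> m n"
  shows "snd n < snd m \<or> snd n = snd m \<and> height (fst n) < height (fst m)"
proof -
  obtain b where b: "b \<in> aff_pos_real_roots" "0 < cpair (fst b) (fst m)" "n = aff_refl b m"
    using assms unfolding aff_step_def by auto
  from aff_root_snd[OF b(1)] show ?thesis
  proof
    assume "snd b = 0 \<and> fst b \<in> pos_roots"
    then show ?thesis using b height_pos[of "fst b"]
      by (simp add: aff_refl_snd aff_refl_fst refl_root_def height_simps)
  qed (use b in \<open>simp add: aff_refl_snd\<close>)
qed

lemma aff_less_measure:
  assumes "aff_less \<Lambda> m n"
  shows "snd n < snd m \<or> snd n = snd m \<and> height (fst n) < height (fst m)"
  using assms unfolding aff_less_eq
  by (induction rule: tranclp_induct) (force dest: aff_step_measure)+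

lemma aff_less_irrefl: "\<not> aff_less \<Lambda> m m"
  using aff_less_measure by blast

lemma aff_less_iff: "aff_less \<Lambda> m n \<longleftrightarrow> aff_le \<Lambda> m n \<and> m \<noteq> n"
  using aff_less_irrefl unfolding aff_less_eq by (metis rtranclpD tranclp_into_rtranclp)

abbreviation pair_simple :: "'i option \<Rightarrow> 'a \<times> real \<Rightarrow> real" where
  "pair_simple i m \<equiv> cpair (cl_simple i) (fst m)"

abbreviation simple_refl :: "'i option \<Rightarrow> 'a \<times> real \<Rightarrow> 'a \<times> real" where
  "simple_refl i \<equiv> aff_refl (aff_simple i)"

lemma pair_simple_refl [simp]: "pair_simple i (simple_refl i m) = - pair_simple i m"
  by (simp add: aff_refl_fst cl_simple_fst[symmetric] cpair_refl_same)

lemma simple_refl_fixed: "pair_simple i m = 0 \<Longrightarrow> simple_refl i m = m"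
  by (simp add: aff_refl_def cl_simple_fst[symmetric])

lemma aff_step_simple:
  assumes "m \<in> aff_orbit \<Lambda>" "0 < pair_simple i m" shows "aff_step \<Lambda> m (simple_refl i m)"
  using assms aff_simple_root unfolding aff_step_def cl_simple_fst by blast

lemma aff_step_simple':
  assumes "m \<in> aff_orbit \<Lambda>" "pair_simple i m < 0" shows "aff_step \<Lambda> (simple_refl i m) m"
  using aff_step_simple[OF aff_orbit_simple[OF assms(1), of i], of i] assms by simp

lemma aff_le_simple:
  assumes "m \<in> aff_orbit \<Lambda>" "0 \<le> pair_simple i m" shows "aff_le \<Lambda> m (simple_refl i m)"
  using aff_step_simple[OF assms(1), of i] simple_refl_fixed[of i m] assms(2)
  by (cases "pair_simple i m = 0") (auto simp: less_le)

lemma aff_le_simple':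
  assumes "m \<in> aff_orbit \<Lambda>" "pair_simple i m \<le> 0" shows "aff_le \<Lambda> (simple_refl i m) m"
  using aff_le_simple[OF aff_orbit_simple[OF assms(1), of i], of i] assms(2) by simp

section \<open>Lifting properties of the affine order\<close>

lemma root_step_reflect:
  assumes "b \<in> aff_pos_real_roots" "b \<noteq> aff_simple i" "m \<in> aff_orbit \<Lambda>" "0 < cpair (fst b) (fst m)"
  shows "aff_step \<Lambda> (simple_refl i m) (simple_refl i (aff_refl b m))"
proof -
  have "0 < cpair (fst (simple_refl i b)) (fst (simple_refl i m))"
    using assms(4) by (simp add: aff_refl_fst cpair_refl_refl)
  then show ?thesis
    unfolding aff_step_def
    using aff_refl_simple_pos[OF assms(1,2)] aff_orbit_simple[OF assms(3)] aff_refl_conj by metis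
qed

text \<open>Every positive affine root except the simple one stays positive under r_i, so each step
  is carried to a step in the same direction unless it is r_i itself.\<close>

lemma aff_step_cases:
  assumes "aff_step \<Lambda> m n"
  shows "n = simple_refl i m \<or> aff_step \<Lambda> (simple_refl i m) (simple_refl i n)"
  using assms root_step_reflect unfolding aff_step_def by metis

text \<open>This and the next three are the lifting properties familiar from Bruhat order. Each runs
  through a chain and reflects its steps one by one; when a step is r_i itself, it is dropped and
  the remaining chain is used.\<close>

lemma lift_left:
  assumes "aff_le \<Lambda> m n" "n \<in> aff_orbit \<Lambda>" "pair_simple i n \<le> 0"
  shows "aff_le \<Lambda> (simple_refl i m) n"
  using assms
proof (induction rule: converse_rtranclp_induct)
  case base
  then show ?case by (rule aff_le_simple')
next
  case (step m m')
  with aff_step_cases[OF step.hyps(1), of i] show ?case by (metis converse_rtranclp_into_rtranclp)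
qed

lemma lift_right:
  assumes "aff_le \<Lambda> m n" "m \<in> aff_orbit \<Lambda>" "0 \<le> pair_simple i m"
  shows "aff_le \<Lambda> m (simple_refl i n)"
  using assms
proof (induction rule: rtranclp_induct)
  case base
  then show ?case by (rule aff_le_simple)
next
  case (step n' n)
  with aff_step_cases[OF step.hyps(2), of i] show ?case
    by (metis aff_refl_invol rtranclp.rtrancl_into_rtrancl)
qed

lemma lift_both_up:
  assumes "aff_le \<Lambda> m n" "n \<in> aff_orbit \<Lambda>" "0 \<le> pair_simple i n"
  shows "aff_le \<Lambda> (simple_refl i m) (simple_refl i n)"
  using assms
proof (induction rule: converse_rtranclp_induct)
  case base
  then show ?case by simp
next
  case (step m m')
  have "aff_le \<Lambda> m' (simple_refl i n)"
    using step.hyps(2) aff_le_simple[OF step.prems] by simp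
  with step aff_step_cases[OF step.hyps(1), of i] show ?case by (metis converse_rtranclp_into_rtranclp)
qed

lemma lift_both_down:
  assumes "aff_le \<Lambda> m n" "m \<in> aff_orbit \<Lambda>" "pair_simple i m \<le> 0"
  shows "aff_le \<Lambda> (simple_refl i m) (simple_refl i n)"
  using assms
proof (induction rule: rtranclp_induct)
  case base
  then show ?case by simp
next
  case (step n' n)
  have "aff_le \<Lambda> (simple_refl i m) n'"
    using aff_le_simple'[OF step.prems] step.hyps(1) by simp
  with step aff_step_cases[OF step.hyps(2), of i] show ?case
    by (metis aff_refl_invol rtranclp.rtrancl_into_rtrancl)
qed

section \<open>Covers and simple reflections\<close>

definition no_between :: "'a \<Rightarrow> 'a \<times> real \<Rightarrow> 'a \<times> real \<Rightarrow> bool" where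
  "no_between \<Lambda> m n \<longleftrightarrow> \<not> (\<exists>x. aff_less \<Lambda> m x \<and> aff_less \<Lambda> x n)"

lemma aff_step_less: "aff_step \<Lambda> x y \<Longrightarrow> aff_less \<Lambda> x y"
  unfolding aff_less_eq by (rule tranclp.r_into_trancl)

text \<open>Depending on the sign of its pairing, an element strictly between the reflected ends
  either reflects to one between m and n, or lies below n, which puts r_i m strictly between m and
  n.\<close>

lemma no_between_up:
  assumes mn: "no_between \<Lambda> m n" and m: "m \<in> aff_orbit \<Lambda>" and n: "n \<in> aff_orbit \<Lambda>"
    and s: "0 < pair_simple i m" "0 < pair_simple i n"
  shows "no_between \<Lambda> (simple_refl i m) (simple_refl i n)"
  unfolding no_between_def
proof safe
  fix x assume x: "aff_less \<Lambda> (simple_refl i m) x" "aff_less \<Lambda> x (simple_refl i n)"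
  have xo: "x \<in> aff_orbit \<Lambda>" using aff_less_orbit x by blast
  have le: "aff_le \<Lambda> (simple_refl i m) x" "aff_le \<Lambda> x (simple_refl i n)"
    and ne: "simple_refl i m \<noteq> x" "x \<noteq> simple_refl i n"
    using x unfolding aff_less_iff by auto
  show False
  proof (cases "pair_simple i x \<le> 0")
    case True
    have "aff_le \<Lambda> m (simple_refl i x)" "aff_le \<Lambda> (simple_refl i x) n"
      using lift_both_down[OF le(1) aff_orbit_simple[OF m], of i] lift_both_down[OF le(2) xo True] s
      by simp_all
    moreover have "m \<noteq> simple_refl i x" "simple_refl i x \<noteq> n" using ne by auto
    ultimately show False using mn unfolding no_between_def aff_less_iff by blast
  next
    case False
    then have "aff_le \<Lambda> x n" using lift_right[OF le(2) xo, of i] by simp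
    then have "aff_less \<Lambda> (simple_refl i m) n"
      using x(1) unfolding aff_less_eq by (metis tranclp_rtranclp_tranclp)
    then show False using mn aff_step_less[OF aff_step_simple[OF m s(1)]] unfolding no_between_def by blast
  qed
qed

lemma no_between_down:
  assumes mn: "no_between \<Lambda> m n" and m: "m \<in> aff_orbit \<Lambda>" and n: "n \<in> aff_orbit \<Lambda>"
    and s: "pair_simple i m < 0" "pair_simple i n < 0"
  shows "no_between \<Lambda> (simple_refl i m) (simple_refl i n)"
  unfolding no_between_def
proof safe
  fix x assume x: "aff_less \<Lambda> (simple_refl i m) x" "aff_less \<Lambda> x (simple_refl i n)"
  have xo: "x \<in> aff_orbit \<Lambda>" using aff_less_orbit x by blast
  have le: "aff_le \<Lambda> (simple_refl i m) x" "aff_le \<Lambda> x (simple_refl i n)"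
    and ne: "simple_refl i m \<noteq> x" "x \<noteq> simple_refl i n"
    using x unfolding aff_less_iff by auto
  show False
  proof (cases "0 \<le> pair_simple i x")
    case True
    have "aff_le \<Lambda> m (simple_refl i x)" "aff_le \<Lambda> (simple_refl i x) n"
      using lift_both_up[OF le(1) xo True] lift_both_up[OF le(2) aff_orbit_simple[OF n], of i] s
      by simp_all
    moreover have "m \<noteq> simple_refl i x" "simple_refl i x \<noteq> n" using ne by auto
    ultimately show False using mn unfolding no_between_def aff_less_iff by blast
  next
    case False
    then have "aff_le \<Lambda> m x" using lift_left[OF le(1) xo, of i] by simp
    then have "aff_less \<Lambda> m (simple_refl i n)"
      using x(2) unfolding aff_less_eq by (rule rtranclp_tranclp_tranclp)
    then show False using mn aff_step_less[OF aff_step_simple'[OF n s(2)]] unfolding no_between_def by blast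
  qed
qed

text \<open>By lifting, an element in between would lie below m or above r_i m, according to the
  sign of its pairing.\<close>

lemma no_between_simple:
  assumes m: "m \<in> aff_orbit \<Lambda>" and s: "0 < pair_simple i m"
  shows "no_between \<Lambda> m (simple_refl i m)"
  unfolding no_between_def
proof safe
  fix x assume x: "aff_less \<Lambda> m x" "aff_less \<Lambda> x (simple_refl i m)"
  have xo: "x \<in> aff_orbit \<Lambda>" using aff_less_orbit x by blast
  have le: "aff_le \<Lambda> m x" "aff_le \<Lambda> x (simple_refl i m)"
    using x unfolding aff_less_iff by auto
  show False
  proof (cases "0 \<le> pair_simple i x")
    case True
    then have "aff_le \<Lambda> x m" using lift_right[OF le(2) xo True] by simp
    then show False using x(1) aff_less_irrefl unfolding aff_less_eq by (metis tranclp_rtranclp_tranclp)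
  next
    case False
    then have "aff_le \<Lambda> (simple_refl i m) x" using lift_left[OF le(1) xo] by simp
    then show False using x(2) aff_less_irrefl unfolding aff_less_eq by (metis rtranclp_tranclp_tranclp)
  qed
qed

lemma aff_refl_eq_simple:
  assumes b: "b \<in> aff_pos_real_roots" "0 < cpair (fst b) (fst m)"
    and i: "0 < pair_simple i m" and eq: "aff_refl b m = simple_refl i m"
  shows "b = aff_simple i"
  by (rule aff_roots_parallel[OF b(1) aff_simple_root _ b(2) i])
    (use eq in \<open>simp add: aff_refl_def cl_simple_fst\<close>)

text \<open>Induction on the height of \<open>b\<close>: choosing \<open>i\<close> with \<open>\<langle>\<alpha>_i, b\<rangle> > 0\<close> makes the pairing with
  \<open>\<alpha>_i\<close> decrease strictly along the step. If its sign decreases, both sides fail, otherwise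
  both are invariant under \<open>r_i\<close>.\<close>

lemma no_between_iff_step_len:
  assumes "b \<in> aff_pos_real_roots" "m \<in> aff_orbit \<Lambda>" "0 < cpair (fst b) (fst m)"
  shows "no_between \<Lambda> m (aff_refl b m) \<longleftrightarrow> step_len (fst m) b = 1"
  using assms
proof (induction arbitrary: m rule: aff_root_induct)
  case (simple i)
  then show ?case using no_between_simple[of m \<Lambda> i] step_len_simple[of i "fst m"]
    by (simp add: cl_simple_fst)
next
  case (step b i)
  let ?n = "aff_refl b m" and ?c = "simple_refl i b"
  have no: "?n \<in> aff_orbit \<Lambda>" using aff_orbit_refl step by blast
  have cc: "0 < cpair (fst ?c) (fst (simple_refl i m))"
    using step.prems by (simp add: aff_refl_fst cpair_refl_refl)
  have IH: "no_between \<Lambda> (simple_refl i m) (simple_refl i ?n) \<longleftrightarrow> step_len (fst (simple_refl i m)) ?c = 1"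
    using step.IH[OF aff_orbit_simple[OF step.prems(1)] cc] by (simp add: aff_refl_conj)
  have ge: "1 \<le> step_len (fst (simple_refl i m)) ?c"
    by (rule step_len_ge_1[OF step.hyps(4) cc])
  have D: "step_len (fst (simple_refl i m)) ?c = step_len (fst m) b + sgn (pair_simple i ?n) - sgn (pair_simple i m)"
    using step_len_refl[OF aff_root_fst[OF step.hyps(1)], of i "fst m"]
    by (simp add: aff_refl_fst cl_simple_fst)
  have less: "pair_simple i ?n < pair_simple i m"
    using cpair_step_less[OF step.prems(2) step.hyps(3)] by (simp add: aff_refl_fst)
  have step_mn: "aff_step \<Lambda> m ?n" unfolding aff_step_def using step by blast
  consider "0 < pair_simple i ?n" "0 < pair_simple i m" | "pair_simple i ?n < 0" "pair_simple i m < 0"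
    | "pair_simple i ?n \<le> 0" "0 < pair_simple i m" | "pair_simple i ?n < 0" "pair_simple i m = 0"
    using less by linarith
  then show ?case
  proof cases
    case 1
    \<comment> \<open>The converse applies the mirror lemma to the reflected pair, whose pairings
      have the opposite sign.\<close>
    have "no_between \<Lambda> m ?n \<longleftrightarrow> no_between \<Lambda> (simple_refl i m) (simple_refl i ?n)"
      using no_between_up[OF _ step.prems(1) no 1(2,1)]
        no_between_down[OF _ aff_orbit_simple[OF step.prems(1)] aff_orbit_simple[OF no], of i i i] 1 by auto
    then show ?thesis using IH D 1 by simp
  next
    case 2
    have "no_between \<Lambda> m ?n \<longleftrightarrow> no_between \<Lambda> (simple_refl i m) (simple_refl i ?n)"
      using no_between_down[OF _ step.prems(1) no 2(2,1)]
        no_between_up[OF _ aff_orbit_simple[OF step.prems(1)] aff_orbit_simple[OF no], of i i i] 2 by auto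
    then show ?thesis using IH D 2 by simp
  next
    case 3
    \<comment> \<open>Here r_i m lies strictly between the ends: lifting gives comparability, and
      equality with the far end would make the label simple.\<close>
    have "aff_le \<Lambda> (simple_refl i m) ?n"
      using lift_left[OF _ no 3(1), of m] step_mn by blast
    moreover have "simple_refl i m \<noteq> ?n"
      using aff_refl_eq_simple[OF step.hyps(1) step.prems(2) 3(2)] step.hyps(2) by metis
    ultimately have "aff_less \<Lambda> (simple_refl i m) ?n" by (simp add: aff_less_iff)
    then have "\<not> no_between \<Lambda> m ?n"
      using aff_step_less[OF aff_step_simple[OF step.prems(1) 3(2)]] unfolding no_between_def by blast
    moreover have "sgn (pair_simple i ?n) \<le> 0" using 3 by (simp add: sgn_if)
    moreover have "sgn (pair_simple i m) = 1" using 3 by simp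
    ultimately show ?thesis using D ge by linarith
  next
    case 4
    have "aff_le \<Lambda> m (simple_refl i ?n)"
      using lift_right[OF _ step.prems(1), of ?n i] step_mn 4 by auto
    moreover have "m \<noteq> simple_refl i ?n" using 4 by (metis pair_simple_refl less_irrefl neg_equal_0_iff_equal)
    ultimately have "aff_less \<Lambda> m (simple_refl i ?n)" by (simp add: aff_less_iff)
    then have "\<not> no_between \<Lambda> m ?n"
      using aff_step_less[OF aff_step_simple'[OF no 4(1)]] unfolding no_between_def by blast
    then show ?thesis using D ge 4 by simp
  qed
qed

text \<open>The \<delta>-component of the weight matters only for the orbit and the target; whether
  a label gives a cover is decided by the classical weight. This lets covers descend to the finite
  orbit.\<close>

lemma aff_cover_iff:
  "aff_cover \<Lambda> m b n \<longleftrightarrow> m \<in> aff_orbit \<Lambda> \<and> b \<in> aff_pos_real_roots \<and>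
     0 < cpair (fst b) (fst m) \<and> n = aff_refl b m \<and> step_len (fst m) b = 1"
  unfolding aff_cover_def using no_between_iff_step_len[of b m \<Lambda>] unfolding no_between_def by blast

subsection \<open>Lengths in the Weyl group\<close>

lemma word_Cons [simp]: "word (i # is) = refl_root (\<alpha> i) \<circ> word is"
  by (simp add: word_def)

lemma word_Nil [simp]: "word [] = id"
  by (simp add: word_def)

lemma word_append: "word (is @ js) = word is \<circ> word js"
  by (induction "is") auto

lemma word_rev: "word (rev is) \<circ> word is = id"
  by (induction "is") (auto simp: word_append fun_eq_iff)

lemma weyl_word: "word is \<in> weyl_group"
  by (simp add: weyl_group_def)

lemma weyl_induct [consumes 1, case_names id refl]:
  assumes "w \<in> weyl_group" "P id"
    and "\<And>i w. w \<in> weyl_group \<Longrightarrow> P w \<Longrightarrow> P (refl_root (\<alpha> i) \<circ> w)"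
  shows "P w"
proof -
  have "P (word js)" for js
  proof (induction js)
    case Nil
    show ?case by (simp only: word_Nil assms(2))
  next
    case (Cons j js)
    then show ?case by (simp only: word_Cons) (intro assms(3) weyl_word)
  qed
  then show ?thesis using assms(1) by (auto simp: weyl_group_def)
qed

lemma weyl_id: "id \<in> weyl_group"
  using weyl_word[of "[]"] by simp

lemma weyl_comp: "w \<in> weyl_group \<Longrightarrow> w' \<in> weyl_group \<Longrightarrow> w \<circ> w' \<in> weyl_group"
  unfolding weyl_group_def by (auto simp flip: word_append)

lemma weyl_inverse:
  assumes "w \<in> weyl_group"
  obtains w' where "w' \<in> weyl_group" "\<forall>x. w' (w x) = x" "\<forall>x. w (w' x) = x"
proof -
  obtain js where js: "w = word js" using assms by (auto simp: weyl_group_def)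
  show thesis
    using that[of "word (rev js)"] word_rev[of js] word_rev[of "rev js"]
    by (simp add: js weyl_word fun_eq_iff)
qed

lemma weyl_linear: "w \<in> weyl_group \<Longrightarrow> linear w"
proof (induction rule: weyl_induct)
  case (refl i w)
  then show ?case by (intro linear_compose refl_root_linear)
qed (simp add: linear_iff)

lemma weyl_inner: "w \<in> weyl_group \<Longrightarrow> w x \<bullet> w y = x \<bullet> y"
  by (induction arbitrary: x y rule: weyl_induct) (auto simp: inner_refl_refl)

lemma weyl_cpair: "w \<in> weyl_group \<Longrightarrow> cpair (w x) (w y) = cpair x y"
  by (simp add: cpair_def weyl_inner)

lemma weyl_roots: "w \<in> weyl_group \<Longrightarrow> w ` \<Phi> = \<Phi>"
proof (induction rule: weyl_induct)
  case (refl i w)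
  then show ?case by (metis image_comp refl_root_image simple_roots)
qed simp

lemma weyl_root: "w \<in> weyl_group \<Longrightarrow> b \<in> \<Phi> \<Longrightarrow> w b \<in> \<Phi>"
  using weyl_roots by blast

lemma weyl_neg: "w \<in> weyl_group \<Longrightarrow> w (- x) = - w x"
  using linear_neg weyl_linear by blast

lemma weyl_refl_conj: "w \<in> weyl_group \<Longrightarrow> refl_root (w a) (w v) = w (refl_root a v)"
  by (rule refl_root_isometry) (auto simp: weyl_linear weyl_inner)

lemma weyl_refl_comp: "w \<in> weyl_group \<Longrightarrow> w \<circ> refl_root a = refl_root (w a) \<circ> w"
  by (simp add: fun_eq_iff weyl_refl_conj)

lemma refl_root_weyl: "b \<in> \<Phi> \<Longrightarrow> refl_root b \<in> weyl_group"
proof -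
  have simple: "refl_root (\<alpha> i) \<in> weyl_group" for i using weyl_word[of "[i]"] by simp
  have pos: "refl_root b \<in> weyl_group" if "b \<in> pos_roots" for b
    using that
  proof (induction rule: pos_root_induct)
    case (step b i)
    have "refl_root b = refl_root (\<alpha> i) \<circ> refl_root (refl_root (\<alpha> i) b) \<circ> refl_root (\<alpha> i)"
    proof
      fix x
      show "refl_root b x = (refl_root (\<alpha> i) \<circ> refl_root (refl_root (\<alpha> i) b) \<circ> refl_root (\<alpha> i)) x"
        using weyl_refl_conj[OF simple, of i "refl_root (\<alpha> i) b" "refl_root (\<alpha> i) x"] by simp
    qed
    then show ?case using step.IH simple weyl_comp by metis
  qed (rule simple)
  assume "b \<in> \<Phi>"
  then show ?thesis using root_cases[of b] pos pos[of "- b"] by (auto simp: refl_root_neg_root)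
qed

lemma cpair_rho: "cpair (\<alpha> i) rho = 1"
proof -
  let ?P = "pos_roots - {\<alpha> i}"
  have nz: "\<alpha> i \<noteq> 0" using root_nonzero simple_roots by auto
  have split: "(\<Sum>b\<in>pos_roots. b) = \<alpha> i + (\<Sum>b\<in>?P. b)"
    by (rule sum.remove[OF finite_pos_roots simple_pos])
  have "inj_on (refl_root (\<alpha> i)) ?P" using inj_refl_root inj_on_subset by blast
  then have "(\<Sum>b\<in>refl_root (\<alpha> i) ` ?P. cpair (\<alpha> i) b) = (\<Sum>b\<in>?P. - cpair (\<alpha> i) b)"
    by (subst sum.reindex) (simp_all add: cpair_refl_same)
  then have "(\<Sum>b\<in>?P. cpair (\<alpha> i) b) = 0"
    by (simp add: refl_simple_pos_image sum_negf)
  then show ?thesis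
    by (simp add: rho_def cpair_scaleR split cpair_add cpair_sum cpair_self[OF nz])
qed

lemma rho_pos: assumes "b \<in> pos_roots" shows "0 < b \<bullet> rho"
proof -
  have s: "0 < \<alpha> i \<bullet> rho" for i
    using cpair_rho[of i] cpair_pos_iff[of "\<alpha> i" rho] root_nonzero[OF simple_roots] by simp
  have bc: "b \<in> root_cone" using assms by (simp add: pos_roots_def)
  obtain i where "0 < coord i b" using ex_nonzero_inner_simple[OF _ bc] assms pos_roots_subset by auto
  then show ?thesis unfolding inner_expansion[of b rho]
    using s coord_root_cone[OF bc] by (intro sum_pos2[of _ i]) (auto simp: less_imp_le)
qed

lemma rho_sgn: "b \<in> \<Phi> \<Longrightarrow> b \<bullet> rho \<noteq> 0 \<and> (0 < b \<bullet> rho \<longleftrightarrow> b \<in> pos_roots)"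
  using rho_pos[of b] rho_pos[of "- b"] root_cases[of b] pos_not_neg[of b] by force

lemma inner_weyl_rho:
  assumes "w \<in> weyl_group" "b \<in> \<Phi>" shows "b \<bullet> w rho \<noteq> 0"
proof -
  obtain w' where w': "w' \<in> weyl_group" "\<forall>x. w' (w x) = x" "\<forall>x. w (w' x) = x" using weyl_inverse[OF assms(1)] .
  have "b \<bullet> w rho = w' b \<bullet> w' (w rho)" by (rule weyl_inner[OF w'(1), symmetric])
  also have "\<dots> = w' b \<bullet> rho" by (simp add: w'(2))
  finally show ?thesis using rho_sgn weyl_root[OF w'(1) assms(2)] by auto
qed

text \<open>Passed through the word letter by letter, b stays positive until it equals the current
  simple root. The sign hypothesis forces this to happen, and that letter is the one
  deleted.\<close>

lemma strong_exchange:
  assumes "b \<in> pos_roots" "b \<bullet> word ks rho < 0"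
  shows "\<exists>ls. refl_root b \<circ> word ks = word ls \<and> Suc (length ls) = length ks"
  using assms
proof (induction ks arbitrary: b)
  case Nil
  then show ?case using rho_pos[of b] by simp
next
  case (Cons k ks)
  show ?case
  proof (cases "b = \<alpha> k")
    case True
    then show ?thesis by (intro exI[of _ ks]) (simp add: fun_eq_iff)
  next
    case False
    let ?c = "refl_root (\<alpha> k) b"
    have "?c \<in> pos_roots" using refl_simple_pos Cons.prems False by auto
    moreover have "?c \<bullet> word ks rho < 0" using Cons.prems by (simp add: inner_refl_root)
    ultimately obtain ls where ls: "refl_root ?c \<circ> word ks = word ls" "Suc (length ls) = length ks"
      using Cons.IH by blast
    have "refl_root b (refl_root (\<alpha> k) v) = refl_root (\<alpha> k) (refl_root ?c v)" for v
      by (metis inner_refl_refl refl_root_invol refl_root_isometry refl_root_linear)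
    moreover have "refl_root ?c (word ks v) = word ls v" for v using ls(1) by (metis comp_apply)
    ultimately have "refl_root b \<circ> word (k # ks) = word (k # ls)" by (intro ext) simp
    moreover have "Suc (length (k # ls)) = length (k # ks)" using ls(2) by simp
    ultimately show ?thesis by blast
  qed
qed

lemma sign_len_word_le: "sign_len (word ks rho) - sign_len rho \<le> length ks"
proof (induction ks)
  case (Cons k ks)
  have "sgn (\<alpha> k \<bullet> word ks rho) \<le> 1" by (simp add: sgn_if)
  then show ?case using Cons by (simp add: sign_len_simple)
qed simp

text \<open>A letter that would lower the count is absorbed by an exchange, so words of exactly the
  predicted length are built letter by letter.\<close>

lemma reduced_word:
  "\<exists>js. word js = word ks \<and> real (length js) = sign_len (word ks rho) - sign_len rho"
proof (induction ks)
  case Nil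
  then show ?case by (intro exI[of _ "[]"]) simp
next
  case (Cons k ks)
  obtain js where js: "word js = word ks" "real (length js) = sign_len (word ks rho) - sign_len rho"
    using Cons by auto
  have nz: "\<alpha> k \<bullet> word ks rho \<noteq> 0" using inner_weyl_rho weyl_word simple_roots by auto
  show ?case
  proof (cases "0 < \<alpha> k \<bullet> word ks rho")
    case True
    then show ?thesis using js by (intro exI[of _ "k # js"]) (simp add: sign_len_simple)
  next
    case False
    then have neg: "\<alpha> k \<bullet> word js rho < 0" using nz js by simp
    obtain ls where ls: "refl_root (\<alpha> k) \<circ> word js = word ls" "Suc (length ls) = length js"
      using strong_exchange[OF simple_pos neg] by blast
    have "real (length ls) = real (length js) - 1" using ls(2) by linarith
    moreover have "word ls rho = refl_root (\<alpha> k) (word ks rho)" using ls(1) js(1) by (metis comp_apply)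
    ultimately show ?thesis using js ls neg by (intro exI[of _ ls]) (simp add: sign_len_simple)
  qed
qed

text \<open>No root is orthogonal to a weight in the orbit of \<open>rho\<close>, so the right-hand
  side counts the inversions, the positive roots b with b \<bullet> w rho < 0.\<close>

lemma len_eq: assumes "w \<in> weyl_group" shows "real (len w) = sign_len (w rho) - sign_len rho"
proof -
  obtain ks where ks: "w = word ks" using assms by (auto simp: weyl_group_def)
  obtain js where js: "word js = w" "real (length js) = sign_len (w rho) - sign_len rho"
    using reduced_word[of ks] ks by auto
  have "len w = length js"
    unfolding len_def
  proof (rule Least_equality)
    fix n assume "\<exists>is. length is = n \<and> word is = w"
    then obtain ls where "length ls = n" "word ls = w" by auto
    then have "real (length js) \<le> real n" using sign_len_word_le[of ls] js(2) by simp
    then show "length js \<le> n" by simp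
  qed (use js in auto)
  then show ?thesis using js by simp
qed

lemma len_eq_0: assumes "w \<in> weyl_group" "len w = 0" shows "w = id"
proof -
  obtain ks where "w = word ks" using assms by (auto simp: weyl_group_def)
  then have "\<exists>n. \<exists>is. length is = n \<and> word is = w" by auto
  from LeastI_ex[OF this] assms(2) show ?thesis unfolding len_def by auto
qed

lemma weyl_rho_inj:
  assumes "w \<in> weyl_group" "w' \<in> weyl_group" "w rho = w' rho" shows "w = w'"
proof -
  obtain v where v: "v \<in> weyl_group" "\<forall>y. v (w y) = y" "\<forall>y. w (v y) = y" using weyl_inverse[OF assms(1)] .
  have "(v \<circ> w') rho = rho" using v(2)[rule_format, of rho] assms(3) by simp
  then have "real (len (v \<circ> w')) = 0" using len_eq[OF weyl_comp[OF v(1) assms(2)]] by simp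
  then have "v \<circ> w' = id" using len_eq_0[OF weyl_comp[OF v(1) assms(2)]] by simp
  then have "v (w' x) = x" for x by (simp add: fun_eq_iff)
  then show ?thesis using v(3) by (intro ext) metis
qed

text \<open>For a label of \<delta>-component 0, the bound \<open>step_len_ge_1\<close> at a weight
  in the orbit of \<open>rho\<close> is a statement about lengths.\<close>

lemma len_refl_less:
  assumes "w \<in> weyl_group" "b \<in> pos_roots" "0 < cpair b (w rho)"
  shows "len w < len (refl_root b \<circ> w)"
proof -
  have "refl_root b \<circ> w \<in> weyl_group" using assms refl_root_weyl weyl_comp pos_roots_subset by auto
  moreover have "1 \<le> step_len (w rho) (b, 0)"
    using assms by (intro step_len_ge_1) (auto simp: aff_root_iff)
  ultimately have "real (len w) < real (len (refl_root b \<circ> w))"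
    using len_eq assms(1) by (simp add: step_len_def)
  then show ?thesis by simp
qed

subsection \<open>Bruhat covers\<close>

lemma bruhat_less_len:
  assumes "bruhat_less w w'" shows "len w < len w'"
  using assms unfolding bruhat_less_def by (induction rule: tranclp_induct) auto

text \<open>\<open>bruhat_less\<close> multiplies by reflections on the right. The left reflection
  in b is the right one in the inverse image of b under w, which is positive because it pairs
  positively with \<open>rho\<close>.\<close>

lemma bruhat_less_refl:
  assumes w: "w \<in> weyl_group" and b: "b \<in> pos_roots" "0 < cpair b (w rho)"
  shows "bruhat_less w (refl_root b \<circ> w)"
proof -
  obtain v where v: "v \<in> weyl_group" "\<forall>y. v (w y) = y" "\<forall>y. w (v y) = y" using weyl_inverse[OF w] .
  have vb: "v b \<in> \<Phi>" using weyl_root v b pos_roots_subset by auto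
  have "cpair (v b) rho = cpair b (w rho)" using weyl_cpair[OF w, of "v b" rho] v(3) by simp
  then have "0 < cpair (v b) rho" using b(2) by simp
  then have "0 < v b \<bullet> rho" using cpair_pos_iff[OF root_nonzero[OF vb], of rho] by simp
  then have vp: "v b \<in> pos_roots" using rho_sgn[OF vb] by simp
  have "refl_root b \<circ> w = w \<circ> refl_root (v b)" using weyl_refl_comp[OF w, of "v b"] v(3) by simp
  then show ?thesis
    unfolding bruhat_less_def using vp w len_refl_less[OF w b] by (intro tranclp.r_into_trancl) auto
qed

text \<open>The \<delta>-component never increases along the order, so a chain that begins and ends
  at one level uses only finite labels, and each of its steps is a Bruhat step.\<close>

lemma aff_less_bruhat:
  assumes "aff_less rho m n"
  shows "snd n \<le> snd m \<and> (snd n = snd m \<longrightarrow> (\<forall>w\<in>weyl_group. fst m = w rho \<longrightarrow>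
    (\<exists>w'\<in>weyl_group. fst n = w' rho \<and> bruhat_less w w')))"
proof -
  have step: "snd n \<le> snd m \<and> (snd n = snd m \<longrightarrow> (\<forall>w\<in>weyl_group. fst m = w rho \<longrightarrow>
    (\<exists>w'\<in>weyl_group. fst n = w' rho \<and> bruhat_less w w')))" if st: "aff_step rho m n" for m n
  proof (intro conjI impI ballI)
    show "snd n \<le> snd m" using aff_step_measure[OF st] by auto
    fix w assume eq: "snd n = snd m" and w: "w \<in> weyl_group" "fst m = w rho"
    obtain b where b: "b \<in> aff_pos_real_roots" "0 < cpair (fst b) (fst m)" "n = aff_refl b m"
      using st unfolding aff_step_def by auto
    have "snd b = 0" using b eq by (simp add: aff_refl_snd)
    then have bp: "fst b \<in> pos_roots" using aff_root_snd[OF b(1)] by auto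
    show "\<exists>w'\<in>weyl_group. fst n = w' rho \<and> bruhat_less w w'"
      using bruhat_less_refl[OF w(1) bp] b w refl_root_weyl[of "fst b"] bp pos_roots_subset weyl_comp[OF _ w(1)]
      by (intro bexI[of _ "refl_root (fst b) \<circ> w"]) (auto simp: aff_refl_fst)
  qed
  show ?thesis
    using assms unfolding aff_less_eq
  proof (induction rule: tranclp_induct)
    case (base n)
    then show ?case by (rule step)
  next
    case (step n p)
    note st = \<open>\<And>n m. aff_step rho m n \<Longrightarrow> _\<close>[OF step.hyps(2)]
    show ?case
    proof (intro conjI impI ballI)
      show "snd p \<le> snd m" using step.IH st by linarith
      fix w assume eq: "snd p = snd m" and w: "w \<in> weyl_group" "fst m = w rho"
      have e: "snd n = snd m" "snd p = snd n" using eq step.IH st by linarith+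
      obtain w1 where w1: "w1 \<in> weyl_group" "fst n = w1 rho" "bruhat_less w w1"
        using step.IH e(1) w by blast
      obtain w2 where w2: "w2 \<in> weyl_group" "fst p = w2 rho" "bruhat_less w1 w2"
        using st e(2) w1 by blast
      have "bruhat_less w w2" using w1(3) w2(3) unfolding bruhat_less_def by (rule tranclp_trans)
      then show "\<exists>w'\<in>weyl_group. fst p = w' rho \<and> bruhat_less w w'" using w2 by blast
    qed
  qed
qed

lemma weyl_aff_orbit: "w \<in> weyl_group \<Longrightarrow> (w \<Lambda>, 0) \<in> aff_orbit \<Lambda>"
proof (induction rule: weyl_induct)
  case (refl i w)
  from aff_orbit_simple[OF refl.IH, of "Some i"] show ?case
    by (simp add: aff_refl_def refl_root_def)
qed (simp add: aff_orbit_base)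

text \<open>If the value is 1, the lengths differ by 1 and leave no room. Conversely, an affine
  weight strictly between the two ends at level 0 would itself be at level 0 and give an
  intermediate Weyl group element, so the criterion for affine covers applies on the orbit of
  \<open>rho\<close>.\<close>

lemma bruhat_cover_refl:
  assumes w: "w \<in> weyl_group" and b: "b \<in> pos_roots" "0 < cpair b (w rho)"
  shows "bruhat_cover w (refl_root b \<circ> w) \<longleftrightarrow> step_len (w rho) (b, 0) = 1"
proof
  have rw: "refl_root b \<circ> w \<in> weyl_group" using w b refl_root_weyl weyl_comp pos_roots_subset by auto
  show "bruhat_cover w (refl_root b \<circ> w)" if "step_len (w rho) (b, 0) = 1"
  proof -
    have "real (len (refl_root b \<circ> w)) = real (len w) + 1"
      using that len_eq[OF w] len_eq[OF rw] by (simp add: step_len_def)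
    then have "len (refl_root b \<circ> w) = Suc (len w)" by linarith
    then have "\<not> (\<exists>z. bruhat_less w z \<and> bruhat_less z (refl_root b \<circ> w))"
      using bruhat_less_len by (metis Suc_leI leD)
    then show ?thesis using bruhat_less_refl[OF assms] by (simp add: bruhat_cover_def)
  qed
  assume cov: "bruhat_cover w (refl_root b \<circ> w)"
  have r: "(b, 0) \<in> aff_pos_real_roots" using b by (simp add: aff_root_iff)
  have e: "aff_refl (b, 0) (w rho, 0) = ((refl_root b \<circ> w) rho, 0)"
    by (simp add: aff_refl_def refl_root_def)
  have "no_between rho (w rho, 0) (aff_refl (b, 0) (w rho, 0))"
    unfolding no_between_def e
  proof safe
    fix x assume x: "aff_less rho (w rho, 0) x" "aff_less rho x ((refl_root b \<circ> w) rho, 0)"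
    have s: "snd x = 0" using aff_less_bruhat[OF x(1)] aff_less_bruhat[OF x(2)] by simp
    obtain w1 where w1: "w1 \<in> weyl_group" "fst x = w1 rho" "bruhat_less w w1"
      using aff_less_bruhat[OF x(1)] s w by auto
    obtain w2 where w2: "w2 \<in> weyl_group" "(refl_root b \<circ> w) rho = w2 rho" "bruhat_less w1 w2"
      using aff_less_bruhat[OF x(2)] s w1 by auto
    have "w2 = refl_root b \<circ> w" using weyl_rho_inj[of "refl_root b \<circ> w" w2, OF rw w2(1,2)] by simp
    then show False using cov w1 w2 unfolding bruhat_cover_def by blast
  qed
  then show "step_len (w rho) (b, 0) = 1"
    using no_between_iff_step_len[OF r weyl_aff_orbit[OF w, of rho]] b by simp
qed

text \<open>Passing from m to m' only resolves zero signs. In the descent, the value 1 and the lower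
  bound force the pairing with the chosen node to have equal signs at both ends of the step. As it
  strictly decreases, it is nonzero at both, so m' sees the same signs.\<close>

lemma step_len_regular:
  assumes "b \<in> aff_pos_real_roots" "0 < cpair (fst b) m" "step_len m b = 1"
    and "\<And>a. a \<in> \<Phi> \<Longrightarrow> a \<bullet> m \<noteq> 0 \<Longrightarrow> sgn (a \<bullet> m') = sgn (a \<bullet> m)"
  shows "step_len m' b = 1"
  using assms
proof (induction arbitrary: m m' rule: aff_root_induct)
  case (simple i)
  have "0 < cl_simple i \<bullet> m" using simple(1) by (simp add: cl_simple_fst[symmetric] cpair_pos_iff)
  then have "0 < cl_simple i \<bullet> m'" using simple.prems(3)[OF cl_simple_root, of i] by (metis sgn_greater less_irrefl)
  then show ?case by (intro step_len_simple) (simp add: cpair_pos_iff)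
next
  case (step b i)
  let ?s = "refl_root (cl_simple i)" and ?c = "simple_refl i b"
  have bR: "fst b \<in> \<Phi>" using aff_root_fst step.hyps by blast
  have ge: "1 \<le> step_len (?s m) ?c"
    by (rule step_len_ge_1[OF step.hyps(4)]) (simp add: aff_refl_pairing step.prems)
  have less: "cpair (cl_simple i) (refl_root (fst b) m) < cpair (cl_simple i) m"
    using cpair_step_less[OF step.prems(1) step.hyps(3)] .
  have D: "step_len (?s x) ?c = step_len x b + sgn (cpair (cl_simple i) (refl_root (fst b) x)) - sgn (cpair (cl_simple i) x)" for x
    by (rule step_len_refl[OF bR])
  have sg: "sgn (cpair (cl_simple i) (refl_root (fst b) m)) = sgn (cpair (cl_simple i) m)"
    using ge D[of m] step.prems(2) sgn_mono[OF less_imp_le[OF less]] by simp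
  then have nz: "cpair (cl_simple i) m \<noteq> 0" "cpair (cl_simple i) (refl_root (fst b) m) \<noteq> 0"
    using less by (auto simp: sgn_if split: if_splits)
  have "sgn (cpair (cl_simple i) m') = sgn (cpair (cl_simple i) m)"
  proof -
    have "cl_simple i \<bullet> m \<noteq> 0" using nz(1) by (auto simp: cpair_def)
    from step.prems(3)[OF cl_simple_root this] show ?thesis by (simp add: sgn_cpair)
  qed
  moreover have "sgn (cpair (cl_simple i) (refl_root (fst b) m')) = sgn (cpair (cl_simple i) (refl_root (fst b) m))"
  proof -
    have "refl_root (fst b) (cl_simple i) \<in> \<Phi>" using refl_closed bR cl_simple_root by blast
    moreover have "refl_root (fst b) (cl_simple i) \<bullet> m \<noteq> 0"
      using nz(2) by (auto simp: cpair_def inner_refl_root)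
    ultimately show ?thesis
      using step.prems(3)[of "refl_root (fst b) (cl_simple i)"] by (simp add: sgn_cpair inner_refl_root)
  qed
  moreover have "step_len (?s m') ?c = 1"
  proof (rule step.IH)
    show "0 < cpair (fst ?c) (?s m)" by (simp add: aff_refl_pairing step.prems)
    show "step_len (?s m) ?c = 1" using D[of m] sg step.prems by simp
    fix a assume "a \<in> \<Phi>" "a \<bullet> ?s m \<noteq> 0"
    then show "sgn (a \<bullet> ?s m') = sgn (a \<bullet> ?s m)"
      using step.prems(3)[of "?s a"] refl_closed[OF cl_simple_root] by (simp add: inner_refl_root[symmetric])
  qed
  ultimately show ?case using D[of m'] sg by simp
qed

end

locale dominant_root_system = simple_root_system \<Phi> \<alpha>
  for \<Phi> :: "'a::euclidean_space set" and \<alpha> :: "'i::finite \<Rightarrow> 'a" +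
  fixes \<Lambda> :: 'a
  assumes dominant: "dominant_weight \<Lambda>"
begin

subsection \<open>Minimal coset representatives\<close>

lemma weight_integral: "a \<in> \<Phi> \<Longrightarrow> cpair a \<Lambda> \<in> \<int>"
  using dominant by (auto simp: dominant_weight_def weight_lattice_def)

lemma dominant_pos: assumes "b \<in> pos_roots" shows "0 \<le> b \<bullet> \<Lambda>"
proof -
  have "0 \<le> \<alpha> i \<bullet> \<Lambda>" for i
    using dominant cpair_pos_iff[OF root_nonzero[OF simple_roots], of i "- \<Lambda>"]
    by (auto simp: dominant_weight_def cpair_minus dest!: spec[of _ i])
  moreover have "b \<in> root_cone" using assms by (simp add: pos_roots_def)
  ultimately show ?thesis
    unfolding inner_expansion[of b] by (intro sum_nonneg) (simp add: coord_root_cone)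
qed

lemma dominant_sgn: "a \<in> \<Phi> \<Longrightarrow> a \<bullet> \<Lambda> \<noteq> 0 \<Longrightarrow> sgn (a \<bullet> rho) = sgn (a \<bullet> \<Lambda>)"
  using dominant_pos[of a] dominant_pos[of "- a"] rho_pos[of a] rho_pos[of "- a"] root_cases[of a]
  by (auto simp: sgn_if)

lemma refl_root_stab: "b \<in> \<Phi> \<Longrightarrow> refl_root b \<in> stab \<Lambda> \<longleftrightarrow> b \<bullet> \<Lambda> = 0"
  using refl_root_weyl[of b] root_nonzero[of b] by (auto simp: stab_def refl_root_def cpair_def)

lemma pos_roots_J_eq: "pos_roots_J \<Lambda> = {b \<in> pos_roots. b \<bullet> \<Lambda> = 0}"
  using refl_root_stab pos_roots_subset by (auto simp: pos_roots_J_def)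

lemma stab_comp: "u \<in> stab \<Lambda> \<Longrightarrow> v \<in> stab \<Lambda> \<Longrightarrow> u \<circ> v \<in> stab \<Lambda>"
  by (auto simp: stab_def weyl_comp)

lemma stab_inverse:
  assumes "w \<in> weyl_group" "w' \<in> weyl_group" "w \<Lambda> = w' \<Lambda>"
  obtains u where "u \<in> stab \<Lambda>" "w' = w \<circ> u"
proof -
  obtain v where v: "v \<in> weyl_group" "\<forall>y. v (w y) = y" "\<forall>y. w (v y) = y" using weyl_inverse[OF assms(1)] .
  have "v (w' \<Lambda>) = \<Lambda>" using v(2)[rule_format, of \<Lambda>] assms(3) by simp
  then have "v \<circ> w' \<in> stab \<Lambda>" using weyl_comp v assms by (simp add: stab_def)
  moreover have "w' = w \<circ> (v \<circ> w')" by (simp add: fun_eq_iff v(3))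
  ultimately show thesis using that by blast
qed

lemma ex_min_rep:
  assumes "w \<in> weyl_group" shows "\<exists>u\<in>stab \<Lambda>. w \<circ> u \<in> min_reps \<Lambda>"
proof -
  have "id \<in> stab \<Lambda>" by (simp add: stab_def weyl_id)
  then obtain u where u: "u \<in> stab \<Lambda>" "\<And>v. v \<in> stab \<Lambda> \<Longrightarrow> len (w \<circ> u) \<le> len (w \<circ> v)"
    using ex_has_least_nat[of "\<lambda>u. u \<in> stab \<Lambda>" id "\<lambda>u. len (w \<circ> u)"] by blast
  have "len (w \<circ> u) \<le> len (w \<circ> u \<circ> v)" if "v \<in> stab \<Lambda>" for v
    using u(2)[OF stab_comp[OF u(1) that]] by (simp add: comp_assoc)
  moreover have "w \<circ> u \<in> weyl_group" using assms u by (simp add: stab_def weyl_comp)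
  ultimately show ?thesis using u(1) by (auto simp: min_reps_def)
qed

text \<open>If x a were negative, multiplying x on the right by r_a, which fixes \<Lambda>, would
  shorten it.\<close>

lemma min_reps_J_pos:
  assumes x: "x \<in> min_reps \<Lambda>" and a: "a \<in> pos_roots" "a \<bullet> \<Lambda> = 0" shows "x a \<in> pos_roots"
proof (rule ccontr)
  assume neg: "x a \<notin> pos_roots"
  have xw: "x \<in> weyl_group" using x by (simp add: min_reps_def)
  have aR: "a \<in> \<Phi>" using a pos_roots_subset by auto
  have p: "- x a \<in> pos_roots" using root_cases[OF weyl_root[OF xw aR]] neg by simp
  let ?y = "x \<circ> refl_root a"
  have yw: "?y \<in> weyl_group" using weyl_comp xw refl_root_weyl aR by blast
  have "cpair (- x a) (?y rho) = cpair a rho"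
    by (simp add: cpair_neg_root weyl_cpair[OF xw] cpair_refl_same)
  then have "0 < cpair (- x a) (?y rho)"
    using rho_pos[OF a(1)] by (simp add: cpair_pos_iff root_nonzero[OF aR])
  from len_refl_less[of ?y "- x a", OF yw p this] have "len ?y < len (refl_root (x a) \<circ> ?y)"
    by (simp add: refl_root_neg_root)
  moreover have "refl_root (x a) \<circ> ?y = x"
    by (simp add: fun_eq_iff weyl_refl_conj[OF xw])
  moreover have "len x \<le> len ?y" using x refl_root_stab[OF aR] a by (simp add: min_reps_def)
  ultimately show False by simp
qed

text \<open>Writing y = x u with u in the stabilizer, u permutes the positive roots: those pairing
  positively with \<Lambda> stay positive because u fixes \<Lambda>, and on the others minimality of
  both x and y excludes a change of sign. So u has length 0.\<close>

lemma min_reps_inj: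
  assumes x: "x \<in> min_reps \<Lambda>" and y: "y \<in> min_reps \<Lambda>" and eq: "x \<Lambda> = y \<Lambda>" shows "x = y"
proof -
  have xw: "x \<in> weyl_group" "y \<in> weyl_group" using x y by (auto simp: min_reps_def)
  obtain u where u: "u \<in> stab \<Lambda>" "y = x \<circ> u" using stab_inverse[OF xw eq] by blast
  have uw: "u \<in> weyl_group" "u \<Lambda> = \<Lambda>" using u by (auto simp: stab_def)
  have up: "u a \<in> pos_roots" if a: "a \<in> pos_roots" for a
  proof (rule ccontr)
    assume n: "u a \<notin> pos_roots"
    have aR: "a \<in> \<Phi>" using a pos_roots_subset by auto
    have p: "- u a \<in> pos_roots" using root_cases[OF weyl_root[OF uw(1) aR]] n by simp
    have e: "u a \<bullet> \<Lambda> = a \<bullet> \<Lambda>" using weyl_inner[OF uw(1), of a \<Lambda>] uw(2) by simp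
    then have "a \<bullet> \<Lambda> = 0" using dominant_pos[OF a] dominant_pos[OF p] by simp
    then have "y a \<in> pos_roots" "x (- u a) \<in> pos_roots"
      using min_reps_J_pos[OF y a] min_reps_J_pos[OF x p] e by auto
    then show False using u(2) pos_not_neg[of "y a"] by (simp add: weyl_neg[OF xw(1)])
  qed
  obtain v where "v \<in> weyl_group" and vu: "\<forall>x. v (u x) = x" and "\<forall>x. u (v x) = x" using weyl_inverse[OF uw(1)] .
  have inj: "inj_on u pos_roots" using vu by (auto intro: inj_on_inverseI[of _ v])
  then have img: "u ` pos_roots = pos_roots" using up by (intro endo_inj_surj[OF finite_pos_roots]) auto
  have "(\<Sum>b\<in>u ` pos_roots. sgn (b \<bullet> u rho)) = (\<Sum>b\<in>pos_roots. sgn (b \<bullet> rho))"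
    using inj by (subst sum.reindex) (simp_all add: weyl_inner[OF uw(1)])
  then have "sign_len (u rho) = sign_len rho" by (simp add: img sign_len_def)
  then have "u = id" using len_eq_0[OF uw(1)] len_eq[OF uw(1)] by simp
  then show ?thesis using u(2) by simp
qed

text \<open>The difference \<open>f\<close> of the signs at \<open>rho\<close> and at \<Lambda> is
  odd, vanishes on roots not orthogonal to \<Lambda>, and is nonnegative on positive roots.
  Minimality of x keeps it nonnegative on their images under the inverse of x. Both sums to be
  compared are thus half the sum of the absolute values of \<open>f\<close> over \<Phi>.\<close>

lemma len_min_reps:
  assumes x: "x \<in> min_reps \<Lambda>" shows "real (len x) = sign_len (x \<Lambda>) - sign_len \<Lambda>"
proof -
  have xw: "x \<in> weyl_group" using x by (simp add: min_reps_def)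
  obtain v where v: "v \<in> weyl_group" "\<forall>y. v (x y) = y" "\<forall>y. x (v y) = y" using weyl_inverse[OF xw] .
  define f where "f a = sgn (a \<bullet> rho) - sgn (a \<bullet> \<Lambda>)" for a
  have f0: "f a = 0" if "a \<in> \<Phi>" "a \<bullet> \<Lambda> \<noteq> 0" for a using dominant_sgn[OF that] by (simp add: f_def)
  have fpos: "f a = \<bar>f a\<bar>" if "a \<in> pos_roots" for a
    using f0[of a] rho_pos[OF that] that pos_roots_subset by (cases "a \<bullet> \<Lambda> = 0") (auto simp: f_def)
  have fvpos: "f (v b) = \<bar>f (v b)\<bar>" if "b \<in> pos_roots" for b
  proof (cases "v b \<in> pos_roots")
    case False
    have vR: "v b \<in> \<Phi>" using weyl_root v that pos_roots_subset by auto
    then have p: "- v b \<in> pos_roots" using root_cases False by auto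
    have "v b \<bullet> \<Lambda> \<noteq> 0"
    proof
      assume "v b \<bullet> \<Lambda> = 0"
      then have "x (- v b) \<in> pos_roots" using min_reps_J_pos[OF x p] by simp
      then show False using pos_not_neg[OF that] by (simp add: weyl_neg[OF xw] v(3))
    qed
    then show ?thesis using f0[OF vR] by simp
  qed (rule fpos)
  have fneg: "f (- a) = - f a" for a by (simp add: f_def sgn_minus)
  have vinj: "inj_on v \<Phi>" using v(3) by (metis inj_onI)
  have "2 * (\<Sum>b\<in>pos_roots. \<bar>f (v b)\<bar>) = (\<Sum>b\<in>\<Phi>. \<bar>f (v b)\<bar>)"
    by (rule sum_roots_decomp[symmetric]) (simp add: weyl_neg[OF v(1)] fneg)
  also have "\<dots> = (\<Sum>b\<in>v ` \<Phi>. \<bar>f b\<bar>)" by (simp add: sum.reindex[OF vinj])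
  also have "\<dots> = 2 * (\<Sum>b\<in>pos_roots. \<bar>f b\<bar>)"
    unfolding weyl_roots[OF v(1)] by (rule sum_roots_decomp) (simp add: fneg)
  finally have "(\<Sum>b\<in>pos_roots. f (v b)) = (\<Sum>b\<in>pos_roots. f b)"
    using fpos fvpos by (simp cong: sum.cong)
  moreover have "f (v b) = sgn (b \<bullet> x rho) - sgn (b \<bullet> x \<Lambda>)" for b
    using weyl_inner[OF xw, of "v b"] by (simp add: f_def v(3))
  ultimately have "(\<Sum>b\<in>pos_roots. sgn (b \<bullet> x rho) - sgn (b \<bullet> x \<Lambda>)) = (\<Sum>b\<in>pos_roots. sgn (b \<bullet> rho) - sgn (b \<bullet> \<Lambda>))"
    by (simp add: f_def)
  then show ?thesis
    unfolding len_eq[OF xw] sign_len_def by (simp add: sum_subtractf field_simps)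
qed

lemma min_rep_props:
  assumes "w \<in> weyl_group"
  shows "min_rep \<Lambda> w \<in> min_reps \<Lambda>" "min_rep \<Lambda> w \<Lambda> = w \<Lambda>" "len (min_rep \<Lambda> w) \<le> len w"
proof -
  have ex1: "\<exists>!x. x \<in> min_reps \<Lambda> \<and> (\<exists>u\<in>stab \<Lambda>. x = w \<circ> u)"
  proof (rule ex_ex1I)
    show "\<exists>x. x \<in> min_reps \<Lambda> \<and> (\<exists>u\<in>stab \<Lambda>. x = w \<circ> u)" using ex_min_rep[OF assms] by blast
    fix x y assume "x \<in> min_reps \<Lambda> \<and> (\<exists>u\<in>stab \<Lambda>. x = w \<circ> u)" "y \<in> min_reps \<Lambda> \<and> (\<exists>u\<in>stab \<Lambda>. y = w \<circ> u)"
    then show "x = y" by (intro min_reps_inj) (auto simp: stab_def)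
  qed
  obtain u where u: "min_rep \<Lambda> w \<in> min_reps \<Lambda>" "u \<in> stab \<Lambda>" "min_rep \<Lambda> w = w \<circ> u"
    using theI'[OF ex1] unfolding min_rep_def by blast
  show "min_rep \<Lambda> w \<in> min_reps \<Lambda>" "min_rep \<Lambda> w \<Lambda> = w \<Lambda>" using u by (auto simp: stab_def)
  have uw: "u \<in> weyl_group" "u \<Lambda> = \<Lambda>" using u by (auto simp: stab_def)
  obtain v where v: "v \<in> weyl_group" "\<forall>x. v (u x) = x" "\<forall>x. u (v x) = x"
    using weyl_inverse[OF uw(1)] .
  have "v \<Lambda> = \<Lambda>" using v(2)[rule_format, of \<Lambda>] uw(2) by simp
  then have "len (min_rep \<Lambda> w) \<le> len (min_rep \<Lambda> w \<circ> v)" using u(1) v by (auto simp: min_reps_def stab_def)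
  also have "min_rep \<Lambda> w \<circ> v = w" by (simp add: u(3) fun_eq_iff v(3))
  finally show "len (min_rep \<Lambda> w) \<le> len w" .
qed

subsection \<open>Edges of the quantum Bruhat graph\<close>

lemma qweight_weyl: "w \<in> weyl_group \<Longrightarrow> qweight (w m) (w a) = qweight m a"
  by (intro qweight_isometry weyl_linear weyl_inner weyl_roots)

text \<open>On positive roots the sign of the pairing with \<Lambda> is the indicator of the
  complement of \<open>pos_roots_J\<close>; this is where the weight of the quantum edges comes
  from.\<close>

lemma qweight_dominant: "qweight \<Lambda> a = cpair a (2 *\<^sub>R rho - 2 *\<^sub>R rho_J \<Lambda>)"
proof -
  have sub: "pos_roots_J \<Lambda> \<subseteq> pos_roots" by (auto simp: pos_roots_J_def)
  have "2 *\<^sub>R rho - 2 *\<^sub>R rho_J \<Lambda> = (\<Sum>b\<in>pos_roots - pos_roots_J \<Lambda>. b)"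
    by (simp add: rho_def rho_J_def sum_diff[OF finite_pos_roots sub])
  moreover have "qweight \<Lambda> a = (\<Sum>b\<in>pos_roots - pos_roots_J \<Lambda>. cpair a b)"
    unfolding qweight_pos_roots
  proof (rule sum.mono_neutral_cong_right[OF finite_pos_roots])
    show "cpair a b * sgn (b \<bullet> \<Lambda>) = cpair a b" if "b \<in> pos_roots - pos_roots_J \<Lambda>" for b
      using that dominant_pos[of b] by (auto simp: pos_roots_J_eq sgn_if)
  qed (auto simp: pos_roots_J_eq)
  ultimately show ?thesis by (simp add: cpair_sum)
qed

definition weight_edge :: "real \<Rightarrow> 'a \<Rightarrow> 'a \<Rightarrow> bool" where
  "weight_edge \<sigma> m n \<longleftrightarrow> (\<exists>b\<in>aff_pos_real_roots. 0 < cpair (fst b) m \<and> n = refl_root (fst b) m \<and>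
     step_len m b = 1 \<and> \<sigma> * cpair (fst b) m \<in> \<int>)"

lemma qb_edge_min_reps: "qb_edge \<Lambda> w g w' \<Longrightarrow> w \<in> min_reps \<Lambda> \<and> w' \<in> min_reps \<Lambda>"
  unfolding qb_edge_def using min_rep_props(1) weyl_comp refl_root_weyl pos_roots_subset
  by (auto simp: min_reps_def subset_iff)

text \<open>The label g becomes the root w g, since reflecting the weight on the left matches
  multiplying w on the right. The \<delta>-component is taken to be 0 for a Bruhat edge and 1 for a
  quantum edge.\<close>

lemma qb_edge_weight_edge:
  assumes e: "qb_edge \<Lambda> w g w'" and \<sigma>: "\<sigma> * cpair g \<Lambda> \<in> \<int>"
  shows "weight_edge \<sigma> (w \<Lambda>) (w' \<Lambda>)"
proof -
  have wm: "w \<in> min_reps \<Lambda>" and g: "g \<in> pos_roots" "g \<bullet> \<Lambda> \<noteq> 0"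
    and w': "w' = min_rep \<Lambda> (w \<circ> refl_root g)"
    using e by (auto simp: qb_edge_def pos_roots_J_eq)
  have ww: "w \<in> weyl_group" using wm by (simp add: min_reps_def)
  have gR: "g \<in> \<Phi>" using g pos_roots_subset by auto
  have rw: "w \<circ> refl_root g \<in> weyl_group" using weyl_comp ww refl_root_weyl gR by blast
  have rw_eq: "w \<circ> refl_root g = refl_root (w g) \<circ> w" by (rule weyl_refl_comp[OF ww])
  have w'm: "w' \<in> min_reps \<Lambda>" "w' \<Lambda> = refl_root (w g) (w \<Lambda>)" "len w' \<le> len (w \<circ> refl_root g)"
    using min_rep_props[OF rw] w' rw_eq by (auto simp: weyl_refl_conj[OF ww])
  have cp: "cpair (w g) (w \<Lambda>) = cpair g \<Lambda>" by (rule weyl_cpair[OF ww])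
  have "0 < cpair g \<Lambda>" using g dominant_pos[OF g(1)] by (simp add: cpair_pos_iff root_nonzero[OF gR])
  then have pos: "0 < cpair (w g) (w \<Lambda>)" using cp by simp
  have wgR: "w g \<in> \<Phi>" using weyl_root ww gR by blast
  have len: "real (len w') - real (len w) = sign_len (refl_root (w g) (w \<Lambda>)) - sign_len (w \<Lambda>)"
    using len_min_reps[OF wm] len_min_reps[OF w'm(1)] w'm(2) by simp
  have "\<exists>k. (w g, k) \<in> aff_pos_real_roots \<and> step_len (w \<Lambda>) (w g, k) = 1"
  proof (cases "bruhat_cover w (w \<circ> refl_root g)")
    case True
    have cr: "cpair (w g) (w rho) = cpair g rho" by (rule weyl_cpair[OF ww])
    have rpos: "0 < cpair g rho" using rho_pos[OF g(1)] by (simp add: cpair_pos_iff root_nonzero[OF gR])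
    have lt: "len w < len (w \<circ> refl_root g)" using True bruhat_less_len by (simp add: bruhat_cover_def)
    have p: "w g \<in> pos_roots"
    proof (rule ccontr)
      assume "w g \<notin> pos_roots"
      then have n: "- w g \<in> pos_roots" using root_cases wgR by auto
      have "0 < cpair (- w g) ((w \<circ> refl_root g) rho)"
        using rpos by (simp add: cpair_neg_root weyl_cpair[OF ww] cpair_refl_same)
      from len_refl_less[of "w \<circ> refl_root g" "- w g", OF rw n this] have "len (w \<circ> refl_root g) < len w"
        by (simp add: rw_eq refl_root_neg_root flip: comp_assoc)
      then show False using lt by simp
    qed
    have "step_len (w rho) (w g, 0) = 1"
      using bruhat_cover_refl[OF ww p] True rpos cr rw_eq by simp
    then have "real (len (w \<circ> refl_root g)) = real (len w) + 1"
      using len_eq[OF ww] len_eq[OF rw] by (simp add: step_len_def weyl_refl_conj[OF ww])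
    \<comment> \<open>Passing to the minimal representative can only shorten, which bounds the value
      by 1 from above; the general lower bound then gives equality.\<close>
    then have "step_len (w \<Lambda>) (w g, 0) \<le> 1" using len w'm(3) by (simp add: step_len_def)
    moreover have "1 \<le> step_len (w \<Lambda>) (w g, 0)" using p pos by (intro step_len_ge_1) (auto simp: aff_root_iff)
    ultimately show ?thesis using p by (intro exI[of _ 0]) (auto simp: aff_root_iff)
  next
    case False
    then have "real (len w') = real (len w) + 1 - cpair g (2 *\<^sub>R rho - 2 *\<^sub>R rho_J \<Lambda>)"
      using e unfolding qb_edge_def by blast
    then have "step_len (w \<Lambda>) (w g, 1) = 1"
      using len by (simp add: step_len_def qweight_weyl[OF ww] qweight_dominant)
    then show ?thesis using wgR by (intro exI[of _ 1]) (auto simp: aff_root_iff)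
  qed
  then obtain k where "(w g, k) \<in> aff_pos_real_roots" "step_len (w \<Lambda>) (w g, k) = 1" by blast
  then show ?thesis unfolding weight_edge_def using pos w'm(2) cp \<sigma>
    by (intro bexI[of _ "(w g, k)"]) auto
qed

lemma weight_edge_qb_edge:
  assumes wm: "w \<in> min_reps \<Lambda>" and e: "weight_edge \<sigma> (w \<Lambda>) n"
  obtains g w' where "qb_edge \<Lambda> w g w'" "\<sigma> * cpair g \<Lambda> \<in> \<int>" "w' \<Lambda> = n"
proof -
  obtain a k where b: "(a, k) \<in> aff_pos_real_roots" "0 < cpair a (w \<Lambda>)" "n = refl_root a (w \<Lambda>)"
    "step_len (w \<Lambda>) (a, k) = 1" "\<sigma> * cpair a (w \<Lambda>) \<in> \<int>"
    using e unfolding weight_edge_def by force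
  have ww: "w \<in> weyl_group" using wm by (simp add: min_reps_def)
  obtain v where v: "v \<in> weyl_group" "\<forall>y. v (w y) = y" "\<forall>y. w (v y) = y" using weyl_inverse[OF ww] .
  define g where "g = v a"
  have wg: "w g = a" by (simp add: g_def v(3))
  have aR: "a \<in> \<Phi>" using aff_root_fst[OF b(1)] by simp
  have gR: "g \<in> \<Phi>" unfolding g_def using weyl_root v aR by blast
  have cp: "cpair a (w m) = cpair g m" for m using weyl_cpair[OF ww, of g m] wg by simp
  have g\<Lambda>: "0 < g \<bullet> \<Lambda>" using b(2) cp cpair_pos_iff[OF root_nonzero[OF gR]] by simp
  have gp: "g \<in> pos_roots" using dominant_pos[of "- g"] root_cases[OF gR] g\<Lambda> by auto
  have rw: "w \<circ> refl_root g \<in> weyl_group" using weyl_comp ww refl_root_weyl gR by blast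
  have rw_eq: "w \<circ> refl_root g = refl_root a \<circ> w" using weyl_refl_comp[OF ww, of g] wg by simp
  define w' where "w' = min_rep \<Lambda> (w \<circ> refl_root g)"
  have w'm: "w' \<in> min_reps \<Lambda>" "w' \<Lambda> = n"
    using min_rep_props[OF rw] b(3) rw_eq by (auto simp: w'_def)
  have len: "real (len w') - real (len w) = sign_len (refl_root a (w \<Lambda>)) - sign_len (w \<Lambda>)"
    using len_min_reps[OF wm] len_min_reps[OF w'm(1)] w'm(2) b(3) by simp
  have q: "0 < qweight (w \<Lambda>) a" using qweight_pos[OF aR] b(2) cpair_pos_iff[OF root_nonzero[OF aR]] by blast
  have shift: "step_len (w \<Lambda>) (a, k) = step_len (w \<Lambda>) (a, j) + (k - j) * qweight (w \<Lambda>) a" for j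
    by (simp add: step_len_def algebra_simps)
  have ge: "1 \<le> step_len (w \<Lambda>) (a, j)" if "(a, j) \<in> aff_pos_real_roots" for j
    using step_len_ge_1[OF that] b(2) by simp
  have "qb_edge \<Lambda> w g w'"
  proof (cases "k = 0")
    case True
    then have ap: "a \<in> pos_roots" using b(1) by (auto simp: aff_root_iff)
    \<comment> \<open>Bruhat covers are decided at \<open>rho\<close>, so the condition is moved
      there: \<open>rho\<close> has the same sign as \<Lambda> on every root not orthogonal to
      \<Lambda>.\<close>
    have "step_len (w rho) (a, 0) = 1"
    proof (rule step_len_regular[of _ "w \<Lambda>"])
      fix c assume c: "c \<in> \<Phi>" "c \<bullet> w \<Lambda> \<noteq> 0"
      have "c \<bullet> w m = v c \<bullet> m" for m using weyl_inner[OF ww, of "v c" m] v(3) by simp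
      then show "sgn (c \<bullet> w rho) = sgn (c \<bullet> w \<Lambda>)"
        using dominant_sgn[of "v c"] weyl_root[OF v(1) c(1)] c(2) by simp
    qed (use b True in auto)
    moreover have "0 < cpair a (w rho)"
      using cp rho_pos[OF gp] by (simp add: cpair_pos_iff root_nonzero[OF gR])
    ultimately have "bruhat_cover w (w \<circ> refl_root g)"
      using bruhat_cover_refl[OF ww ap] rw_eq by simp
    then show ?thesis using wm gp g\<Lambda> by (simp add: qb_edge_def w'_def pos_roots_J_eq)
  next
    case False
    then have k: "1 \<le> k" using b(1) by (auto simp: aff_root_iff elim!: Ints_cases)
    have "1 \<le> step_len (w \<Lambda>) (a, 1)" using ge[of 1] aR by (simp add: aff_root_iff)
    then have "(k - 1) * qweight (w \<Lambda>) a \<le> 0" using shift[of 1] b(4) by simp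
    then have "k = 1" using k q by (simp add: mult_le_0_iff)
    then have "real (len w') = real (len w) + 1 - cpair g (2 *\<^sub>R rho - 2 *\<^sub>R rho_J \<Lambda>)"
      using b(4) len qweight_weyl[OF ww, of \<Lambda> g] wg by (simp add: step_len_def qweight_dominant)
    then show ?thesis using wm gp g\<Lambda> by (simp add: qb_edge_def w'_def pos_roots_J_eq)
  qed
  then show thesis using that w'm(2) b(5) cp by metis
qed

lemma qb_sigma_path_iff:
  assumes y: "y \<in> min_reps \<Lambda>"
  shows "(weight_edge \<sigma>)\<^sup>*\<^sup>* (y \<Lambda>) n \<longleftrightarrow> (\<exists>x\<in>min_reps \<Lambda>. x \<Lambda> = n \<and> qb_sigma_path \<Lambda> \<sigma> y x)"
proof
  assume "(weight_edge \<sigma>)\<^sup>*\<^sup>* (y \<Lambda>) n"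
  then show "\<exists>x\<in>min_reps \<Lambda>. x \<Lambda> = n \<and> qb_sigma_path \<Lambda> \<sigma> y x"
  proof (induction rule: rtranclp_induct)
    case base
    then show ?case using y by (auto simp: qb_sigma_path_def)
  next
    case (step n n')
    then obtain x where x: "x \<in> min_reps \<Lambda>" "x \<Lambda> = n" "qb_sigma_path \<Lambda> \<sigma> y x" by blast
    obtain g x' where x': "qb_edge \<Lambda> x g x'" "\<sigma> * cpair g \<Lambda> \<in> \<int>" "x' \<Lambda> = n'"
      using weight_edge_qb_edge[OF x(1), of \<sigma> n'] step.hyps(2) x(2) by metis
    then have "qb_sigma_path \<Lambda> \<sigma> y x'"
      using x(3) unfolding qb_sigma_path_def by (auto intro: rtranclp.rtrancl_into_rtrancl)
    then show ?case using x' qb_edge_min_reps by blast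
  qed
next
  assume "\<exists>x\<in>min_reps \<Lambda>. x \<Lambda> = n \<and> qb_sigma_path \<Lambda> \<sigma> y x"
  then obtain x where x: "x \<Lambda> = n" "qb_sigma_path \<Lambda> \<sigma> y x" by blast
  from x(2)[unfolded qb_sigma_path_def] have "(weight_edge \<sigma>)\<^sup>*\<^sup>* (y \<Lambda>) (x \<Lambda>)"
    by (induction rule: rtranclp_induct) (auto intro: rtranclp.rtrancl_into_rtrancl qb_edge_weight_edge)
  then show "(weight_edge \<sigma>)\<^sup>*\<^sup>* (y \<Lambda>) n" using x by simp
qed

end

subsection \<open>Piecewise linear paths\<close>

text \<open>Prescribing increments on closed pieces avoids the selection of a piece in
  \<open>pl_path\<close>; with extensionality it determines the path.\<close>

definition is_pl :: "nat \<Rightarrow> (nat \<Rightarrow> 'v::real_vector) \<Rightarrow> (nat \<Rightarrow> real) \<Rightarrow> (real \<Rightarrow> 'v) \<Rightarrow> bool" where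
  "is_pl s v \<sigma> \<eta> \<longleftrightarrow> \<eta> \<in> extensional {0..1} \<and> \<eta> 0 = 0 \<and>
     (\<forall>u<s. \<forall>t\<in>{\<sigma> u..\<sigma> (Suc u)}. \<eta> t = \<eta> (\<sigma> u) + (t - \<sigma> u) *\<^sub>R v (Suc u))"

lemma is_plD: "is_pl s v \<sigma> \<eta> \<Longrightarrow> u < s \<Longrightarrow> t \<in> {\<sigma> u..\<sigma> (Suc u)} \<Longrightarrow>
    \<eta> t = \<eta> (\<sigma> u) + (t - \<sigma> u) *\<^sub>R v (Suc u)"
  unfolding is_pl_def by blast

lemma is_pl_ext: "is_pl s v \<sigma> \<eta> \<Longrightarrow> \<eta> \<in> extensional {0..1}" and is_pl_0: "is_pl s v \<sigma> \<eta> \<Longrightarrow> \<eta> 0 = 0"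
  unfolding is_pl_def by blast+

lemma is_plI:
  assumes "\<eta> \<in> extensional {0..1}" "\<eta> 0 = 0"
    and "\<And>u t. u < s \<Longrightarrow> t \<in> {\<sigma> u..\<sigma> (Suc u)} \<Longrightarrow> \<eta> t = \<eta> (\<sigma> u) + (t - \<sigma> u) *\<^sub>R v (Suc u)"
  shows "is_pl s v \<sigma> \<eta>"
  using assms unfolding is_pl_def by blast

lemma partition_less: "rational_partition s \<sigma> \<Longrightarrow> i < j \<Longrightarrow> j \<le> s \<Longrightarrow> \<sigma> i < \<sigma> j"
proof (induction j)
  case (Suc j)
  then have "\<sigma> j < \<sigma> (Suc j)" by (simp add: rational_partition_def)
  then show ?case using Suc by (cases "i = j") auto
qed simp

lemma partition_le: "rational_partition s \<sigma> \<Longrightarrow> i \<le> j \<Longrightarrow> j \<le> s \<Longrightarrow> \<sigma> i \<le> \<sigma> j"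
  using partition_less[of s \<sigma> i j] by (cases "i = j") auto

lemma partition_bounds: "rational_partition s \<sigma> \<Longrightarrow> i \<le> s \<Longrightarrow> 0 \<le> \<sigma> i \<and> \<sigma> i \<le> 1"
  using partition_le[of s \<sigma> 0 i] partition_le[of s \<sigma> i s] by (auto simp: rational_partition_def)

lemma partition_less_iff:
  "rational_partition s \<sigma> \<Longrightarrow> i \<le> s \<Longrightarrow> j \<le> s \<Longrightarrow> \<sigma> i < \<sigma> j \<longleftrightarrow> i < j"
  by (metis partition_le partition_less not_le)

lemma partition_pos: "rational_partition s \<sigma> \<Longrightarrow> 0 < s"
  by (auto simp: rational_partition_def intro: Suc_lessI gr0I)

lemma partition_piece_left:
  assumes "rational_partition s \<sigma>" "0 < t" "t \<le> 1"
  obtains u where "u < s" "\<sigma> u < t" "t \<le> \<sigma> (Suc u)"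
proof -
  have "t \<le> \<sigma> s" "\<not> t \<le> \<sigma> 0" using assms by (auto simp: rational_partition_def)
  from ex_least_nat_less[of "\<lambda>n. t \<le> \<sigma> n", OF this] show thesis using that by (auto simp: not_le)
qed

lemma partition_piece_right:
  assumes "rational_partition s \<sigma>" "0 \<le> t" "t < 1"
  obtains u where "u < s" "\<sigma> u \<le> t" "t < \<sigma> (Suc u)"
proof -
  have "t < \<sigma> s" "\<not> t < \<sigma> 0" using assms by (auto simp: rational_partition_def)
  from ex_least_nat_less[of "\<lambda>n. t < \<sigma> n", OF this] show thesis using that by (auto simp: not_less)
qed

lemma partition_piece:
  assumes "rational_partition s \<sigma>" "t \<in> {0..1}"
  obtains u where "u < s" "t \<in> {\<sigma> u..\<sigma> (Suc u)}"
proof (cases "t = 0")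
  case True
  then show ?thesis using that[of 0] assms partition_pos[OF assms(1)] partition_bounds[of s \<sigma> 1]
    by (auto simp: rational_partition_def)
next
  case False
  then have "0 < t" "t \<le> 1" using assms(2) by auto
  from partition_piece_left[OF assms(1) this] obtain u where "u < s" "\<sigma> u < t" "t \<le> \<sigma> (Suc u)" .
  then show ?thesis using that[of u] by auto
qed

lemma is_pl_unique:
  assumes p: "rational_partition s \<sigma>" and "is_pl s v \<sigma> \<eta>" "is_pl s v \<sigma> \<eta>'" shows "\<eta> = \<eta>'"
proof (rule extensionalityI)
  have node: "u \<le> s \<Longrightarrow> \<eta> (\<sigma> u) = \<eta>' (\<sigma> u)" for u
  proof (induction u)
    case 0
    then show ?case using assms by (simp add: is_pl_def rational_partition_def)
  next
    case (Suc u)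
    then have "\<sigma> (Suc u) \<in> {\<sigma> u..\<sigma> (Suc u)}" using partition_le[OF p, of u "Suc u"] by auto
    then show ?case using Suc is_plD[OF assms(2), of u "\<sigma> (Suc u)"] is_plD[OF assms(3), of u "\<sigma> (Suc u)"] by simp
  qed
  fix t :: real assume "t \<in> {0..1}"
  then obtain u where u: "u < s" "t \<in> {\<sigma> u..\<sigma> (Suc u)}" using partition_piece[OF p] by blast
  then show "\<eta> t = \<eta>' t"
    using node[of u] is_plD[OF assms(2) u] is_plD[OF assms(3) u] by simp
qed (use assms in \<open>auto simp: is_pl_def\<close>)

lemma is_pl_pl_path:
  assumes p: "rational_partition s \<sigma>" shows "is_pl s v \<sigma> (pl_path s v \<sigma>)"
proof -
  define S where "S n = (\<Sum>j\<in>{1..<Suc n}. (\<sigma> j - \<sigma> (j - 1)) *\<^sub>R v j)" for n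
  have val: "pl_path s v \<sigma> t = S u + (t - \<sigma> u) *\<^sub>R v (Suc u)"
    if u: "u < s" "t \<in> {\<sigma> u..\<sigma> (Suc u)}" for u t
  proof -
    let ?Q = "\<lambda>u. 1 \<le> u \<and> u \<le> s \<and> \<sigma> (u - 1) \<le> t \<and> t \<le> \<sigma> u"
    define n where "n = (LEAST u. ?Q u)"
    have "?Q (Suc u)" using u by auto
    then have n: "?Q n" and le: "n \<le> Suc u"
      unfolding n_def by (rule LeastI, rule Least_le)
    obtain k where k: "n = Suc k" using n by (cases n) auto
    have t01: "t \<in> {0..1}" using u partition_bounds[OF p, of u] partition_bounds[OF p, of "Suc u"] by auto
    have "pl_path s v \<sigma> t = (\<Sum>j\<in>{1..<n}. (\<sigma> j - \<sigma> (j - 1)) *\<^sub>R v j) + (t - \<sigma> (n - 1)) *\<^sub>R v n"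
      unfolding pl_path_def restrict_apply'[OF t01] Let_def n_def ..
    then have "pl_path s v \<sigma> t = S k + (t - \<sigma> k) *\<^sub>R v (Suc k)"
      by (simp only: S_def k diff_Suc_1)
    \<comment> \<open>At a node shared by two pieces the least index selects the left one; the two
      formulas agree there.\<close>
    moreover have "S k + (t - \<sigma> k) *\<^sub>R v (Suc k) = S u + (t - \<sigma> u) *\<^sub>R v (Suc u)"
    proof (cases "k = u")
      case False
      then have "Suc k \<le> u" using le k by simp
      moreover have "\<sigma> u \<le> \<sigma> (Suc k)" using n k u by auto
      ultimately have "u = Suc k" using partition_less_iff[OF p, of "Suc k" u] u by force
      moreover have "t = \<sigma> u" using n k u calculation by auto
      ultimately show ?thesis by (simp add: S_def)
    qed simp
    ultimately show ?thesis by simp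
  qed
  have p0: "\<sigma> 0 = 0" using p by (simp add: rational_partition_def)
  have node: "pl_path s v \<sigma> (\<sigma> u) = S u" if "u < s" for u
    using val[OF that, of "\<sigma> u"] partition_le[OF p, of u "Suc u"] that by auto
  have "pl_path s v \<sigma> 0 = 0" using node[of 0] partition_pos[OF p] by (simp add: p0 S_def)
  moreover have "pl_path s v \<sigma> \<in> extensional {0..1}" by (simp add: pl_path_def)
  ultimately show ?thesis using val node by (intro is_plI) auto
qed

lemma pl_path_eq_iff: "rational_partition s \<sigma> \<Longrightarrow> \<eta> = pl_path s v \<sigma> \<longleftrightarrow> is_pl s v \<sigma> \<eta>"
  using is_pl_pl_path is_pl_unique by blast

lemma is_pl_cong:
  assumes "is_pl s v \<sigma> \<eta>" "\<And>u. u \<in> {1..s} \<Longrightarrow> v' u = v u" shows "is_pl s v' \<sigma> \<eta>"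
proof (rule is_plI)
  fix u t assume u: "u < s" "t \<in> {\<sigma> u..\<sigma> (Suc u)}"
  then show "\<eta> t = \<eta> (\<sigma> u) + (t - \<sigma> u) *\<^sub>R v' (Suc u)"
    using is_plD[OF assms(1) u] assms(2)[of "Suc u"] by simp
qed (use assms(1) in \<open>auto intro: is_pl_ext is_pl_0\<close>)

lemma is_pl_continuous:
  fixes \<eta> :: "real \<Rightarrow> 'v::real_normed_vector"
  assumes p: "rational_partition s \<sigma>" and e: "is_pl s v \<sigma> \<eta>" shows "continuous_on {0..1} \<eta>"
proof -
  have "u \<le> s \<Longrightarrow> continuous_on {0..\<sigma> u} \<eta>" for u
  proof (induction u)
    case 0
    then show ?case using p by (simp add: rational_partition_def)
  next
    case (Suc u)
    have "continuous_on {\<sigma> u..\<sigma> (Suc u)} (\<lambda>t. \<eta> (\<sigma> u) + (t - \<sigma> u) *\<^sub>R v (Suc u))"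
      by (intro continuous_intros)
    moreover have "\<eta> (\<sigma> u) + (t - \<sigma> u) *\<^sub>R v (Suc u) = \<eta> t" if "t \<in> {\<sigma> u..\<sigma> (Suc u)}" for t
      using is_plD[OF e _ that] Suc.prems by simp
    ultimately have "continuous_on {\<sigma> u..\<sigma> (Suc u)} \<eta>" by (rule continuous_on_eq)
    then have "continuous_on ({0..\<sigma> u} \<union> {\<sigma> u..\<sigma> (Suc u)}) \<eta>"
      using Suc by (intro continuous_on_closed_Un) auto
    moreover have "{0..\<sigma> u} \<union> {\<sigma> u..\<sigma> (Suc u)} = {0..\<sigma> (Suc u)}"
      using partition_bounds[OF p, of u] partition_le[OF p, of u "Suc u"] Suc.prems by auto
    ultimately show ?case by simp
  qed
  from this[of s] show ?thesis using p by (simp add: rational_partition_def)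
qed

lemma compact_level_set:
  fixes f :: "real \<Rightarrow> real"
  assumes "continuous_on {a..b} f" shows "compact ({a..b} \<inter> f -` {c})"
proof -
  have "closed ({a..b} \<inter> f -` {c})" by (rule continuous_closed_preimage[OF assms]) auto
  moreover have "bounded ({a..b} \<inter> f -` {c})" by (rule bounded_subset[OF bounded_closed_interval]) auto
  ultimately show ?thesis by (simp add: compact_eq_bounded_closed)
qed

text \<open>Level sets on a compact interval are compact, so the extremal times in the root
  operators are attained.\<close>

lemma ex_first_level:
  fixes f :: "real \<Rightarrow> real"
  assumes "continuous_on {a..b} f" "t \<in> {a..b}" "f t = c"
  obtains x where "x \<in> {a..b}" "f x = c" "\<And>y. y \<in> {a..b} \<Longrightarrow> f y = c \<Longrightarrow> x \<le> y"
  using compact_attains_inf[OF compact_level_set[OF assms(1), of c]] assms(2,3) by blast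

lemma ex_last_level:
  fixes f :: "real \<Rightarrow> real"
  assumes "continuous_on {a..b} f" "t \<in> {a..b}" "f t = c"
  obtains x where "x \<in> {a..b}" "f x = c" "\<And>y. y \<in> {a..b} \<Longrightarrow> f y = c \<Longrightarrow> y \<le> x"
  using compact_attains_sup[OF compact_level_set[OF assms(1), of c]] assms(2,3) by blast

lemma Ints_diff_iff: "x - y \<in> \<int> \<Longrightarrow> x \<in> \<int> \<longleftrightarrow> (y :: 'v::ring_1) \<in> \<int>"
  by (metis Ints_add Ints_diff diff_add_cancel diff_diff_eq2 add_diff_cancel_left')

context dominant_root_system
begin

subsection \<open>Chains in the orbit\<close>

definition orbit :: "'a set" where
  "orbit = (\<lambda>w. w \<Lambda>) ` weyl_group"

abbreviation ipair :: "'i option \<Rightarrow> 'a \<Rightarrow> real" where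
  "ipair i \<equiv> cpair (cl_simple i)"

abbreviation irefl :: "'i option \<Rightarrow> 'a \<Rightarrow> 'a" where
  "irefl i \<equiv> refl_root (cl_simple i)"

abbreviation chain :: "real \<Rightarrow> 'a \<Rightarrow> 'a \<Rightarrow> bool" where
  "chain \<sigma> \<equiv> (weight_edge \<sigma>)\<^sup>*\<^sup>*"

lemma orbit_refl: "m \<in> orbit \<Longrightarrow> b \<in> \<Phi> \<Longrightarrow> refl_root b m \<in> orbit"
  unfolding orbit_def using weyl_comp[OF refl_root_weyl]
  by (auto intro!: image_eqI[of _ _ "refl_root b \<circ> _"])

lemma orbit_integral: assumes "m \<in> orbit" "b \<in> \<Phi>" shows "cpair b m \<in> \<int>"
proof -
  obtain w where w: "w \<in> weyl_group" "m = w \<Lambda>" using assms by (auto simp: orbit_def)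
  obtain v where v: "v \<in> weyl_group" "\<forall>x. v (w x) = x" "\<forall>x. w (v x) = x" using weyl_inverse[OF w(1)] .
  have "cpair b m = cpair (v b) (v m)" using weyl_cpair[OF v(1)] by simp
  also have "v m = \<Lambda>" by (simp add: v(2) w(2))
  finally show ?thesis using weight_integral weyl_root[OF v(1) assms(2)] by simp
qed

text \<open>An edge changes the scaled pairing by the integer of the \<sigma>-condition times a
  Cartan integer, so it is constant modulo integers along a \<sigma>-chain.\<close>

lemma chain_integral:
  assumes "chain \<sigma> x y" "a \<in> \<Phi>" shows "\<sigma> * cpair a x - \<sigma> * cpair a y \<in> \<int>"
  using assms(1)
proof (induction rule: rtranclp_induct)
  case (step y z)
  obtain b where b: "b \<in> aff_pos_real_roots" "z = refl_root (fst b) y" "\<sigma> * cpair (fst b) y \<in> \<int>"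
    using step.hyps(2) unfolding weight_edge_def by auto
  have "cpair a (fst b) \<in> \<int>" using crystallographic assms(2) aff_root_fst[OF b(1)] by blast
  then have "(\<sigma> * cpair (fst b) y) * cpair a (fst b) \<in> \<int>" using b(3) by auto
  from Ints_add[OF step.IH this] show ?case
    by (simp add: b(2) refl_root_def cpair_diff cpair_scaleR algebra_simps)
qed simp

lemma weight_edge_integral:
  assumes "weight_edge \<sigma> x y" "a \<in> \<Phi>" shows "\<sigma> * cpair a x \<in> \<int> \<longleftrightarrow> \<sigma> * cpair a y \<in> \<int>"
  using Ints_diff_iff[OF chain_integral[OF r_into_rtranclp[of "weight_edge \<sigma>", OF assms(1)] assms(2)]] .

text \<open>By \<open>step_len_refl\<close> and \<open>step_len_ge_1\<close>, the sign of the pairing with a simple root can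
  only decrease along an edge labelled by this simple root.\<close>

lemma weight_edge_cases [consumes 1, case_names simple other]:
  assumes "weight_edge \<sigma> x y"
  obtains "y = irefl i x" "0 < ipair i x" "\<sigma> * ipair i x \<in> \<int>"
  | "sgn (ipair i x) \<le> sgn (ipair i y)"
    "sgn (ipair i x) = sgn (ipair i y) \<Longrightarrow> weight_edge \<sigma> (irefl i x) (irefl i y)"
proof -
  obtain b where b: "b \<in> aff_pos_real_roots" "0 < cpair (fst b) x" "y = refl_root (fst b) x"
    "step_len x b = 1" "\<sigma> * cpair (fst b) x \<in> \<int>"
    using assms unfolding weight_edge_def by blast
  show thesis
  proof (cases "b = aff_simple i")
    case True
    then show thesis using b that(1) by (simp add: cl_simple_fst)
  next
    case False
    let ?c = "simple_refl i b"
    have c: "?c \<in> aff_pos_real_roots" using aff_refl_simple_pos b(1) False by blast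
    have cp: "cpair (fst ?c) (irefl i x) = cpair (fst b) x" by (rule aff_refl_pairing)
    have D: "step_len (irefl i x) ?c = 1 + sgn (ipair i y) - sgn (ipair i x)"
      using step_len_refl[OF aff_root_fst[OF b(1)], of i x] b(3,4) by simp
    have "1 \<le> step_len (irefl i x) ?c" using step_len_ge_1[OF c, of "irefl i x"] b(2) cp by simp
    moreover have "weight_edge \<sigma> (irefl i x) (irefl i y)" if "sgn (ipair i x) = sgn (ipair i y)"
      unfolding weight_edge_def
    proof (intro bexI[OF _ c] conjI)
      show "irefl i y = refl_root (fst ?c) (irefl i x)"
        by (simp add: b(3) aff_refl_fst cl_simple_fst[symmetric] refl_root_isometry refl_root_linear inner_refl_refl)
    qed (use D that cp b in simp_all)
    ultimately show thesis using that(2) D by simp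
  qed
qed

lemma weight_edge_simple: "0 < ipair i x \<Longrightarrow> \<sigma> * ipair i x \<in> \<int> \<Longrightarrow> weight_edge \<sigma> x (irefl i x)"
  unfolding weight_edge_def using aff_simple_root[of i] step_len_simple[of i x]
  by (intro bexI[of _ "aff_simple i"]) (auto simp: cl_simple_fst)

text \<open>The first edge after which the pairing is no longer positive must be r_i itself.
  Reflecting the edges before it and omitting it gives the new chain.\<close>

lemma chain_refl_left:
  assumes "chain \<sigma> x y" "0 < ipair i x" "ipair i y \<le> 0" shows "chain \<sigma> (irefl i x) y"
  using assms
proof (induction rule: converse_rtranclp_induct)
  case (step x z)
  show ?case
  proof (rule weight_edge_cases[OF step.hyps(1), of i])
    assume "z = irefl i x"
    then show ?thesis using step.hyps(2) by simp
  next
    assume le: "sgn (ipair i x) \<le> sgn (ipair i z)"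
      and e: "sgn (ipair i x) = sgn (ipair i z) \<Longrightarrow> weight_edge \<sigma> (irefl i x) (irefl i z)"
    have z: "0 < ipair i z" using le step.prems by (auto simp: sgn_if split: if_splits)
    then show ?thesis using e step.IH step.prems by (simp add: converse_rtranclp_into_rtranclp)
  qed
qed simp

lemma chain_refl_right:
  assumes "chain \<sigma> x y" "0 \<le> ipair i x" "ipair i y < 0" shows "chain \<sigma> x (irefl i y)"
  using assms
proof (induction rule: rtranclp_induct)
  case (step z y)
  show ?case
  proof (rule weight_edge_cases[OF step.hyps(2), of i])
    assume "y = irefl i z"
    then show ?thesis using step.hyps(1) by simp
  next
    assume le: "sgn (ipair i z) \<le> sgn (ipair i y)"
      and e: "sgn (ipair i z) = sgn (ipair i y) \<Longrightarrow> weight_edge \<sigma> (irefl i z) (irefl i y)"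
    have z: "ipair i z < 0" using le step.prems by (auto simp: sgn_if split: if_splits)
    then show ?thesis using e step.IH step.prems by (simp add: rtranclp.rtrancl_into_rtrancl)
  qed
qed simp

text \<open>The sign drops only through an edge r_i, whose \<sigma>-condition is the integrality
  claimed; modulo integers nothing changes along the chain.\<close>

lemma chain_drop_integral:
  assumes "chain \<sigma> x y" "sgn (ipair i y) < sgn (ipair i x)" shows "\<sigma> * ipair i x \<in> \<int>"
  using assms
proof (induction rule: converse_rtranclp_induct)
  case (step x z)
  show ?case
  proof (rule weight_edge_cases[OF step.hyps(1), of i])
    assume "sgn (ipair i x) \<le> sgn (ipair i z)"
    then have "\<sigma> * ipair i z \<in> \<int>" using step by simp
    then show ?thesis using weight_edge_integral[OF step.hyps(1) cl_simple_root] by blast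
  qed
qed simp

text \<open>Without integrality no edge is r_i, so the sign can only rise; equal signs at the ends
  make it constant, and every edge can be reflected.\<close>

lemma chain_refl_both:
  assumes "chain \<sigma> x y" "\<sigma> * ipair i x \<notin> \<int>" "sgn (ipair i x) = sgn (ipair i y)"
  shows "chain \<sigma> (irefl i x) (irefl i y)"
  using assms
proof (induction rule: converse_rtranclp_induct)
  case (step x z)
  have nz: "\<sigma> * ipair i z \<notin> \<int>"
    using weight_edge_integral[OF step.hyps(1) cl_simple_root] step.prems by blast
  show ?case
  proof (rule weight_edge_cases[OF step.hyps(1), of i])
    assume "\<sigma> * ipair i x \<in> \<int>"
    then show ?thesis using step.prems by simp
  next
    assume le: "sgn (ipair i x) \<le> sgn (ipair i z)"
      and e: "sgn (ipair i x) = sgn (ipair i z) \<Longrightarrow> weight_edge \<sigma> (irefl i x) (irefl i z)"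
    have "\<not> sgn (ipair i y) < sgn (ipair i z)" using chain_drop_integral[OF step.hyps(2)] nz by blast
    then have "sgn (ipair i x) = sgn (ipair i z)" using le step.prems by simp
    then show ?thesis using e step.IH nz step.prems by (simp add: converse_rtranclp_into_rtranclp)
  qed
qed simp

subsection \<open>Paths with directions in the orbit\<close>

definition path_data :: "nat \<Rightarrow> (nat \<Rightarrow> 'a) \<Rightarrow> (nat \<Rightarrow> real) \<Rightarrow> (real \<Rightarrow> 'a) \<Rightarrow> bool" where
  "path_data s v \<sigma> \<eta> \<longleftrightarrow> rational_partition s \<sigma> \<and> is_pl s v \<sigma> \<eta> \<and> (\<forall>u\<in>{1..s}. v u \<in> orbit) \<and>
     (\<forall>u\<in>{1..<s}. chain (\<sigma> u) (v (Suc u)) (v u))"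

lemma path_dataD:
  assumes "path_data s v \<sigma> \<eta>"
  shows "rational_partition s \<sigma>" "is_pl s v \<sigma> \<eta>"
    "u \<in> {1..<s} \<Longrightarrow> chain (\<sigma> u) (v (Suc u)) (v u)"
  using assms by (auto simp: path_data_def)

definition chain_paths :: "(real \<Rightarrow> 'a) set" where
  "chain_paths = {\<eta>. \<exists>s v \<sigma>. path_data s v \<sigma> \<eta>}"

text \<open>The point r splits a piece into two with the same direction, joined by an empty chain.
  Old nodes are kept, so the other end of a segment to be reflected remains a node.\<close>

lemma path_data_insert:
  assumes d: "path_data s v \<sigma> \<eta>" and r: "r \<in> {0..1}" "r \<in> \<rat>"
  obtains s' v' \<sigma>' where "path_data s' v' \<sigma>' \<eta>" "\<exists>a\<le>s'. \<sigma>' a = r" "\<forall>b\<le>s. \<exists>b'\<le>s'. \<sigma>' b' = \<sigma> b"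
proof (cases "\<exists>a\<le>s. \<sigma> a = r")
  case True
  then show ?thesis using that d by blast
next
  case False
  note p = path_dataD(1)[OF d]
  obtain u where u: "u < s" "\<sigma> u \<le> r" "r \<le> \<sigma> (Suc u)" using partition_piece[OF p r(1)] by auto
  have lt: "\<sigma> u < r" "r < \<sigma> (Suc u)" using False u by (metis less_imp_le_nat less_le Suc_leI)+
  define \<sigma>' where "\<sigma>' j = (if j \<le> u then \<sigma> j else if j = Suc u then r else \<sigma> (j - 1))" for j
  define v' where "v' j = (if j \<le> Suc u then v j else v (j - 1))" for j
  have step: "\<sigma> j < \<sigma> (Suc j)" if "j < s" for j using p that by (simp add: rational_partition_def)
  have rat: "\<sigma> j \<in> \<rat>" if "j \<le> s" for j using p that by (simp add: rational_partition_def)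
  have "\<sigma>' j < \<sigma>' (Suc j)" if "j < Suc s" for j
  proof -
    consider "j < u" | "j = u" | "j = Suc u" | k where "j = Suc k" "u < k" by (cases j) (auto, force)
    then show ?thesis by cases (use that step lt u in \<open>auto simp: \<sigma>'_def\<close>)
  qed
  then have p': "rational_partition (Suc s) \<sigma>'"
    using p u r(2) rat by (auto simp: rational_partition_def \<sigma>'_def)
  note isp = path_dataD(2)[OF d]
  note pl = is_plD[OF isp]
  have "\<eta> t = \<eta> (\<sigma>' j) + (t - \<sigma>' j) *\<^sub>R v' (Suc j)"
    if "j < Suc s" "t \<in> {\<sigma>' j..\<sigma>' (Suc j)}" for j t
  proof -
    consider "j < u" | "j = u" | "j = Suc u" | k where "j = Suc k" "u < k" by (cases j) (auto, force)
    then show ?thesis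
    proof cases
      case 1
      then show ?thesis using that pl[of j t] u by (simp add: \<sigma>'_def v'_def)
    next
      case 2
      then show ?thesis using that pl[of j t] u by (simp add: \<sigma>'_def v'_def)
    next
      case 3
      then have "\<eta> t = \<eta> (\<sigma> u) + (t - \<sigma> u) *\<^sub>R v (Suc u)" "\<eta> r = \<eta> (\<sigma> u) + (r - \<sigma> u) *\<^sub>R v (Suc u)"
        using pl[of u t] pl[of u r] that u by (auto simp: \<sigma>'_def)
      then have "\<eta> t = \<eta> r + (t - r) *\<^sub>R v (Suc u)" by (simp add: scaleR_left_diff_distrib)
      then show ?thesis using 3 by (simp add: \<sigma>'_def v'_def)
    next
      case 4
      then show ?thesis using that pl[of k t] u by (simp add: \<sigma>'_def v'_def)
    qed
  qed
  then have "is_pl (Suc s) v' \<sigma>' \<eta>" by (intro is_plI is_pl_ext[OF isp] is_pl_0[OF isp])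
  moreover have "v' j \<in> orbit" if "j \<in> {1..Suc s}" for j
  proof -
    have "v k \<in> orbit" if "k \<in> {1..s}" for k using d that by (simp add: path_data_def)
    moreover have "if j \<le> Suc u then j \<in> {1..s} else j - 1 \<in> {1..s}" using that u by auto
    ultimately show ?thesis by (auto simp: v'_def split: if_splits)
  qed
  moreover have "chain (\<sigma>' j) (v' (Suc j)) (v' j)" if "j \<in> {1..<Suc s}" for j
  proof -
    note ch = path_dataD(3)[OF d]
    consider "j \<le> u" | "j = Suc u" | k where "j = Suc k" "u < k" by (cases j) (auto, force)
    then show ?thesis
    proof cases
      case 1
      then show ?thesis using that ch[of j] u by (simp add: \<sigma>'_def v'_def)
    next
      case 2
      then show ?thesis by (simp add: v'_def)
    next
      case 3
      then show ?thesis using that ch[of k] u by (simp add: \<sigma>'_def v'_def)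
    qed
  qed
  ultimately have "path_data (Suc s) v' \<sigma>' \<eta>" using p' by (simp add: path_data_def)
  moreover have "\<exists>b'\<le>Suc s. \<sigma>' b' = \<sigma> b" if "b \<le> s" for b
  proof (cases "b \<le> u")
    case True
    then show ?thesis using that by (intro exI[of _ b]) (simp add: \<sigma>'_def)
  next
    case False
    then show ?thesis using that by (intro exI[of _ "Suc b"]) (simp add: \<sigma>'_def)
  qed
  moreover have "\<exists>a\<le>Suc s. \<sigma>' a = r" using u by (intro exI[of _ "Suc u"]) (simp add: \<sigma>'_def)
  ultimately show ?thesis using that by blast
qed

lemma path_data_merge:
  assumes d: "path_data s v \<sigma> \<eta>" and u: "u \<in> {1..<s}" "v u = v (Suc u)"
  shows "\<exists>v' \<sigma>'. path_data (s - 1) v' \<sigma>' \<eta>"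
proof -
  note p = path_dataD(1)[OF d]
  define \<sigma>' where "\<sigma>' j = (if j < u then \<sigma> j else \<sigma> (Suc j))" for j
  define v' where "v' j = (if j \<le> u then v j else v (Suc j))" for j
  have "\<sigma>' j < \<sigma>' (Suc j)" if "j < s - 1" for j
    using partition_less[OF p] that u by (auto simp: \<sigma>'_def)
  then have p': "rational_partition (s - 1) \<sigma>'"
    using p u by (auto simp: rational_partition_def \<sigma>'_def)
  note isp = path_dataD(2)[OF d]
  note pl = is_plD[OF isp]
  have "\<eta> t = \<eta> (\<sigma>' j) + (t - \<sigma>' j) *\<^sub>R v' (Suc j)"
    if j: "j < s - 1" "t \<in> {\<sigma>' j..\<sigma>' (Suc j)}" for j t
  proof -
    consider "Suc j < u" | "u = Suc j" | "u \<le> j" by linarith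
    then show ?thesis
    proof cases
      case 1
      then show ?thesis using j pl[of j t] by (simp add: \<sigma>'_def v'_def)
    next
      case 3
      then show ?thesis using j pl[of "Suc j" t] by (simp add: \<sigma>'_def v'_def)
    next
      case 2
      have le: "\<sigma> j \<le> \<sigma> u" using partition_le[OF p, of j u] 2 u by simp
      have \<sigma>u: "\<eta> (\<sigma> u) = \<eta> (\<sigma> j) + (\<sigma> u - \<sigma> j) *\<^sub>R v u"
        using pl[of j "\<sigma> u"] le 2 u by simp
      show ?thesis
      proof (cases "t \<le> \<sigma> u")
        case True
        then show ?thesis using j pl[of j t] 2 u by (simp add: \<sigma>'_def v'_def)
      next
        case False
        then have "\<eta> t = \<eta> (\<sigma> u) + (t - \<sigma> u) *\<^sub>R v u" using j pl[of u t] 2 u by (simp add: \<sigma>'_def)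
        also have "\<dots> = \<eta> (\<sigma> j) + ((\<sigma> u - \<sigma> j) *\<^sub>R v u + (t - \<sigma> u) *\<^sub>R v u)"
          by (simp only: \<sigma>u add.assoc)
        also have "\<dots> = \<eta> (\<sigma> j) + (t - \<sigma> j) *\<^sub>R v u"
          by (simp flip: scaleR_left_distrib)
        finally show ?thesis using 2 by (simp add: \<sigma>'_def v'_def)
      qed
    qed
  qed
  then have "is_pl (s - 1) v' \<sigma>' \<eta>" by (intro is_plI is_pl_ext[OF isp] is_pl_0[OF isp])
  moreover have "v' j \<in> orbit" if "j \<in> {1..s - 1}" for j
    using d that by (auto simp: path_data_def v'_def)
  moreover have "chain (\<sigma>' j) (v' (Suc j)) (v' j)" if j: "j \<in> {1..<s - 1}" for j
  proof -
    note ch = path_dataD(3)[OF d]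
    consider "j < u" | "j = u" | "u < j" by linarith
    then show ?thesis
    proof cases
      case 1
      then show ?thesis using ch[of j] j u by (simp add: \<sigma>'_def v'_def)
    next
      case 2
      moreover have "Suc u \<in> {1..<s}" using 2 j by auto
      ultimately show ?thesis using ch[of "Suc u"] u(2) by (simp add: \<sigma>'_def v'_def)
    next
      case 3
      then show ?thesis using ch[of "Suc j"] j by (simp add: \<sigma>'_def v'_def)
    qed
  qed
  ultimately show ?thesis using p' unfolding path_data_def by blast
qed

lemma path_data_distinct:
  assumes "\<eta> \<in> chain_paths"
  obtains s v \<sigma> where "path_data s v \<sigma> \<eta>" "\<And>u. u \<in> {1..<s} \<Longrightarrow> v u \<noteq> v (Suc u)"
proof -
  let ?Q = "\<lambda>s. \<exists>v \<sigma>. path_data s v \<sigma> \<eta>"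
  have "\<exists>s. ?Q s" using assms by (auto simp: chain_paths_def)
  from LeastI_ex[OF this] obtain v \<sigma> where d: "path_data (LEAST s. ?Q s) v \<sigma> \<eta>" by blast
  have "v u \<noteq> v (Suc u)" if "u \<in> {1..<(LEAST s. ?Q s)}" for u
  proof
    assume "v u = v (Suc u)"
    from path_data_merge[OF d that this] have "(LEAST s. ?Q s) \<le> (LEAST s. ?Q s) - 1" by (rule Least_le)
    then show False using that by auto
  qed
  then show thesis using that d by blast
qed

subsection \<open>Quantum LS paths and LS paths\<close>

lemma QLS_eq: "QLS \<Lambda> = chain_paths"
proof (intro equalityI subsetI)
  fix \<eta> assume "\<eta> \<in> QLS \<Lambda>"
  then obtain s x \<sigma> where q: "is_qls \<Lambda> s x \<sigma>" "\<eta> = pl_path s (\<lambda>u. x u \<Lambda>) \<sigma>"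
    by (auto simp: QLS_def)
  have m: "x u \<in> min_reps \<Lambda>" if "u \<in> {1..s}" for u using q(1) that by (auto simp: is_qls_def)
  have "chain (\<sigma> u) (x (Suc u) \<Lambda>) (x u \<Lambda>)" if "u \<in> {1..<s}" for u
    using qb_sigma_path_iff[OF m, of "Suc u" "\<sigma> u" "x u \<Lambda>"] m[of u] q(1) that by (auto simp: is_qls_def)
  moreover have "x u \<Lambda> \<in> orbit" if "u \<in> {1..s}" for u using m[OF that] by (auto simp: orbit_def min_reps_def)
  ultimately have "path_data s (\<lambda>u. x u \<Lambda>) \<sigma> \<eta>"
    using q is_pl_pl_path[of s \<sigma>] by (auto simp: path_data_def is_qls_def)
  then show "\<eta> \<in> chain_paths" by (auto simp: chain_paths_def)
next
  fix \<eta> assume h: "\<eta> \<in> chain_paths"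
  obtain s v \<sigma> where d: "path_data s v \<sigma> \<eta>" and ne: "\<And>u. u \<in> {1..<s} \<Longrightarrow> v u \<noteq> v (Suc u)"
    using path_data_distinct[OF h] by blast
  have "\<forall>u\<in>{1..s}. \<exists>x\<in>min_reps \<Lambda>. x \<Lambda> = v u"
  proof
    fix u assume "u \<in> {1..s}"
    then have "v u \<in> orbit" using d by (simp add: path_data_def)
    then obtain w where "w \<in> weyl_group" "v u = w \<Lambda>" by (auto simp: orbit_def)
    then show "\<exists>x\<in>min_reps \<Lambda>. x \<Lambda> = v u" using min_rep_props[of w] by auto
  qed
  then obtain x where x: "\<And>u. u \<in> {1..s} \<Longrightarrow> x u \<in> min_reps \<Lambda> \<and> x u \<Lambda> = v u" by metis
  have "qb_sigma_path \<Lambda> (\<sigma> u) (x (Suc u)) (x u)" if u: "u \<in> {1..<s}" for u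
  proof -
    have "chain (\<sigma> u) (x (Suc u) \<Lambda>) (v u)" using d u x[of "Suc u"] by (auto simp: path_data_def)
    then obtain y where "y \<in> min_reps \<Lambda>" "y \<Lambda> = v u" "qb_sigma_path \<Lambda> (\<sigma> u) (x (Suc u)) y"
      using qb_sigma_path_iff[of "x (Suc u)" "\<sigma> u" "v u"] x[of "Suc u"] u by auto
    \<comment> \<open>A minimal representative is determined by its weight, so the chain ends at the
      representative already chosen.\<close>
    moreover have "y = x u" using min_reps_inj[of y "x u"] calculation x[of u] u by auto
    ultimately show ?thesis by simp
  qed
  moreover have "x u \<noteq> x (Suc u)" if "u \<in> {1..<s}" for u using ne[OF that] x[of u] x[of "Suc u"] that by auto
  ultimately have "is_qls \<Lambda> s x \<sigma>" using d x by (auto simp: is_qls_def path_data_def)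
  moreover have "\<eta> = pl_path s (\<lambda>u. x u \<Lambda>) \<sigma>"
    using d x by (subst pl_path_eq_iff) (auto simp: path_data_def intro: is_pl_cong)
  ultimately show "\<eta> \<in> QLS \<Lambda>" unfolding QLS_def by blast
qed

lemma weight_edge_lift:
  assumes "weight_edge \<sigma> x y" "(x, k) \<in> aff_orbit \<Lambda>"
  shows "\<exists>k' b. aff_cover \<Lambda> (x, k) b (y, k') \<and> \<sigma> * cpair (fst b) y \<in> \<int>"
proof -
  obtain b where b: "b \<in> aff_pos_real_roots" "0 < cpair (fst b) x" "y = refl_root (fst b) x"
    "step_len x b = 1" "\<sigma> * cpair (fst b) x \<in> \<int>"
    using assms unfolding weight_edge_def by blast
  have e: "aff_refl b (x, k) = (y, snd (aff_refl b (x, k)))" using b(3) aff_refl_fst[of b "(x, k)"]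
    by (metis fst_conv prod.collapse)
  have "aff_cover \<Lambda> (x, k) b (y, snd (aff_refl b (x, k)))"
    unfolding aff_cover_iff using b assms(2) e by auto
  moreover have "\<sigma> * cpair (fst b) y \<in> \<int>" using b(3,5) by (simp add: cpair_refl_same)
  ultimately show ?thesis by blast
qed

lemma aff_cover_step: "aff_cover \<Lambda> m b n \<Longrightarrow> aff_step \<Lambda> m n"
  by (auto simp: aff_cover_iff aff_step_def)

text \<open>The \<delta>-component of the end is whatever the labels produce. The comparison is weak
  because the chain may be empty.\<close>

lemma chain_lift:
  assumes "chain \<sigma> x y" "(x, k) \<in> aff_orbit \<Lambda>"
  shows "\<exists>k'. sigma_chain \<Lambda> \<sigma> (y, k') (x, k) \<and> aff_le \<Lambda> (x, k) (y, k')"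
  using assms(1)
proof (induction rule: rtranclp_induct)
  case base
  then show ?case unfolding sigma_chain_def by blast
next
  case (step y z)
  then obtain k' where k': "sigma_chain \<Lambda> \<sigma> (y, k') (x, k)" "aff_le \<Lambda> (x, k) (y, k')" by blast
  have "(y, k') \<in> aff_orbit \<Lambda>" using aff_le_orbit[OF k'(2)] assms(2) by simp
  from weight_edge_lift[OF step.hyps(2) this] obtain l b
    where l: "aff_cover \<Lambda> (y, k') b (z, l)" "\<sigma> * cpair (fst b) z \<in> \<int>" by blast
  have "sigma_chain \<Lambda> \<sigma> (z, l) (x, k)"
    unfolding sigma_chain_def
    by (rule converse_rtranclp_into_rtranclp[OF _ k'(1)[unfolded sigma_chain_def]]) (intro exI[of _ b], simp add: l)
  moreover have "aff_le \<Lambda> (x, k) (z, l)"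
    using k'(2) aff_cover_step[OF l(1)] by (rule rtranclp.rtrancl_into_rtrancl)
  ultimately show ?case by blast
qed

lemma sigma_chain_chain:
  assumes "sigma_chain \<Lambda> \<sigma> m n" shows "chain \<sigma> (fst n) (fst m)"
  using assms unfolding sigma_chain_def
proof (induction rule: rtranclp_induct)
  case (step n p)
  then obtain b where b: "aff_cover \<Lambda> p b n" "\<sigma> * cpair (fst b) (fst n) \<in> \<int>" by blast
  have "weight_edge \<sigma> (fst p) (fst n)"
    using b unfolding aff_cover_iff weight_edge_def
    by (intro bexI[of _ b]) (auto simp: aff_refl_fst cpair_refl_same)
  then show ?case using step.IH by (rule converse_rtranclp_into_rtranclp)
qed simp

lemma aff_orbit_fst: "m \<in> aff_orbit \<Lambda> \<Longrightarrow> fst m \<in> orbit"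
proof (induction rule: aff_orbit_induct)
  case base
  show ?case unfolding orbit_def by (rule image_eqI[of _ _ id]) (simp_all add: weyl_id)
next
  case (step i m)
  then show ?case using orbit_refl[OF _ cl_simple_root] by (simp add: aff_refl_fst cl_simple_fst[symmetric])
qed

lemma orbit_aff_orbit: "x \<in> orbit \<Longrightarrow> (x, 0) \<in> aff_orbit \<Lambda>"
  by (auto simp: orbit_def weyl_aff_orbit)

text \<open>Chains run from direction u + 1 to direction u, so the \<delta>-components are chosen
  backwards, starting with 0 at the last direction.\<close>

lemma path_data_lift:
  assumes d: "path_data s v \<sigma> \<eta>"
  shows "\<exists>k. (\<forall>u\<in>{1..s}. (v u, k u) \<in> aff_orbit \<Lambda>) \<and>
    (\<forall>u\<in>{1..<s}. sigma_chain \<Lambda> (\<sigma> u) (v u, k u) (v (Suc u), k (Suc u)) \<and>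
      aff_le \<Lambda> (v (Suc u), k (Suc u)) (v u, k u))"
proof -
  have "n < s \<Longrightarrow> \<exists>k. (\<forall>u\<in>{s - n..s}. (v u, k u) \<in> aff_orbit \<Lambda>) \<and>
    (\<forall>u\<in>{s - n..<s}. sigma_chain \<Lambda> (\<sigma> u) (v u, k u) (v (Suc u), k (Suc u)) \<and>
      aff_le \<Lambda> (v (Suc u), k (Suc u)) (v u, k u))" for n
  proof (induction n)
    case 0
    then have "v s \<in> orbit" using d by (simp add: path_data_def)
    then show ?case by (intro exI[of _ "\<lambda>_. 0"]) (simp add: orbit_aff_orbit)
  next
    case (Suc n)
    then obtain k where k: "\<forall>u\<in>{s - n..s}. (v u, k u) \<in> aff_orbit \<Lambda>"
      "\<forall>u\<in>{s - n..<s}. sigma_chain \<Lambda> (\<sigma> u) (v u, k u) (v (Suc u), k (Suc u)) \<and>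
      aff_le \<Lambda> (v (Suc u), k (Suc u)) (v u, k u)" by auto
    define w where "w = s - Suc n"
    have w: "Suc w = s - n" "w \<in> {1..<s}" using Suc.prems by (auto simp: w_def)
    have "chain (\<sigma> w) (v (Suc w)) (v w)" using d w(2) by (auto simp: path_data_def)
    moreover have o: "(v (Suc w), k (Suc w)) \<in> aff_orbit \<Lambda>" using k(1) w by auto
    ultimately obtain l where l: "sigma_chain \<Lambda> (\<sigma> w) (v w, l) (v (Suc w), k (Suc w))"
      "aff_le \<Lambda> (v (Suc w), k (Suc w)) (v w, l)" using chain_lift by blast
    have lo: "(v w, l) \<in> aff_orbit \<Lambda>" using aff_le_orbit[OF l(2)] o by simp
    have i1: "u = w \<or> u \<noteq> w \<and> u \<in> {s - n..s}" if "u \<in> {s - Suc n..s}" for u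
      using that w unfolding w_def[symmetric] by auto
    have i2: "u = w \<or> u \<noteq> w \<and> Suc u \<noteq> w \<and> u \<in> {s - n..<s}" if "u \<in> {s - Suc n..<s}" for u
      using that w unfolding w_def[symmetric] by auto
    show ?case
    proof (intro exI[of _ "k(w := l)"] conjI ballI)
      fix u assume "u \<in> {s - Suc n..s}"
      from i1[OF this] show "(v u, (k(w := l)) u) \<in> aff_orbit \<Lambda>" using lo k(1) by auto
    next
      fix u assume "u \<in> {s - Suc n..<s}"
      from i2[OF this] show "sigma_chain \<Lambda> (\<sigma> u) (v u, (k(w := l)) u) (v (Suc u), (k(w := l)) (Suc u))"
        "aff_le \<Lambda> (v (Suc u), (k(w := l)) (Suc u)) (v u, (k(w := l)) u)"
        using l k(2) by auto
    qed
  qed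
  from this[of "s - 1"] show ?thesis using partition_pos[of s \<sigma>] d by (simp add: path_data_def)
qed

lemma cl_pl_path:
  assumes "rational_partition s \<sigma>"
  shows "is_pl s (\<lambda>u. fst (\<nu> u)) \<sigma> (cl_path (pl_path s \<nu> \<sigma>))"
proof -
  have pl: "is_pl s \<nu> \<sigma> (pl_path s \<nu> \<sigma>)" by (rule is_pl_pl_path[OF assms])
  have "t \<in> {0..1}" if "u < s" "t \<in> {\<sigma> u..\<sigma> (Suc u)}" for u t
    using partition_bounds[OF assms, of u] partition_bounds[OF assms, of "Suc u"] that by auto
  moreover have "\<sigma> u \<in> {0..1}" if "u < s" for u using partition_bounds[OF assms, of u] that by auto
  ultimately have "cl_path (pl_path s \<nu> \<sigma>) t = cl_path (pl_path s \<nu> \<sigma>) (\<sigma> u) + (t - \<sigma> u) *\<^sub>R fst (\<nu> (Suc u))"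
    if "u < s" "t \<in> {\<sigma> u..\<sigma> (Suc u)}" for u t
    using is_plD[OF pl that] that by (simp add: cl_path_def)
  moreover have "cl_path (pl_path s \<nu> \<sigma>) 0 = 0" using is_pl_0[OF pl] by (simp add: cl_path_def)
  moreover have "cl_path (pl_path s \<nu> \<sigma>) \<in> extensional {0..1}" by (simp add: cl_path_def)
  ultimately show ?thesis by (intro is_plI)
qed

lemma LS_cl_eq: "LS_cl \<Lambda> = chain_paths"
proof (intro equalityI subsetI)
  fix \<eta> assume "\<eta> \<in> LS_cl \<Lambda>"
  then obtain s \<nu> \<sigma> where q: "is_ls \<Lambda> s \<nu> \<sigma>" "\<eta> = cl_path (pl_path s \<nu> \<sigma>)"
    by (auto simp: LS_cl_def LS_def)
  then have "path_data s (\<lambda>u. fst (\<nu> u)) \<sigma> \<eta>"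
    using cl_pl_path[of s \<sigma> \<nu>] by (auto simp: path_data_def is_ls_def intro: sigma_chain_chain aff_orbit_fst)
  then show "\<eta> \<in> chain_paths" by (auto simp: chain_paths_def)
next
  fix \<eta> assume h: "\<eta> \<in> chain_paths"
  obtain s v \<sigma> where d: "path_data s v \<sigma> \<eta>" and ne: "\<And>u. u \<in> {1..<s} \<Longrightarrow> v u \<noteq> v (Suc u)"
    using path_data_distinct[OF h] by blast
  obtain k where k: "\<forall>u\<in>{1..s}. (v u, k u) \<in> aff_orbit \<Lambda>"
    "\<forall>u\<in>{1..<s}. sigma_chain \<Lambda> (\<sigma> u) (v u, k u) (v (Suc u), k (Suc u)) \<and>
      aff_le \<Lambda> (v (Suc u), k (Suc u)) (v u, k u)" using path_data_lift[OF d] by blast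
  note p = path_dataD(1)[OF d]
  have "aff_less \<Lambda> (v (Suc u), k (Suc u)) (v u, k u)" if "u \<in> {1..<s}" for u
    using k(2) ne[OF that] that by (auto simp: aff_less_iff)
  then have "is_ls \<Lambda> s (\<lambda>u. (v u, k u)) \<sigma>" using p k by (auto simp: is_ls_def)
  then have "cl_path (pl_path s (\<lambda>u. (v u, k u)) \<sigma>) \<in> LS_cl \<Lambda>" unfolding LS_cl_def LS_def by blast
  moreover have "cl_path (pl_path s (\<lambda>u. (v u, k u)) \<sigma>) = \<eta>"
    using cl_pl_path[OF p, of "\<lambda>u. (v u, k u)"] d by (intro is_pl_unique[OF p]) (auto simp: path_data_def)
  ultimately show "\<eta> \<in> LS_cl \<Lambda>" by simp
qed

subsection \<open>Heights along a path\<close>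

lemma path_data_0: "path_data s v \<sigma> \<eta> \<Longrightarrow> \<eta> 0 = 0"
  using is_pl_0 by (auto simp: path_data_def)

lemma is_pl_cpair:
  assumes "is_pl s v \<sigma> \<eta>" "u < s" "t \<in> {\<sigma> u..\<sigma> (Suc u)}"
  shows "cpair a (\<eta> t) = cpair a (\<eta> (\<sigma> u)) + (t - \<sigma> u) * cpair a (v (Suc u))"
  by (simp only: is_plD[OF assms] cpair_add cpair_scaleR)

lemma cpair_node:
  assumes d: "path_data s v \<sigma> \<eta>" and u: "u < s"
  shows "cpair a (\<eta> (\<sigma> (Suc u))) = cpair a (\<eta> (\<sigma> u)) + (\<sigma> (Suc u) - \<sigma> u) * cpair a (v (Suc u))"
proof -
  note p = path_dataD(1)[OF d] and pl = path_dataD(2)[OF d]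
  have "\<sigma> (Suc u) \<in> {\<sigma> u..\<sigma> (Suc u)}" using partition_le[OF p, of u "Suc u"] u by simp
  from is_pl_cpair[OF pl u this] show ?thesis .
qed

lemma cpair_slope_sgn:
  assumes d: "path_data s v \<sigma> \<eta>" and u: "u < s"
  shows "sgn (cpair a (v (Suc u))) = sgn (cpair a (\<eta> (\<sigma> (Suc u))) - cpair a (\<eta> (\<sigma> u)))"
proof -
  have "0 < \<sigma> (Suc u) - \<sigma> u"
    using d u partition_less[of s \<sigma> u "Suc u"] by (simp add: path_data_def)
  then show ?thesis by (simp add: cpair_node[OF d u] sgn_mult)
qed

text \<open>On a piece, the height minus time times slope is constant. It starts at 0 and changes by
  an integer at each node, by \<open>chain_integral\<close>.\<close>

lemma node_integral:
  assumes d: "path_data s v \<sigma> \<eta>" and a: "a \<in> \<Phi>"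
  shows "Suc u \<le> s \<Longrightarrow> cpair a (\<eta> (\<sigma> (Suc u))) - \<sigma> (Suc u) * cpair a (v (Suc u)) \<in> \<int>"
proof (induction u)
  case 0
  have "\<sigma> 0 = 0" "\<eta> 0 = 0" using d path_data_0[OF d] by (auto simp: path_data_def rational_partition_def)
  then show ?case using cpair_node[OF d, of 0 a] 0 by (simp add: cpair_zero)
next
  case (Suc u)
  have "chain (\<sigma> (Suc u)) (v (Suc (Suc u))) (v (Suc u))" using d Suc.prems by (simp add: path_data_def)
  from Ints_diff[OF Suc.IH chain_integral[OF this a]] Suc.prems
  have "cpair a (\<eta> (\<sigma> (Suc u))) - \<sigma> (Suc u) * cpair a (v (Suc (Suc u))) \<in> \<int>" by simp
  moreover have "cpair a (\<eta> (\<sigma> (Suc (Suc u)))) - \<sigma> (Suc (Suc u)) * cpair a (v (Suc (Suc u)))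
      = cpair a (\<eta> (\<sigma> (Suc u))) - \<sigma> (Suc u) * cpair a (v (Suc (Suc u)))"
    using cpair_node[OF d, of "Suc u" a] Suc.prems by (simp add: algebra_simps)
  ultimately show ?case by simp
qed

lemma node_integral_iff:
  assumes d: "path_data s v \<sigma> \<eta>" and a: "a \<in> \<Phi>" and u: "u \<in> {1..s}"
  shows "cpair a (\<eta> (\<sigma> u)) \<in> \<int> \<longleftrightarrow> \<sigma> u * cpair a (v u) \<in> \<int>"
proof -
  have "cpair a (\<eta> (\<sigma> u)) - \<sigma> u * cpair a (v u) \<in> \<int>"
    using node_integral[OF d a, of "u - 1"] u by simp
  then show ?thesis by (rule Ints_diff_iff)
qed

lemma node_integral_iff':
  assumes d: "path_data s v \<sigma> \<eta>" and a: "a \<in> \<Phi>" and u: "u \<in> {1..<s}"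
  shows "cpair a (\<eta> (\<sigma> u)) \<in> \<int> \<longleftrightarrow> \<sigma> u * cpair a (v (Suc u)) \<in> \<int>"
proof -
  from Ints_diff_iff[OF chain_integral[OF path_dataD(3)[OF d u] a]] show ?thesis
    using node_integral_iff[OF d a, of u] u by simp
qed

lemma end_integral:
  assumes d: "path_data s v \<sigma> \<eta>" and a: "a \<in> \<Phi>" shows "cpair a (\<eta> 1) \<in> \<int>"
proof -
  note p = path_dataD(1)[OF d]
  have s: "\<sigma> s = 1" "s \<in> {1..s}" using p partition_pos[OF p] by (auto simp: rational_partition_def)
  have "v s \<in> orbit" using d s(2) by (simp add: path_data_def)
  then show ?thesis using node_integral_iff[OF d a s(2)] orbit_integral[OF _ a, of "v s"] s(1) by simp
qed

lemma node_rational: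
  assumes d: "path_data s v \<sigma> \<eta>" and a: "a \<in> \<Phi>" and u: "u \<le> s"
  shows "cpair a (\<eta> (\<sigma> u)) \<in> \<rat>"
proof (cases u)
  case 0
  then have "\<sigma> u = 0" using d by (simp add: path_data_def rational_partition_def)
  then show ?thesis using path_data_0[OF d] by (simp add: cpair_zero)
next
  case (Suc w)
  have "v u \<in> orbit" "\<sigma> u \<in> \<rat>" using d u Suc by (auto simp: path_data_def rational_partition_def)
  then have "\<sigma> u * cpair a (v u) \<in> \<rat>" using Rats_mult[of "\<sigma> u"] orbit_integral[OF _ a, of "v u"] Ints_subset_Rats by auto
  moreover have "cpair a (\<eta> (\<sigma> u)) - \<sigma> u * cpair a (v u) \<in> \<rat>"
    using node_integral[OF d a, of w] u Suc Ints_subset_Rats by auto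
  ultimately show ?thesis by (metis Rats_add diff_add_cancel)
qed

text \<open>The time solves a linear equation with rational data. This makes the points cut by the
  root operators admissible as nodes.\<close>

lemma level_rational:
  assumes d: "path_data s v \<sigma> \<eta>" and a: "a \<in> \<Phi>" and u: "u < s" and t: "t \<in> {\<sigma> u..\<sigma> (Suc u)}"
    and l: "cpair a (\<eta> t) \<in> \<int>" and nz: "cpair a (v (Suc u)) \<noteq> 0"
  shows "t \<in> \<rat>"
proof -
  note pl = path_dataD(2)[OF d]
  have "t = \<sigma> u + (cpair a (\<eta> t) - cpair a (\<eta> (\<sigma> u))) / cpair a (v (Suc u))"
    using is_pl_cpair[OF pl u t, of a] nz by (simp add: field_simps)
  moreover have "v (Suc u) \<in> orbit" "\<sigma> u \<in> \<rat>"
    using d u by (auto simp: path_data_def rational_partition_def)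
  ultimately show ?thesis
    using node_rational[OF d a, of u] u l orbit_integral[OF _ a, of "v (Suc u)"] Ints_subset_Rats
    by (metis Rats_add Rats_diff Rats_divide less_imp_le subsetD)
qed

text \<open>The chain at a node runs from the later direction to the earlier one, so a rise of the
  slope's sign in time is a drop along the chain.\<close>

lemma node_sgn_integral:
  assumes d: "path_data s v \<sigma> \<eta>" and u: "u \<in> {1..<s}"
    and sg: "sgn (ipair i (v u)) < sgn (ipair i (v (Suc u)))"
  shows "ipair i (\<eta> (\<sigma> u)) \<in> \<int>"
proof -
  from chain_drop_integral[OF path_dataD(3)[OF d u] sg] show ?thesis using node_integral_iff'[OF d cl_simple_root u] by simp
qed

subsection \<open>Reflecting a segment of a path\<close>

text \<open>The common form of both root operators: the height changes over the segment by -1 for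
  \<open>crystal_e\<close> and by 1 for \<open>crystal_f\<close>, which turns the final shift into
  adding or subtracting \<open>cl_simple i\<close>.\<close>

definition reflect_path :: "'i option \<Rightarrow> real \<Rightarrow> real \<Rightarrow> (real \<Rightarrow> 'a) \<Rightarrow> real \<Rightarrow> 'a" where
  "reflect_path i t0 t1 \<eta> = (\<lambda>t\<in>{0..1}. if t \<le> t0 then \<eta> t
     else if t \<le> t1 then \<eta> t0 + irefl i (\<eta> t - \<eta> t0)
     else \<eta> t - (ipair i (\<eta> t1) - ipair i (\<eta> t0)) *\<^sub>R cl_simple i)"

text \<open>Only the chains at the two ends need separate attention. At inner nodes, non-integral
  heights and equal signs let \<open>chain_refl_both\<close> reflect the whole chain.\<close>

lemma reflect_path_data:
  assumes d: "path_data s v \<sigma> \<eta>" and ab: "a < b" "b \<le> s"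
    and at_a: "1 \<le> a \<Longrightarrow> chain (\<sigma> a) (irefl i (v (Suc a))) (v a)"
    and inner: "\<And>u. a < u \<Longrightarrow> u < b \<Longrightarrow> ipair i (\<eta> (\<sigma> u)) \<notin> \<int>"
      "\<And>u. a < u \<Longrightarrow> u < b \<Longrightarrow> sgn (ipair i (v u)) = sgn (ipair i (v (Suc u)))"
    and at_b: "b < s \<Longrightarrow> chain (\<sigma> b) (v (Suc b)) (irefl i (v b))"
  shows "reflect_path i (\<sigma> a) (\<sigma> b) \<eta> \<in> chain_paths"
proof -
  note p = path_dataD(1)[OF d] and pl = path_dataD(2)[OF d]
  define v' where "v' u = (if a < u \<and> u \<le> b then irefl i (v u) else v u)" for u
  let ?e = "reflect_path i (\<sigma> a) (\<sigma> b) \<eta>"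
  have lin: "linear (irefl i)" by (rule refl_root_linear)
  have bnd: "\<sigma> u \<in> {0..1}" if "u \<le> s" for u using partition_bounds[OF p that] by simp
  have left: "?e t = \<eta> t" if "t \<in> {0..1}" "t \<le> \<sigma> a" for t
    using that by (simp add: reflect_path_def)
  have mid: "?e t = \<eta> (\<sigma> a) + irefl i (\<eta> t - \<eta> (\<sigma> a))" if "t \<in> {0..1}" "\<sigma> a \<le> t" "t \<le> \<sigma> b" for t
    using that linear_0[OF lin] by (cases "t = \<sigma> a") (auto simp: reflect_path_def)
  have right: "?e t = \<eta> t - (ipair i (\<eta> (\<sigma> b)) - ipair i (\<eta> (\<sigma> a))) *\<^sub>R cl_simple i"
    if "t \<in> {0..1}" "\<sigma> b \<le> t" for t
  proof (cases "t = \<sigma> b")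
    case True
    have "\<sigma> a < \<sigma> b" using partition_less[OF p ab] .
    then have "?e t = \<eta> (\<sigma> a) + irefl i (\<eta> t - \<eta> (\<sigma> a))" using mid[OF that(1)] True by simp
    then show ?thesis using True by (simp add: refl_root_def cpair_diff)
  next
    case False
    then show ?thesis using that partition_less[OF p ab] by (simp add: reflect_path_def)
  qed
  have "is_pl s v' \<sigma> ?e"
  proof (rule is_plI)
    show "?e \<in> extensional {0..1}" by (simp add: reflect_path_def)
    show "?e 0 = 0" using left[of 0] bnd[of a] ab is_pl_0[OF pl] by simp
    fix u t assume u: "u < s" "t \<in> {\<sigma> u..\<sigma> (Suc u)}"
    have t01: "t \<in> {0..1}" using bnd[of u] bnd[of "Suc u"] u by auto
    have u01: "\<sigma> u \<in> {0..1}" using bnd[of u] u by simp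
    have e: "\<eta> t = \<eta> (\<sigma> u) + (t - \<sigma> u) *\<^sub>R v (Suc u)" by (rule is_plD[OF pl u])
    consider "u < a" | "a \<le> u" "u < b" | "b \<le> u" by linarith
    then show "?e t = ?e (\<sigma> u) + (t - \<sigma> u) *\<^sub>R v' (Suc u)"
    proof cases
      case 1
      then have "\<sigma> (Suc u) \<le> \<sigma> a" "\<sigma> u \<le> \<sigma> a" using partition_le[OF p] ab by auto
      then show ?thesis using left[OF t01] left[OF u01] e u 1 by (simp add: v'_def)
    next
      case 2
      have le: "\<sigma> (Suc u) \<le> \<sigma> b" "\<sigma> u \<le> \<sigma> b" "\<sigma> a \<le> \<sigma> u"
        using partition_le[OF p, of "Suc u" b] partition_le[OF p, of u b] partition_le[OF p, of a u] ab 2 by auto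
      have "?e t = \<eta> (\<sigma> a) + irefl i ((\<eta> (\<sigma> u) - \<eta> (\<sigma> a)) + (t - \<sigma> u) *\<^sub>R v (Suc u))"
        using mid[OF t01] le u e by (simp add: algebra_simps)
      also have "\<dots> = ?e (\<sigma> u) + (t - \<sigma> u) *\<^sub>R v' (Suc u)"
        using mid[OF u01] le 2 by (simp add: linear_add[OF lin] linear_scale[OF lin] v'_def)
      finally show ?thesis .
    next
      case 3
      then have "\<sigma> b \<le> \<sigma> u" using partition_le[OF p] u by auto
      then show ?thesis using right[OF t01] right[OF u01] e u 3 by (simp add: v'_def)
    qed
  qed
  moreover have "v' u \<in> orbit" if "u \<in> {1..s}" for u
    using d that orbit_refl[OF _ cl_simple_root] by (auto simp: path_data_def v'_def)
  moreover have "chain (\<sigma> u) (v' (Suc u)) (v' u)" if u: "u \<in> {1..<s}" for u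
  proof -
    note ch = path_dataD(3)[OF d u]
    consider "u < a" | "u = a" | "a < u" "u < b" | "u = b" | "b < u" by linarith
    then show ?thesis
    proof cases
      case 1 then show ?thesis using ch ab by (simp add: v'_def)
    next
      case 2 then show ?thesis using at_a ab u by (simp add: v'_def)
    next
      case 3
      have "\<sigma> u * ipair i (v (Suc u)) \<notin> \<int>"
        using inner(1)[OF 3] node_integral_iff'[OF d cl_simple_root u] by simp
      then show ?thesis using chain_refl_both[OF ch] inner(2)[OF 3] 3 by (simp add: v'_def)
    next
      case 4 then show ?thesis using at_b ab u by (simp add: v'_def)
    next
      case 5 then show ?thesis using ch ab by (simp add: v'_def)
    qed
  qed
  ultimately have "path_data s v' \<sigma> ?e" using p by (simp add: path_data_def)
  then show ?thesis unfolding chain_paths_def by blast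
qed

subsection \<open>The crystal operators\<close>

lemma height_continuous:
  assumes "path_data s v \<sigma> \<eta>" shows "continuous_on {0..1} (\<lambda>t. cpair a (\<eta> t))"
proof -
  have "continuous_on {0..1} \<eta>" using assms is_pl_continuous by (auto simp: path_data_def)
  then show ?thesis unfolding cpair_def divide_inverse by (intro continuous_intros)
qed

lemma min_height_first:
  assumes d: "path_data s v \<sigma> \<eta>"
  obtains t1 where "t1 \<in> {0..1}" "ipair i (\<eta> t1) = min_height i \<eta>"
    "\<And>t. t \<in> {0..1} \<Longrightarrow> min_height i \<eta> \<le> ipair i (\<eta> t)"
    "\<And>t. t \<in> {0..1} \<Longrightarrow> ipair i (\<eta> t) = min_height i \<eta> \<Longrightarrow> t1 \<le> t"
proof -
  obtain x where x: "x \<in> {0..1}" "\<forall>t\<in>{0..1}. ipair i (\<eta> x) \<le> ipair i (\<eta> t)"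
    using continuous_attains_inf[OF _ _ height_continuous[OF d, of "cl_simple i"]] by auto
  have m: "min_height i \<eta> = ipair i (\<eta> x)"
    unfolding min_height_def cl_coroot_eq by (rule Least_equality) (use x in auto)
  obtain t1 where "t1 \<in> {0..1}" "ipair i (\<eta> t1) = ipair i (\<eta> x)"
    "\<And>y. y \<in> {0..1} \<Longrightarrow> ipair i (\<eta> y) = ipair i (\<eta> x) \<Longrightarrow> t1 \<le> y"
    using ex_first_level[OF height_continuous[OF d] x(1), of "cl_simple i" "ipair i (\<eta> x)"] by blast
  then show thesis using that[of t1] x m by simp
qed

text \<open>The height falls strictly just before its first minimum and cannot go on falling, so a
  piece ends there, and a following piece has nonnegative slope.\<close>

lemma min_first_node:
  assumes d: "path_data s v \<sigma> \<eta>" and t1: "t1 \<in> {0..1}" "t1 \<noteq> 0"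
    and min: "\<And>t. t \<in> {0..1} \<Longrightarrow> ipair i (\<eta> t1) \<le> ipair i (\<eta> t)"
    and first: "\<And>t. t \<in> {0..1} \<Longrightarrow> ipair i (\<eta> t) = ipair i (\<eta> t1) \<Longrightarrow> t1 \<le> t"
  obtains b where "b \<in> {1..s}" "t1 = \<sigma> b" "ipair i (v b) < 0" "b < s \<Longrightarrow> 0 \<le> ipair i (v (Suc b))"
proof -
  note p = path_dataD(1)[OF d] and pl = path_dataD(2)[OF d]
  have "0 < t1" "t1 \<le> 1" using t1 by auto
  from partition_piece_left[OF p this] obtain u where u: "u < s" "\<sigma> u < t1" "t1 \<le> \<sigma> (Suc u)" .
  have bnd: "\<sigma> j \<in> {0..1}" if "j \<le> s" for j using partition_bounds[OF p that] by simp
  have "ipair i (\<eta> t1) < ipair i (\<eta> (\<sigma> u))"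
    using min[of "\<sigma> u"] first[of "\<sigma> u"] bnd[of u] u by force
  then have "(t1 - \<sigma> u) * ipair i (v (Suc u)) < 0"
    using is_pl_cpair[OF pl u(1), of t1 "cl_simple i"] u by simp
  then have neg: "ipair i (v (Suc u)) < 0" using u(2) by (simp add: mult_less_0_iff)
  have eq: "t1 = \<sigma> (Suc u)"
  proof (rule ccontr)
    assume "t1 \<noteq> \<sigma> (Suc u)"
    then have "(\<sigma> (Suc u) - t1) * ipair i (v (Suc u)) < 0" using u neg by (intro mult_pos_neg) auto
    moreover have "ipair i (\<eta> (\<sigma> (Suc u))) - ipair i (\<eta> t1) = (\<sigma> (Suc u) - t1) * ipair i (v (Suc u))"
      using is_pl_cpair[OF pl u(1), of t1 "cl_simple i"] cpair_node[OF d u(1), of "cl_simple i"] u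
      by (simp add: algebra_simps)
    ultimately show False using min[of "\<sigma> (Suc u)"] bnd[of "Suc u"] u by simp
  qed
  have "0 \<le> ipair i (v (Suc (Suc u)))" if "Suc u < s"
  proof -
    have "0 \<le> sgn (ipair i (v (Suc (Suc u))))"
      unfolding cpair_slope_sgn[OF d that] using min[of "\<sigma> (Suc (Suc u))"] bnd[of "Suc (Suc u)"] that eq
      by (simp add: sgn_if)
    then show ?thesis by (simp add: sgn_if split: if_splits)
  qed
  then show thesis using that[of "Suc u"] u eq neg by simp
qed

lemma min_height_integral:
  assumes d: "path_data s v \<sigma> \<eta>" shows "min_height i \<eta> \<in> \<int>"
proof -
  obtain t1 where t1: "t1 \<in> {0..1}" "ipair i (\<eta> t1) = min_height i \<eta>"
    "\<And>t. t \<in> {0..1} \<Longrightarrow> min_height i \<eta> \<le> ipair i (\<eta> t)"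
    "\<And>t. t \<in> {0..1} \<Longrightarrow> ipair i (\<eta> t) = min_height i \<eta> \<Longrightarrow> t1 \<le> t"
    using min_height_first[OF d] by blast
  note p = path_dataD(1)[OF d] and pl = path_dataD(2)[OF d]
  show ?thesis
  proof (cases "t1 = 0")
    case True
    then show ?thesis using t1(2) is_pl_0[OF pl] by (metis Ints_0 cpair_zero)
  next
    case False
    obtain b where b: "b \<in> {1..s}" "t1 = \<sigma> b" "ipair i (v b) < 0" "b < s \<Longrightarrow> 0 \<le> ipair i (v (Suc b))"
      using min_first_node[OF d t1(1) False] t1 by metis
    show ?thesis
    proof (cases "b = s")
      case True
      then have "t1 = 1" using b p by (simp add: rational_partition_def)
      then show ?thesis using end_integral[OF d cl_simple_root, of i] t1(2) by simp
    next
      case False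
      then have "b \<in> {1..<s}" using b by auto
      moreover have "sgn (ipair i (v b)) < sgn (ipair i (v (Suc b)))" using b False by (auto simp: sgn_if)
      ultimately show ?thesis using node_sgn_integral[OF d, of b i] b t1(2) by simp
    qed
  qed
qed

lemma no_integer_between:
  fixes h m :: real assumes "m \<in> \<int>" "m < h" "h < m + 1" shows "h \<notin> \<int>"
proof
  assume "h \<in> \<int>"
  then obtain k l :: int where "h = k" "m = l" using assms(1) by (auto elim!: Ints_cases)
  then show False using assms by simp
qed

text \<open>The first minimum t1 is already a node, and t0 is inserted. Strictly between them
  heights lie between consecutive integers, so the slope cannot turn from negative to nonnegative.
  At t0 an edge r_i is prepended to the chain; at t1 \<open>chain_refl_right\<close> reflects its
  end.\<close>

lemma crystal_e_closed:
  assumes "\<eta> \<in> chain_paths" "crystal_e i \<eta> = Some \<eta>'" shows "\<eta>' \<in> chain_paths"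
proof -
  define m where "m = min_height i \<eta>"
  define H where "H t = ipair i (\<eta> t)" for t
  obtain s0 v0 \<sigma>0 where d0: "path_data s0 v0 \<sigma>0 \<eta>" using assms(1) by (auto simp: chain_paths_def)
  have cont: "continuous_on {0..1} H" using height_continuous[OF d0] by (simp add: H_def[abs_def])
  have H0: "H 0 = 0" using path_data_0[OF d0] by (simp add: H_def cpair_zero)
  have m0: "m \<noteq> 0" using assms(2) by (auto simp: crystal_e_def Let_def m_def split: if_splits)
  obtain t1 where t1: "t1 \<in> {0..1}" "H t1 = m" "\<And>t. t \<in> {0..1} \<Longrightarrow> m \<le> H t"
    "\<And>t. t \<in> {0..1} \<Longrightarrow> H t = m \<Longrightarrow> t1 \<le> t"
    unfolding H_def m_def using min_height_first[OF d0] by blast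
  have mI: "m \<in> \<int>" unfolding m_def by (rule min_height_integral[OF d0])
  have "m < 0" using t1(3)[of 0] H0 m0 by simp
  then have m1: "m \<le> -1" using mI by (auto elim!: Ints_cases)
  have t1nz: "t1 \<noteq> 0" using t1(2) H0 m0 by auto
  have cont1: "continuous_on {a..t1} H" if "0 \<le> a" for a
    using t1(1) that by (intro continuous_on_subset[OF cont]) auto
  obtain x where x: "0 \<le> x" "x \<le> t1" "H x = m + 1"
    using IVT2'[of H t1 "m + 1" 0] t1 H0 m1 cont1[of 0] by auto
  obtain t0 where t0: "t0 \<in> {0..t1}" "H t0 = m + 1" "\<And>y. y \<in> {0..t1} \<Longrightarrow> H y = m + 1 \<Longrightarrow> y \<le> t0"
    using ex_last_level[OF cont1[of 0], of x "m + 1"] x by auto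
  have t01: "t0 < t1" using t0(1,2) t1(1,2) by (cases "t0 = t1") auto
  have between: "m < H t \<and> H t < m + 1" if lt: "t0 < t" "t < t1" for t
  proof
    have t: "t \<in> {0..1}" using lt t0 t1 by auto
    have "H t \<noteq> m" using t1(4)[OF t] lt by auto
    then show "m < H t" using t1(3)[OF t] by simp
    show "H t < m + 1"
    proof (rule ccontr)
      assume "\<not> ?thesis"
      then obtain y where "t \<le> y" "y \<le> t1" "H y = m + 1"
        using IVT2'[of H t1 "m + 1" t] t1(2) lt cont1[of t] t by auto
      then show False using t0(3)[of y] lt t by auto
    qed
  qed
  have least: "(LEAST t. t \<in> {0..1} \<and> H t = m) = t1"
    using t1 by (intro Least_equality) auto
  have greatest: "(GREATEST t. t \<in> {0..t1} \<and> H t = m + 1) = t0"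
    using t0 by (intro Greatest_equality) auto
  have diff: "ipair i (\<eta> t1) - ipair i (\<eta> t0) = -1" using t0(2) t1(2) by (simp add: H_def)
  have eq: "\<eta>' = reflect_path i t0 t1 \<eta>"
    using assms(2) m0 t0(2) t1(2) unfolding crystal_e_def cl_coroot_eq Let_def m_def[symmetric] H_def[symmetric]
      least greatest
    unfolding reflect_path_def cl_refl_eq diff scaleR_minus_left scaleR_one diff_minus_eq_add by simp
  obtain b0 where b0: "b0 \<in> {1..s0}" "t1 = \<sigma>0 b0"
    using min_first_node[OF d0 t1(1) t1nz, of i] t1 unfolding H_def by metis
  note p0 = path_dataD(1)[OF d0]
  have "0 \<le> t0" "t0 < 1" using t0 t01 t1 by auto
  from partition_piece_right[OF p0 this] obtain u where u: "u < s0" "\<sigma>0 u \<le> t0" "t0 < \<sigma>0 (Suc u)" .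
  \<comment> \<open>On the piece starting at or just before t0 the height falls below m + 1, so its
    slope is nonzero and t0 is rational.\<close>
  have "u < b0" using partition_less_iff[OF p0, of u b0] u b0 t01 by auto
  then have "\<sigma>0 (Suc u) \<le> t1" using partition_le[OF p0, of "Suc u" b0] b0 by auto
  then have "H (\<sigma>0 (Suc u)) < m + 1" using between[of "\<sigma>0 (Suc u)"] u t1(2) by (cases "\<sigma>0 (Suc u) = t1") auto
  then have "ipair i (v0 (Suc u)) \<noteq> 0"
    using is_pl_cpair[of s0 v0 \<sigma>0 \<eta> u t0 "cl_simple i"] cpair_node[OF d0 u(1), of "cl_simple i"] d0 u t0(2)
    by (auto simp: H_def path_data_def)
  then have t0r: "t0 \<in> \<rat>"
    using level_rational[OF d0 cl_simple_root u(1), of t0 i] u t0(2) mI by (simp add: H_def)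
  have t0I: "t0 \<in> {0..1}" using \<open>0 \<le> t0\<close> \<open>t0 < 1\<close> by simp
  obtain s v \<sigma> where d: "path_data s v \<sigma> \<eta>" and nodes: "\<exists>a\<le>s. \<sigma> a = t0" "\<forall>b\<le>s0. \<exists>b'\<le>s. \<sigma> b' = \<sigma>0 b"
    by (rule path_data_insert[OF d0 t0I t0r])
  obtain a b where ab: "a \<le> s" "\<sigma> a = t0" "b \<le> s" "\<sigma> b = t1"
    using nodes b0 by (metis atLeastAtMost_iff)
  note p = path_dataD(1)[OF d]
  have lt: "a < b" using partition_less_iff[OF p, of a b] ab t01 by simp
  obtain b' where b': "b' \<in> {1..s}" "t1 = \<sigma> b'" "ipair i (v b') < 0" "b' < s \<Longrightarrow> 0 \<le> ipair i (v (Suc b'))"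
    using min_first_node[OF d t1(1) t1nz, of i] t1 unfolding H_def by metis
  have bb: "b' = b"
    using partition_less_iff[OF p, of b b'] partition_less_iff[OF p, of b' b] b' ab by force
  have inner: "H (\<sigma> u) \<notin> \<int>" if "a < u" "u < b" for u
    using between[of "\<sigma> u"] partition_less[OF p, of a u] partition_less[OF p, of u b] that ab
    by (intro no_integer_between[OF mI]) auto
  have neg: "a < u \<Longrightarrow> u \<le> b \<Longrightarrow> ipair i (v u) < 0" for u
  proof (induction u)
    case (Suc u)
    show ?case
    proof (cases "u = a")
      case True
      have "t0 < \<sigma> (Suc a)" "\<sigma> (Suc a) \<le> t1"
        using partition_less[OF p, of a "Suc a"] partition_le[OF p, of "Suc a" b] ab lt by auto
      then have "H (\<sigma> (Suc a)) < H (\<sigma> a)"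
        using between[of "\<sigma> (Suc a)"] t1(2) t0(2) ab by (cases "\<sigma> (Suc a) = t1") auto
      then have "sgn (ipair i (v (Suc a))) = -1"
        using cpair_slope_sgn[OF d, of a "cl_simple i"] lt ab by (simp add: H_def)
      then show ?thesis using True by (simp add: sgn_if split: if_splits)
    next
      case False
      then have n: "ipair i (v u) < 0" using Suc by simp
      show ?thesis
      proof (rule ccontr)
        assume "\<not> ?thesis"
        then have "sgn (ipair i (v u)) < sgn (ipair i (v (Suc u)))" using n by (auto simp: sgn_if)
        then have "H (\<sigma> u) \<in> \<int>"
          unfolding H_def using Suc.prems ab False by (intro node_sgn_integral[OF d]) auto
        then show False using inner[of u] Suc.prems False by simp
      qed
    qed
  qed simp
  have "reflect_path i (\<sigma> a) (\<sigma> b) \<eta> \<in> chain_paths"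
  proof (rule reflect_path_data[OF d lt ab(3)])
    assume a1: "1 \<le> a"
    then have aS: "a \<in> {1..<s}" using lt ab by simp
    have "H (\<sigma> a) \<in> \<int>" using mI t0(2) ab by simp
    then have "\<sigma> a * ipair i (v (Suc a)) \<in> \<int>"
      using node_integral_iff'[OF d cl_simple_root aS, of i] by (simp add: H_def)
    \<comment> \<open>After reflection the pairing is positive, so the simple edge leads from the
      reflected direction back to the original one.\<close>
    then have "weight_edge (\<sigma> a) (irefl i (v (Suc a))) (irefl i (irefl i (v (Suc a))))"
      using neg[of "Suc a"] lt by (intro weight_edge_simple) (auto simp: cpair_refl_same)
    moreover have "chain (\<sigma> a) (v (Suc a)) (v a)" using d aS by (simp add: path_data_def)
    ultimately show "chain (\<sigma> a) (irefl i (v (Suc a))) (v a)"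
      by (simp add: converse_rtranclp_into_rtranclp)
  next
    fix u assume u: "a < u" "u < b"
    show "ipair i (\<eta> (\<sigma> u)) \<notin> \<int>" using inner[OF u] by (simp add: H_def)
    show "sgn (ipair i (v u)) = sgn (ipair i (v (Suc u)))" using neg[of u] neg[of "Suc u"] u by simp
  next
    assume b1: "b < s"
    then have "chain (\<sigma> b) (v (Suc b)) (v b)" using d lt by (simp add: path_data_def)
    then show "chain (\<sigma> b) (v (Suc b)) (irefl i (v b))"
      using chain_refl_right b' bb b1 by simp
  qed
  then show ?thesis using eq ab by simp
qed

text \<open>Here the last minimum t0 is a node and t1 is inserted. The chain at t0 gets its start
  reflected by \<open>chain_refl_left\<close>, and at t1 an edge r_i is appended.\<close>

lemma crystal_f_closed:
  assumes "\<eta> \<in> chain_paths" "crystal_f i \<eta> = Some \<eta>'" shows "\<eta>' \<in> chain_paths"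
proof -
  define m where "m = min_height i \<eta>"
  define H where "H t = ipair i (\<eta> t)" for t
  obtain s0 v0 \<sigma>0 where d0: "path_data s0 v0 \<sigma>0 \<eta>" using assms(1) by (auto simp: chain_paths_def)
  note p0 = path_dataD(1)[OF d0] and pl0 = path_dataD(2)[OF d0]
  have cont: "continuous_on {0..1} H" using height_continuous[OF d0] by (simp add: H_def[abs_def])
  have m1: "H 1 \<noteq> m"
    using assms(2) by (auto simp: crystal_f_def Let_def m_def H_def cl_coroot_eq split: if_splits)
  obtain x where x: "x \<in> {0..1}" "H x = m" "\<And>t. t \<in> {0..1} \<Longrightarrow> m \<le> H t"
    unfolding H_def m_def using min_height_first[OF d0] by metis
  have mI: "m \<in> \<int>" unfolding m_def by (rule min_height_integral[OF d0])
  have "m < H 1" using x(3)[of 1] m1 by simp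
  moreover have "H 1 \<in> \<int>" unfolding H_def by (rule end_integral[OF d0 cl_simple_root])
  ultimately have H1: "m + 1 \<le> H 1" using mI by (auto elim!: Ints_cases)
  obtain t0 where t0: "t0 \<in> {0..1}" "H t0 = m" "\<And>y. y \<in> {0..1} \<Longrightarrow> H y = m \<Longrightarrow> y \<le> t0"
    using ex_last_level[OF cont x(1,2)] by blast
  have t0lt: "0 \<le> t0" "t0 < 1" using t0 m1 by (auto simp: less_le)
  have cont0: "continuous_on {t0..b} H" if "b \<le> 1" for b
    using t0(1) that by (intro continuous_on_subset[OF cont]) auto
  obtain y where y: "t0 \<le> y" "y \<le> 1" "H y = m + 1"
    using IVT'[of H t0 "m + 1" 1] t0 t0lt H1 cont0[of 1] by auto
  obtain t1 where t1: "t1 \<in> {t0..1}" "H t1 = m + 1" "\<And>y. y \<in> {t0..1} \<Longrightarrow> H y = m + 1 \<Longrightarrow> t1 \<le> y"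
    using ex_first_level[OF cont0[of 1], of y "m + 1"] y by auto
  have t01: "t0 < t1" using t0(1,2) t1(1,2) by (cases "t0 = t1") auto
  have between: "m < H t \<and> H t < m + 1" if lt: "t0 < t" "t < t1" for t
  proof
    have t: "t \<in> {0..1}" using lt t0 t1 by auto
    have "H t \<noteq> m" using t0(3)[OF t] lt by auto
    then show "m < H t" using x(3)[OF t] by simp
    show "H t < m + 1"
    proof (rule ccontr)
      assume "\<not> ?thesis"
      then obtain y where "t0 \<le> y" "y \<le> t" "H y = m + 1"
        using IVT'[of H t0 "m + 1" t] t0(2) lt cont0[of t] t by auto
      then show False using t1(3)[of y] lt t by auto
    qed
  qed
  have greatest: "(GREATEST t. t \<in> {0..1} \<and> H t = m) = t0"
    using t0 by (intro Greatest_equality) auto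
  have least: "(LEAST t. t \<in> {t0..1} \<and> H t = m + 1) = t1"
    using t1 by (intro Least_equality) auto
  have diff: "ipair i (\<eta> t1) - ipair i (\<eta> t0) = 1" using t0(2) t1(2) by (simp add: H_def)
  have eq: "\<eta>' = reflect_path i t0 t1 \<eta>"
    using assms(2) m1 t0(2) t1(2) unfolding crystal_f_def cl_coroot_eq Let_def m_def[symmetric] H_def[symmetric]
      least greatest
    unfolding reflect_path_def cl_refl_eq diff scaleR_minus_left scaleR_one diff_minus_eq_add by simp
  \<comment> \<open>Stated for arbitrary data of the path, because it is used both before and after
    the insertion of t1.\<close>
  have node0: "\<exists>a\<le>s. \<sigma> a = t0 \<and> a < s \<and> (1 \<le> a \<longrightarrow> ipair i (v a) \<le> 0)"
    if d: "path_data s v \<sigma> \<eta>" for s v \<sigma>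
  proof -
    note p = path_dataD(1)[OF d] and pl = path_dataD(2)[OF d]
    have bnd: "\<sigma> j \<in> {0..1}" if "j \<le> s" for j using partition_bounds[OF p that] by simp
    obtain u where u: "u < s" "\<sigma> u \<le> t0" "t0 < \<sigma> (Suc u)" using partition_piece_right[OF p t0lt] .
    have mid: "H t0 = H (\<sigma> u) + (t0 - \<sigma> u) * ipair i (v (Suc u))"
      "H (\<sigma> (Suc u)) = H (\<sigma> u) + (\<sigma> (Suc u) - \<sigma> u) * ipair i (v (Suc u))"
      using is_pl_cpair[OF pl u(1), of t0 "cl_simple i"] cpair_node[OF d u(1), of "cl_simple i"] u
      by (auto simp: H_def)
    have "m < H (\<sigma> (Suc u))" using x(3)[of "\<sigma> (Suc u)"] t0(3)[of "\<sigma> (Suc u)"] bnd[of "Suc u"] u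
      by (force simp: less_le)
    then have "0 < (\<sigma> (Suc u) - t0) * ipair i (v (Suc u))" using mid t0(2) by (simp add: algebra_simps)
    then have pos: "0 < ipair i (v (Suc u))" using u by (simp add: zero_less_mult_iff)
    have "\<sigma> u = t0"
    proof (rule ccontr)
      assume "\<sigma> u \<noteq> t0"
      then have "0 < (t0 - \<sigma> u) * ipair i (v (Suc u))" using pos u by simp
      then show False using mid(1) t0(2) x(3)[of "\<sigma> u"] bnd[of u] u by simp
    qed
    moreover have "ipair i (v u) \<le> 0" if u1: "1 \<le> u"
    proof -
      obtain w where w: "u = Suc w" using u1 by (cases u) auto
      have "sgn (ipair i (v u)) \<le> 0"
        unfolding w using cpair_slope_sgn[OF d, of w "cl_simple i"] x(3)[of "\<sigma> w"] bnd[of w] u w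
          \<open>\<sigma> u = t0\<close> t0(2) by (simp add: H_def sgn_if)
      then show ?thesis by (simp add: sgn_if split: if_splits)
    qed
    ultimately show ?thesis using u by (intro exI[of _ u]) simp
  qed
  obtain a0 where a0: "a0 < s0" "\<sigma>0 a0 = t0" using node0[OF d0] by blast
  have "0 < t1" "t1 \<le> 1" using t01 t0lt t1 by auto
  from partition_piece_left[OF p0 this] obtain u where u: "u < s0" "\<sigma>0 u < t1" "t1 \<le> \<sigma>0 (Suc u)" .
  have "a0 < Suc u" using partition_less_iff[OF p0, of a0 "Suc u"] u a0 t01 by auto
  then have "t0 \<le> \<sigma>0 u" using partition_le[OF p0, of a0 u] a0 u by auto
  then have "H (\<sigma>0 u) < m + 1" using between[of "\<sigma>0 u"] u t0(2) by (cases "\<sigma>0 u = t0") auto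
  then have "ipair i (v0 (Suc u)) \<noteq> 0"
    using is_pl_cpair[OF pl0 u(1), of t1 "cl_simple i"] u t1(2) by (auto simp: H_def)
  then have t1r: "t1 \<in> \<rat>"
    using level_rational[OF d0 cl_simple_root u(1), of t1 i] u t1(2) mI by (simp add: H_def)
  have t1I: "t1 \<in> {0..1}" using \<open>0 < t1\<close> \<open>t1 \<le> 1\<close> by simp
  obtain s v \<sigma> where d: "path_data s v \<sigma> \<eta>" and b: "\<exists>b\<le>s. \<sigma> b = t1"
      and "\<forall>b\<le>s0. \<exists>b'\<le>s. \<sigma> b' = \<sigma>0 b"
    by (rule path_data_insert[OF d0 t1I t1r])
  obtain a where a: "a < s" "\<sigma> a = t0" "1 \<le> a \<Longrightarrow> ipair i (v a) \<le> 0" using node0[OF d] by blast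
  obtain b where b: "b \<le> s" "\<sigma> b = t1" using b by blast
  note p = path_dataD(1)[OF d]
  have lt: "a < b" using partition_less_iff[OF p, of a b] a b t01 by simp
  have inner: "H (\<sigma> u) \<notin> \<int>" if "a < u" "u < b" for u
    using between[of "\<sigma> u"] partition_less[OF p, of a u] partition_less[OF p, of u b] that a b
    by (intro no_integer_between[OF mI]) auto
  \<comment> \<open>The slope is known first on the last piece, where the height rises to m + 1, so
    the induction runs backwards from b.\<close>
  have pos: "a < b - n \<Longrightarrow> 0 < ipair i (v (b - n))" for n
  proof (induction n)
    case 0
    obtain w where w: "b = Suc w" using lt by (cases b) auto
    have "t0 \<le> \<sigma> w" "\<sigma> w < t1"
      using partition_le[OF p, of a w] partition_less[OF p, of w b] a b lt w by auto
    then have "H (\<sigma> w) < H (\<sigma> b)"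
      using between[of "\<sigma> w"] t1(2) t0(2) b by (cases "\<sigma> w = t0") auto
    then have "sgn (ipair i (v b)) = 1"
      unfolding w using cpair_slope_sgn[OF d, of w "cl_simple i"] w b by (simp add: H_def)
    then show ?case by (simp add: sgn_if split: if_splits)
  next
    case (Suc n)
    define u where "u = b - Suc n"
    have u: "Suc u = b - n" "a < u" "u < b" using Suc.prems by (auto simp: u_def)
    have n: "0 < ipair i (v (Suc u))" using Suc u by simp
    have "0 < ipair i (v u)"
    proof (rule ccontr)
      assume "\<not> ?thesis"
      then have "sgn (ipair i (v u)) < sgn (ipair i (v (Suc u)))" using n by (auto simp: sgn_if)
      then have "H (\<sigma> u) \<in> \<int>"
        unfolding H_def using u b by (intro node_sgn_integral[OF d]) auto
      then show False using inner[of u] u by simp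
    qed
    then show ?case by (simp add: u_def)
  qed
  have pos: "0 < ipair i (v u)" if "a < u" "u \<le> b" for u using pos[of "b - u"] that by simp
  have "reflect_path i (\<sigma> a) (\<sigma> b) \<eta> \<in> chain_paths"
  proof (rule reflect_path_data[OF d lt b(1)])
    assume a1: "1 \<le> a"
    then have "chain (\<sigma> a) (v (Suc a)) (v a)" using d a(1) by (simp add: path_data_def)
    then show "chain (\<sigma> a) (irefl i (v (Suc a))) (v a)"
      using chain_refl_left pos[of "Suc a"] lt a(3)[OF a1] by simp
  next
    fix u assume u: "a < u" "u < b"
    show "ipair i (\<eta> (\<sigma> u)) \<notin> \<int>" using inner[OF u] by (simp add: H_def)
    show "sgn (ipair i (v u)) = sgn (ipair i (v (Suc u)))" using pos[of u] pos[of "Suc u"] u by simp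
  next
    assume b1: "b < s"
    have "H (\<sigma> b) \<in> \<int>" using mI t1(2) b by simp
    then have "\<sigma> b * ipair i (v b) \<in> \<int>"
      using node_integral_iff[OF d cl_simple_root, of b i] lt b by (simp add: H_def)
    then have "weight_edge (\<sigma> b) (v b) (irefl i (v b))"
      using pos[of b] lt by (intro weight_edge_simple) auto
    moreover have "chain (\<sigma> b) (v (Suc b)) (v b)" using d b1 lt by (simp add: path_data_def)
    ultimately show "chain (\<sigma> b) (v (Suc b)) (irefl i (v b))"
      by (simp add: rtranclp.rtrancl_into_rtrancl)
  qed
  then show ?thesis using eq a b by simp
qed

lemma affine_crystal_chain_paths: "affine_crystal chain_paths"
  unfolding affine_crystal_def
proof (intro ballI allI conjI subsetI)
  fix \<eta> i x assume "\<eta> \<in> chain_paths"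
  then show "x \<in> set_option (crystal_e i \<eta>) \<Longrightarrow> x \<in> chain_paths"
    "x \<in> set_option (crystal_f i \<eta>) \<Longrightarrow> x \<in> chain_paths"
    using crystal_e_closed[of \<eta> i x] crystal_f_closed[of \<eta> i x] by (simp_all add: elem_set)
qed

end

theorem proposition4p6:
  fixes \<Phi> :: "'a::euclidean_space set" and \<alpha> :: "'i::finite \<Rightarrow> 'a" and \<Lambda> :: 'a
  assumes "simple_root_system \<Phi> \<alpha>"
    and "simple_root_system.dominant_weight \<Phi> \<alpha> \<Lambda>"
  shows "simple_root_system.affine_crystal \<Phi> \<alpha> (simple_root_system.QLS \<Phi> \<alpha> \<Lambda>) \<and>
    simple_root_system.affine_crystal \<Phi> \<alpha> (simple_root_system.LS_cl \<Phi> \<alpha> \<Lambda>) \<and>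
    (\<exists>\<Psi>. simple_root_system.affine_crystal_iso \<Phi> \<alpha>
      (simple_root_system.QLS \<Phi> \<alpha> \<Lambda>) (simple_root_system.LS_cl \<Phi> \<alpha> \<Lambda>) \<Psi>)"
proof -
  interpret dominant_root_system \<Phi> \<alpha> \<Lambda>
    using assms by (simp add: dominant_root_system_def dominant_root_system_axioms_def)
  have "affine_crystal_iso chain_paths chain_paths id"
    by (simp add: affine_crystal_iso_def option.map_id0)
  then show ?thesis using affine_crystal_chain_paths unfolding QLS_eq LS_cl_eq by blast
qed

end
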